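(* Let $\mathscr F$ be a toric reflexive sheaf on a smooth toric DM stack $\mathcal X$. If on some open chart $\mathscr U_\sigma$ ($\sigma$ a top-dimensional cone) the $S$-family $\hat F^\sigma$ corresponding to $\mathscr F|_{\mathscr U_\sigma}$ has at least two (nonzero) box summands, then $\mathscr F$ is equivariantly decomposable into toric subsheaves of smaller rank.
   Context: $\mathcal X$ is given by a stacky fan $(N,\Sigma,\beta)$: $N$ a finitely generated abelian group of rank $d$, $\Sigma$ a rational simplicial fan in $N_{\mathbb Q}$ with rays $\rho_1,\dots,\rho_n$ spanning $N_{\mathbb Q}$, $\beta:\mathbb Z^n\to N$ with finite cokernel and the image of $\beta(e_i)$ in $N_{\mathbb Q}$ generating $\rho_i$; $\mathcal X=[Z/G]$ with $G=\mathrm{Hom}(DG(\beta),\mathbb C^* )$, $DG(\beta)=H^1(\mathrm{Cone}(\beta)^* )$, $Z=\mathbb C^n\setminus V(\prod_{\rho_i\not\subseteq\sigma}x_i:\sigma\in\Sigma)$, and $G$ acting through characters $\alpha_1,\dots,\alpha_n$ dual to $\beta^\vee$. The torus $\mathbb T$ of dimension $d$ acts on $\mathcal X$. $\mathcal X$ is assumed covered by the open substacks $\mathscr U_\sigma\cong[\mathbb C^d/G_\sigma]$ of the top-dimensional cones $\sigma$, where $G_\sigma=\{g\in G:\alpha_i(g)=1\ \forall\rho_i\not\subseteq\sigma\}$ is finite; on such a chart $\mathbb T$ acts on the coordinates of $\mathbb C^d$ by linearly independent characters $m_1,\dots,m_d\in X(\mathbb T)$. A toric sheaf is a $\mathbb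 T$-equivariant coherent sheaf. The box of the chart is $B_\sigma(\mathbb T)=\{\sum_kq_km_k\in X(\mathbb T):q_k\in\mathbb Q,\ 0\le q_k<1\}$. The $S$-family $\hat F^\sigma$ of $\mathscr F|_{\mathscr U_\sigma}$ is the collection of $X(\mathbb T)$-weight spaces $F^\sigma(m)$ of the corresponding graded module on $\mathbb C^d$, together with the multiplication maps $F^\sigma(m)\to F^\sigma(m+m_k)$. For $b\in B_\sigma(\mathbb T)$ the box summand ${}_b\hat F^\sigma$ is the sub-$S$-family with spaces ${}_bF^\sigma(\lambda)=F^\sigma(b+\sum_k\lambda_km_k)$, $\lambda\in\mathbb Z^d$; the corresponding sheaf decomposes as the direct sum over $b\in B_\sigma(\mathbb T)$ of these summands. Equivariantly decomposable means isomorphic, as a toric sheaf, to a direct sum of nonzero toric subsheaves of smaller rank. *)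

theory Defs
  imports Complex_Main "HOL-Algebra.Algebra"
begin

section \<open>Coherent sheaves of modules on varieties, with a linearisation\<close>

text \<open>
  A variety is given by its closed points together with an algebra of global functions such that
  the zero loci of the latter are the Zariski closed sets (a quasi-affine variety).
  Regular functions are those that are locally quotients of members of the algebra.
\<close>

inductive_set function_algebra :: "('p \<Rightarrow> complex) set \<Rightarrow> ('p \<Rightarrow> complex) set"
  for S :: "('p \<Rightarrow> complex) set" where
    const: "(\<lambda>_. c) \<in> function_algebra S"
  | gen: "f \<in> S \<Longrightarrow> f \<in> function_algebra S"
  | add: "f \<in> function_algebra S \<Longrightarrow> g \<in> function_algebra S
      \<Longrightarrow> (\<lambda>x. f x + g x) \<in> function_algebra S"
  | mult: "f \<in> function_algebra S \<Longrightarrow> g \<in> function_algebra S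
      \<Longrightarrow> (\<lambda>x. f x * g x) \<in> function_algebra S"

record 'p variety =
  points :: "'p set"
  funs :: "('p \<Rightarrow> complex) set"

definition zopen :: "'p variety \<Rightarrow> 'p set \<Rightarrow> bool" where
  "zopen Z U \<longleftrightarrow> (\<exists>P \<subseteq> funs Z. U = {x \<in> points Z. \<exists>f\<in>P. f x \<noteq> 0})"

definition regular :: "'p variety \<Rightarrow> 'p set \<Rightarrow> ('p \<Rightarrow> complex) set" where
  "regular Z U = {f \<in> extensional U. \<forall>x\<in>U. \<exists>V. zopen Z V \<and> x \<in> V \<and> V \<subseteq> U \<and>
     (\<exists>p\<in>funs Z. \<exists>q\<in>funs Z. \<forall>y\<in>V. q y \<noteq> 0 \<and> f y = p y / q y)}"

definition str_ring :: "'p variety \<Rightarrow> 'p set \<Rightarrow> ('p \<Rightarrow> complex) ring" where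
  "str_ring Z U = \<lparr>carrier = regular Z U,
     monoid.mult = (\<lambda>f g. \<lambda>x\<in>U. f x * g x), monoid.one = (\<lambda>x\<in>U. 1),
     ring.zero = (\<lambda>x\<in>U. 0), ring.add = (\<lambda>f g. \<lambda>x\<in>U. f x + g x)\<rparr>"

text \<open>The ring multiplication and unit carried by the library's record type of modules
  have no meaning for the modules of sections below.\<close>

record ('p, 'm) osheaf =
  sect :: "'p set \<Rightarrow> ('p \<Rightarrow> complex, 'm) module"
  res :: "'p set \<Rightarrow> 'p set \<Rightarrow> 'm \<Rightarrow> 'm"

definition module_sheaf :: "'p variety \<Rightarrow> ('p, 'm, 'z) osheaf_scheme \<Rightarrow> bool" where
  "module_sheaf Z F \<longleftrightarrow>
     (\<forall>U. zopen Z U \<longrightarrow> Module.module (str_ring Z U) (sect F U)) \<and>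
     (\<forall>U V. zopen Z U \<and> zopen Z V \<and> V \<subseteq> U \<longrightarrow>
        (\<forall>s\<in>carrier (sect F U). res F U V s \<in> carrier (sect F V)) \<and>
        (\<forall>s\<in>carrier (sect F U). \<forall>t\<in>carrier (sect F U).
           res F U V (s \<oplus>\<^bsub>sect F U\<^esub> t) = res F U V s \<oplus>\<^bsub>sect F V\<^esub> res F U V t) \<and>
        (\<forall>f\<in>regular Z U. \<forall>s\<in>carrier (sect F U).
           res F U V (f \<odot>\<^bsub>sect F U\<^esub> s) = restrict f V \<odot>\<^bsub>sect F V\<^esub> res F U V s)) \<and>
     (\<forall>U. zopen Z U \<longrightarrow> (\<forall>s\<in>carrier (sect F U). res F U U s = s)) \<and>
     (\<forall>U V W. zopen Z U \<and> zopen Z V \<and> zopen Z W \<and> W \<subseteq> V \<and> V \<subseteq> U \<longrightarrow>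
        (\<forall>s\<in>carrier (sect F U). res F V W (res F U V s) = res F U W s)) \<and>
     (\<forall>C s. (\<forall>V\<in>C. zopen Z V \<and> s V \<in> carrier (sect F V)) \<and>
        (\<forall>V\<in>C. \<forall>W\<in>C. res F V (V \<inter> W) (s V) = res F W (V \<inter> W) (s W)) \<longrightarrow>
        (\<exists>!t. t \<in> carrier (sect F (\<Union>C)) \<and> (\<forall>V\<in>C. res F (\<Union>C) V t = s V)))"

text \<open>The section \<open>\<Sum>\<^sub>i c\<^sub>i s\<^sub>i|\<^sub>W\<close> over \<open>W\<close>, for sections \<open>s\<^sub>0,\<dots>,s\<^bsub>k-1\<^esub>\<close> over \<open>U\<close>.\<close>

definition lincomb ::
  "('p, 'm, 'z) osheaf_scheme \<Rightarrow> 'p set \<Rightarrow> 'p set \<Rightarrow> nat \<Rightarrow> (nat \<Rightarrow> 'p \<Rightarrow> complex) \<Rightarrow> (nat \<Rightarrow> 'm) \<Rightarrow> 'm"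
where
  "lincomb F U W k c s = finsum (sect F W) (\<lambda>i. c i \<odot>\<^bsub>sect F W\<^esub> res F U W (s i)) {..<k}"

text \<open>Coherence: \<open>F\<close> is of finite type, and so is the kernel of every morphism
  \<open>O\<^sup>k|\<^sub>U \<rightarrow> F|\<^sub>U\<close>.\<close>

definition finite_type :: "'p variety \<Rightarrow> ('p, 'm, 'z) osheaf_scheme \<Rightarrow> bool" where
  "finite_type Z F \<longleftrightarrow> (\<forall>x\<in>points Z. \<exists>U k s. zopen Z U \<and> x \<in> U \<and>
     (\<forall>i<k. s i \<in> carrier (sect F U)) \<and>
     (\<forall>V f y. zopen Z V \<and> V \<subseteq> U \<and> f \<in> carrier (sect F V) \<and> y \<in> V \<longrightarrow>
        (\<exists>W c. zopen Z W \<and> y \<in> W \<and> W \<subseteq> V \<and> (\<forall>i<k. c i \<in> regular Z W) \<and>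
           res F V W f = lincomb F U W k c s)))"

definition relations_finite_type :: "'p variety \<Rightarrow> ('p, 'm, 'z) osheaf_scheme \<Rightarrow> bool" where
  "relations_finite_type Z F \<longleftrightarrow> (\<forall>U k s. zopen Z U \<and> (\<forall>i<k. s i \<in> carrier (sect F U)) \<longrightarrow>
     (\<forall>x\<in>U. \<exists>V (l::nat) r. zopen Z V \<and> x \<in> V \<and> V \<subseteq> U \<and>
        (\<forall>j<l. (\<forall>i<k. r j i \<in> regular Z V) \<and> lincomb F U V k (r j) s = \<zero>\<^bsub>sect F V\<^esub>) \<and>
        (\<forall>W c y. zopen Z W \<and> W \<subseteq> V \<and> y \<in> W \<and> (\<forall>i<k. c i \<in> regular Z W) \<and>
           lincomb F U W k c s = \<zero>\<^bsub>sect F W\<^esub> \<longrightarrow>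
           (\<exists>W' a. zopen Z W' \<and> y \<in> W' \<and> W' \<subseteq> W \<and> (\<forall>j<l. a j \<in> regular Z W') \<and>
              (\<forall>i<k. \<forall>z\<in>W'. c i z = (\<Sum>j<l. a j z * r j i z))))))"

definition coherent :: "'p variety \<Rightarrow> ('p, 'm, 'z) osheaf_scheme \<Rightarrow> bool" where
  "coherent Z F \<longleftrightarrow> module_sheaf Z F \<and> finite_type Z F \<and> relations_finite_type Z F"

text \<open>The dual sheaf: its sections over \<open>U\<close> are the morphisms \<open>F|\<^sub>U \<rightarrow> O|\<^sub>U\<close>, made extensional
  so that a morphism is a unique family of functions.\<close>

definition dual_sections ::
  "'p variety \<Rightarrow> ('p, 'm, 'z) osheaf_scheme \<Rightarrow> 'p set \<Rightarrow> ('p set \<Rightarrow> 'm \<Rightarrow> 'p \<Rightarrow> complex) set"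
where
  "dual_sections Z F U = {\<phi> \<in> extensional {V. zopen Z V \<and> V \<subseteq> U}.
     (\<forall>V. zopen Z V \<and> V \<subseteq> U \<longrightarrow>
        \<phi> V \<in> carrier (sect F V) \<rightarrow>\<^sub>E regular Z V \<and>
        (\<forall>s\<in>carrier (sect F V). \<forall>t\<in>carrier (sect F V).
           \<phi> V (s \<oplus>\<^bsub>sect F V\<^esub> t) = (\<lambda>x\<in>V. \<phi> V s x + \<phi> V t x)) \<and>
        (\<forall>f\<in>regular Z V. \<forall>s\<in>carrier (sect F V).
           \<phi> V (f \<odot>\<^bsub>sect F V\<^esub> s) = (\<lambda>x\<in>V. f x * \<phi> V s x)) \<and>
        (\<forall>W. zopen Z W \<and> W \<subseteq> V \<longrightarrow>
           (\<forall>s\<in>carrier (sect F V). \<phi> W (res F V W s) = restrict (\<phi> V s) W)))}"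

definition dual_sheaf ::
  "'p variety \<Rightarrow> ('p, 'm, 'z) osheaf_scheme \<Rightarrow> ('p, 'p set \<Rightarrow> 'm \<Rightarrow> 'p \<Rightarrow> complex) osheaf"
where
  "dual_sheaf Z F =
     \<lparr>sect = (\<lambda>U. let
          E = (\<lambda>g. \<lambda>V\<in>{V. zopen Z V \<and> V \<subseteq> U}. \<lambda>s\<in>carrier (sect F V). \<lambda>x\<in>V. g V s x) in
        \<lparr>carrier = dual_sections Z F U, monoid.mult = undefined, monoid.one = undefined,
         ring.zero = E (\<lambda>V s x. 0), ring.add = (\<lambda>\<phi> \<psi>. E (\<lambda>V s x. \<phi> V s x + \<psi> V s x)),
         smult = (\<lambda>f \<phi>. E (\<lambda>V s x. f x * \<phi> V s x))\<rparr>),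
      res = (\<lambda>U V \<phi>. restrict \<phi> {W. zopen Z W \<and> W \<subseteq> V})\<rparr>"

text \<open>The canonical map \<open>F \<rightarrow> F\<^sup>*\<^sup>*\<close> on sections over \<open>U\<close>.\<close>

definition bidual_map ::
  "'p variety \<Rightarrow> ('p, 'm, 'z) osheaf_scheme \<Rightarrow> 'p set \<Rightarrow> 'm \<Rightarrow>
     'p set \<Rightarrow> ('p set \<Rightarrow> 'm \<Rightarrow> 'p \<Rightarrow> complex) \<Rightarrow> 'p \<Rightarrow> complex"
where
  "bidual_map Z F U s =
     (\<lambda>V\<in>{V. zopen Z V \<and> V \<subseteq> U}. \<lambda>\<phi>\<in>dual_sections Z F V. \<phi> V (res F U V s))"

definition reflexive_sheaf :: "'p variety \<Rightarrow> ('p, 'm, 'z) osheaf_scheme \<Rightarrow> bool" where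
  "reflexive_sheaf Z F \<longleftrightarrow> coherent Z F \<and>
     (\<forall>U. zopen Z U \<longrightarrow> bij_betw (bidual_map Z F U) (carrier (sect F U))
        (carrier (sect (dual_sheaf Z (dual_sheaf Z F)) U)))"

definition zero_sheaf :: "'p variety \<Rightarrow> ('p, 'm, 'z) osheaf_scheme \<Rightarrow> bool" where
  "zero_sheaf Z F \<longleftrightarrow> (\<forall>U. zopen Z U \<longrightarrow> carrier (sect F U) = {\<zero>\<^bsub>sect F U\<^esub>})"

text \<open>Rank on an irreducible variety: the dimension of the generic stalk over the function field,
  i.e. the largest number of germs that are linearly independent.  Finitely many germs are
  represented over one nonempty open \<open>U\<close>, the coefficients of a relation and the vanishing
  of its value are represented over some smaller nonempty open \<open>V\<close>.\<close>

definition generically_independent ::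
  "'p variety \<Rightarrow> ('p, 'm, 'z) osheaf_scheme \<Rightarrow> 'p set \<Rightarrow> nat \<Rightarrow> (nat \<Rightarrow> 'm) \<Rightarrow> bool"
where
  "generically_independent Z F U k s \<longleftrightarrow>
     (\<forall>V c. zopen Z V \<and> V \<noteq> {} \<and> V \<subseteq> U \<and> (\<forall>i<k. c i \<in> regular Z V) \<and>
        lincomb F U V k c s = \<zero>\<^bsub>sect F V\<^esub> \<longrightarrow> (\<forall>i<k. \<forall>x\<in>V. c i x = 0))"

definition sheaf_rank :: "'p variety \<Rightarrow> ('p, 'm, 'z) osheaf_scheme \<Rightarrow> nat" where
  "sheaf_rank Z F = Sup {k. \<exists>U s. zopen Z U \<and> U \<noteq> {} \<and>
     (\<forall>i<k. s i \<in> carrier (sect F U)) \<and> generically_independent Z F U k s}"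

text \<open>
  A linearisation with respect to an action \<open>a : H \<times> Z \<rightarrow> Z\<close> of a commutative linear algebraic
  group \<open>H\<close>, whose regular functions are specified by making \<open>H \<times> Z\<close> a variety \<open>HZ\<close>.
  An isomorphism \<open>\<Phi> : a\<^sup>*F \<cong> pr\<^sub>2\<^sup>*F\<close> satisfying the cocycle condition is given by its restrictions
  \<open>h\<^sup>*F \<cong> F\<close> to the slices \<open>{h} \<times> Z\<close>, that is, by the maps \<open>lin F h U : F(U) \<rightarrow> F(h\<^sup>-\<^sup>1U)\<close>
  (\<open>H\<close> is reduced).  The last clause says that these fit together to a morphism over \<open>H \<times> Z\<close>:
  locally on \<open>H \<times> Z\<close> the pulled back section is \<open>\<Sum>\<^sub>j f\<^sub>j \<otimes> pr\<^sub>2\<^sup>-\<^sup>1 s\<^sub>j\<close> with \<open>f\<^sub>j\<close> regular.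
\<close>

record ('p, 'm, 'h) linsheaf = "('p, 'm) osheaf" +
  lin :: "'h \<Rightarrow> 'p set \<Rightarrow> 'm \<Rightarrow> 'm"

definition preim :: "'p variety \<Rightarrow> ('h \<Rightarrow> 'p \<Rightarrow> 'p) \<Rightarrow> 'h \<Rightarrow> 'p set \<Rightarrow> 'p set" where
  "preim Z a h U = {x \<in> points Z. a h x \<in> U}"

definition linearised ::
  "'h monoid \<Rightarrow> ('h \<times> 'p) variety \<Rightarrow> 'p variety \<Rightarrow> ('h \<Rightarrow> 'p \<Rightarrow> 'p) \<Rightarrow> ('p, 'm, 'h) linsheaf \<Rightarrow> bool"
where
  "linearised H HZ Z a F \<longleftrightarrow>
     (\<forall>h\<in>carrier H. \<forall>U. zopen Z U \<longrightarrow>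
        (\<forall>s\<in>carrier (sect F U). lin F h U s \<in> carrier (sect F (preim Z a h U))) \<and>
        (\<forall>s\<in>carrier (sect F U). \<forall>t\<in>carrier (sect F U).
           lin F h U (s \<oplus>\<^bsub>sect F U\<^esub> t) = lin F h U s \<oplus>\<^bsub>sect F (preim Z a h U)\<^esub> lin F h U t) \<and>
        (\<forall>f\<in>regular Z U. \<forall>s\<in>carrier (sect F U).
           lin F h U (f \<odot>\<^bsub>sect F U\<^esub> s) =
             (\<lambda>x\<in>preim Z a h U. f (a h x)) \<odot>\<^bsub>sect F (preim Z a h U)\<^esub> lin F h U s) \<and>
        (\<forall>V. zopen Z V \<and> V \<subseteq> U \<longrightarrow> (\<forall>s\<in>carrier (sect F U).
           lin F h V (res F U V s) = res F (preim Z a h U) (preim Z a h V) (lin F h U s)))) \<and>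
     (\<forall>U. zopen Z U \<longrightarrow> (\<forall>s\<in>carrier (sect F U).
        lin F \<one>\<^bsub>H\<^esub> U s = s \<and>
        (\<forall>h\<in>carrier H. \<forall>h'\<in>carrier H.
           lin F (h \<otimes>\<^bsub>H\<^esub> h') U s = lin F h' (preim Z a h U) (lin F h U s)))) \<and>
     (\<forall>U s h0 x0. zopen Z U \<and> s \<in> carrier (sect F U) \<and> h0 \<in> carrier H \<and> x0 \<in> points Z \<and>
        a h0 x0 \<in> U \<longrightarrow>
        (\<exists>\<Omega> V k f t. zopen HZ \<Omega> \<and> (h0, x0) \<in> \<Omega> \<and> zopen Z V \<and>
           (\<forall>h x. (h, x) \<in> \<Omega> \<longrightarrow> x \<in> V \<and> a h x \<in> U) \<and>
           (\<forall>j<k. f j \<in> regular HZ \<Omega> \<and> t j \<in> carrier (sect F V)) \<and>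
           (\<forall>h\<in>carrier H. res F (preim Z a h U) {x. (h, x) \<in> \<Omega>} (lin F h U s) =
              lincomb F V {x. (h, x) \<in> \<Omega>} k (\<lambda>j. \<lambda>x\<in>{x. (h, x) \<in> \<Omega>}. f j (h, x)) t)))"


section \<open>Fans\<close>

definition conic_hull :: "(rat \<Rightarrow> 'v::ab_group_add \<Rightarrow> 'v) \<Rightarrow> 'v set \<Rightarrow> 'v set" where
  "conic_hull scale S = {(\<Sum>v\<in>S. scale (c v) v) | c. \<forall>v\<in>S. 0 \<le> c v}"

definition simplicial_cone :: "(rat \<Rightarrow> 'v::ab_group_add \<Rightarrow> 'v) \<Rightarrow> 'v set \<Rightarrow> bool" where
  "simplicial_cone scale \<sigma> \<longleftrightarrow>
     (\<exists>S. finite S \<and> \<not> Modules.module.dependent scale S \<and> \<sigma> = conic_hull scale S)"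

definition cone_face :: "(rat \<Rightarrow> 'v::ab_group_add \<Rightarrow> 'v) \<Rightarrow> 'v set \<Rightarrow> 'v set \<Rightarrow> bool" where
  "cone_face scale \<tau> \<sigma> \<longleftrightarrow>
     (\<exists>u. Vector_Spaces.linear scale (*) u \<and> (\<forall>x\<in>\<sigma>. 0 \<le> u x) \<and> \<tau> = {x \<in> \<sigma>. u x = 0})"

text \<open>Over a rational vector space, polyhedral cones are automatically rational.\<close>

definition simplicial_fan :: "(rat \<Rightarrow> 'v::ab_group_add \<Rightarrow> 'v) \<Rightarrow> 'v set set \<Rightarrow> bool" where
  "simplicial_fan scale \<Sigma> \<longleftrightarrow> finite \<Sigma> \<and> \<Sigma> \<noteq> {} \<and>
     (\<forall>\<sigma>\<in>\<Sigma>. simplicial_cone scale \<sigma> \<and> (\<forall>\<tau>. cone_face scale \<tau> \<sigma> \<longrightarrow> \<tau> \<in> \<Sigma>)) \<and>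
     (\<forall>\<sigma>\<in>\<Sigma>. \<forall>\<tau>\<in>\<Sigma>. cone_face scale (\<sigma> \<inter> \<tau>) \<sigma> \<and> cone_face scale (\<sigma> \<inter> \<tau>) \<tau>)"


section \<open>Stacky fans\<close>

definition Zpow :: "nat \<Rightarrow> (nat \<Rightarrow> int) monoid" where
  "Zpow k = product_group {..<k} (\<lambda>_. integer_group)"

definition unit_vec :: "nat \<Rightarrow> nat \<Rightarrow> nat \<Rightarrow> int" where
  "unit_vec k i = (\<lambda>j\<in>{..<k}. if j = i then 1 else 0)"

definition Cstar :: "complex monoid" where
  "Cstar = \<lparr>carrier = UNIV - {0}, monoid.mult = (*), monoid.one = 1\<rparr>"

definition hom_group :: "('a, 'c) monoid_scheme \<Rightarrow> ('b, 'e) monoid_scheme \<Rightarrow> ('a \<Rightarrow> 'b) monoid" where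
  "hom_group A B = \<lparr>carrier = hom A B \<inter> extensional (carrier A),
     monoid.mult = (\<lambda>f g. \<lambda>x\<in>carrier A. f x \<otimes>\<^bsub>B\<^esub> g x), monoid.one = (\<lambda>x\<in>carrier A. \<one>\<^bsub>B\<^esub>)\<rparr>"

text \<open>
  The rational vector space \<open>N\<^sub>\<rat>\<close> is the type \<open>'v\<close> with scalar multiplication \<open>scaleQ\<close>, and
  \<open>toQ\<close> is the canonical map from \<open>N\<close>.  The rays are numbered from \<open>0\<close>.
\<close>

record ('g, 'v) stacky_fan =
  lat :: "'g monoid"
  dimn :: nat
  nrays :: nat
  beta :: "(nat \<Rightarrow> int) \<Rightarrow> 'g"
  scaleQ :: "rat \<Rightarrow> 'v \<Rightarrow> 'v"
  toQ :: "'g \<Rightarrow> 'v"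
  fan :: "'v set set"
  ray :: "nat \<Rightarrow> 'v set"

definition cone_dim :: "('g, 'v::ab_group_add, 'z) stacky_fan_scheme \<Rightarrow> 'v set \<Rightarrow> nat" where
  "cone_dim St \<sigma> = vector_space.dim (scaleQ St) \<sigma>"

text \<open>The conditions on \<open>toQ\<close> characterise the map \<open>N \<rightarrow> N \<otimes> \<rat>\<close>: its kernel is the torsion
  subgroup, and every vector has a positive multiple in the image.\<close>

definition is_stacky_fan :: "('g, 'v::ab_group_add, 'z) stacky_fan_scheme \<Rightarrow> bool" where
  "is_stacky_fan St \<longleftrightarrow>
     comm_group (lat St) \<and>
     (\<exists>S. finite S \<and> S \<subseteq> carrier (lat St) \<and> generate (lat St) S = carrier (lat St)) \<and>
     vector_space (scaleQ St) \<and>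
     (\<forall>x\<in>carrier (lat St). \<forall>y\<in>carrier (lat St). toQ St (x \<otimes>\<^bsub>lat St\<^esub> y) = toQ St x + toQ St y) \<and>
     (\<forall>x\<in>carrier (lat St). toQ St x = 0 \<longleftrightarrow> (\<exists>k::nat. k > 0 \<and> x [^]\<^bsub>lat St\<^esub> k = \<one>\<^bsub>lat St\<^esub>)) \<and>
     (\<forall>v. \<exists>k::nat. k > 0 \<and> (\<exists>x\<in>carrier (lat St). scaleQ St (of_nat k) v = toQ St x)) \<and>
     cone_dim St UNIV = dimn St \<and>
     simplicial_fan (scaleQ St) (fan St) \<and>
     bij_betw (ray St) {..<nrays St} {\<sigma> \<in> fan St. cone_dim St \<sigma> = 1} \<and>
     Modules.module.span (scaleQ St) (\<Union>i<nrays St. ray St i) = UNIV \<and>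
     beta St \<in> hom (Zpow (nrays St)) (lat St) \<and>
     finite (carrier (lat St Mod (beta St ` carrier (Zpow (nrays St))))) \<and>
     (\<forall>i<nrays St. ray St i = conic_hull (scaleQ St) {toQ St (beta St (unit_vec (nrays St) i))})"

definition top_cones :: "('g, 'v::ab_group_add, 'z) stacky_fan_scheme \<Rightarrow> 'v set set" where
  "top_cones St = {\<sigma> \<in> fan St. cone_dim St \<sigma> = dimn St}"

text \<open>
  To compute \<open>DG(\<beta>) = H\<^sup>1(Cone(\<beta>)\<^sup>*)\<close> we choose a free resolution
  \<open>0 \<rightarrow> \<int>\<^sup>r \<rightarrow> \<int>\<^sup>p \<rightarrow> N \<rightarrow> 0\<close> with maps \<open>rmap\<close>, \<open>pmap\<close>, and a lift \<open>blift : \<int>\<^sup>n \<rightarrow> \<int>\<^sup>p\<close> of \<open>\<beta>\<close>.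
  Then \<open>Cone(\<beta>)\<close> is the complex \<open>\<int>\<^sup>n \<oplus> \<int>\<^sup>r \<rightarrow> \<int>\<^sup>p\<close>, and \<open>H\<^sup>1\<close> of its dual is the cokernel
  of \<open>(\<int>\<^sup>p)\<^sup>* \<rightarrow> (\<int>\<^sup>n \<oplus> \<int>\<^sup>r)\<^sup>*\<close>.
\<close>

record ('g, 'v) resolved_fan = "('g, 'v) stacky_fan" +
  ngens :: nat
  nrels :: nat
  pmap :: "(nat \<Rightarrow> int) \<Rightarrow> 'g"
  rmap :: "(nat \<Rightarrow> int) \<Rightarrow> nat \<Rightarrow> int"
  blift :: "(nat \<Rightarrow> int) \<Rightarrow> nat \<Rightarrow> int"

definition is_resolved :: "('g, 'v::ab_group_add, 'z) resolved_fan_scheme \<Rightarrow> bool" where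
  "is_resolved St \<longleftrightarrow>
     pmap St \<in> hom (Zpow (ngens St)) (lat St) \<and>
     pmap St ` carrier (Zpow (ngens St)) = carrier (lat St) \<and>
     rmap St \<in> hom (Zpow (nrels St)) (Zpow (ngens St)) \<and>
     inj_on (rmap St) (carrier (Zpow (nrels St))) \<and>
     rmap St ` carrier (Zpow (nrels St)) = {y \<in> carrier (Zpow (ngens St)). pmap St y = \<one>\<^bsub>lat St\<^esub>} \<and>
     blift St \<in> hom (Zpow (nrays St)) (Zpow (ngens St)) \<and>
     (\<forall>y\<in>carrier (Zpow (nrays St)). pmap St (blift St y) = beta St y)"

definition cone_src :: "('g, 'v, 'z) resolved_fan_scheme \<Rightarrow> ((nat \<Rightarrow> int) \<times> (nat \<Rightarrow> int)) monoid" where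
  "cone_src St = Zpow (nrays St) \<times>\<times> Zpow (nrels St)"

definition cone_map :: "('g, 'v, 'z) resolved_fan_scheme \<Rightarrow> (nat \<Rightarrow> int) \<times> (nat \<Rightarrow> int) \<Rightarrow> nat \<Rightarrow> int" where
  "cone_map St = (\<lambda>(y, z). blift St y \<otimes>\<^bsub>Zpow (ngens St)\<^esub> rmap St z)"

definition cone_dual_image ::
  "('g, 'v, 'z) resolved_fan_scheme \<Rightarrow> ((nat \<Rightarrow> int) \<times> (nat \<Rightarrow> int) \<Rightarrow> int) set" where
  "cone_dual_image St = (\<lambda>\<phi>. restrict (\<phi> \<circ> cone_map St) (carrier (cone_src St))) `
     carrier (hom_group (Zpow (ngens St)) integer_group)"

type_synonym dg = "((nat \<Rightarrow> int) \<times> (nat \<Rightarrow> int) \<Rightarrow> int) set"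

definition DG :: "('g, 'v, 'z) resolved_fan_scheme \<Rightarrow> dg monoid" where
  "DG St = hom_group (cone_src St) integer_group Mod cone_dual_image St"

text \<open>\<open>\<beta>\<^sup>\<or>(e\<^sub>i\<^sup>*)\<close>, for \<open>\<beta>\<^sup>\<or> : (\<int>\<^sup>n)\<^sup>* \<rightarrow> DG(\<beta>)\<close>.\<close>

definition beta_dual :: "('g, 'v, 'z) resolved_fan_scheme \<Rightarrow> nat \<Rightarrow> dg" where
  "beta_dual St i = cone_dual_image St #>\<^bsub>hom_group (cone_src St) integer_group\<^esub>
     (\<lambda>y\<in>carrier (cone_src St). fst y i)"

definition Ggrp :: "('g, 'v, 'z) resolved_fan_scheme \<Rightarrow> (dg \<Rightarrow> complex) monoid" where
  "Ggrp St = hom_group (DG St) Cstar"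

definition alpha :: "('g, 'v, 'z) resolved_fan_scheme \<Rightarrow> nat \<Rightarrow> (dg \<Rightarrow> complex) \<Rightarrow> complex" where
  "alpha St i g = g (beta_dual St i)"


section \<open>The variety Z and the toric stack\<close>

type_synonym pt = "nat \<Rightarrow> complex"

definition Zpoints :: "('g, 'v, 'z) stacky_fan_scheme \<Rightarrow> pt set" where
  "Zpoints St = {z \<in> {..<nrays St} \<rightarrow>\<^sub>E UNIV.
     \<exists>\<sigma>\<in>fan St. (\<Prod>i\<in>{i. i < nrays St \<and> \<not> ray St i \<subseteq> \<sigma>}. z i) \<noteq> 0}"

definition Zvar :: "('g, 'v, 'z) stacky_fan_scheme \<Rightarrow> pt variety" where
  "Zvar St = \<lparr>points = Zpoints St, funs = function_algebra {(\<lambda>z. z i) | i. i < nrays St}\<rparr>"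

definition chart :: "('g, 'v, 'z) stacky_fan_scheme \<Rightarrow> 'v set \<Rightarrow> pt set" where
  "chart St \<sigma> = {z \<in> {..<nrays St} \<rightarrow>\<^sub>E UNIV. \<forall>i<nrays St. \<not> ray St i \<subseteq> \<sigma> \<longrightarrow> z i \<noteq> 0}"

text \<open>\<open>\<X> = [Z/G]\<close>, with the standing assumption that it is covered by the charts
  \<open>[chart St \<sigma> / G] = \<U>\<^sub>\<sigma>\<close> of the top-dimensional cones.\<close>

definition smooth_toric_DM_stack :: "('g, 'v::ab_group_add, 'z) resolved_fan_scheme \<Rightarrow> bool" where
  "smooth_toric_DM_stack St \<longleftrightarrow> is_stacky_fan St \<and> is_resolved St \<and>
     Zpoints St = (\<Union>\<sigma>\<in>top_cones St. chart St \<sigma>)"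


section \<open>The torus action\<close>

text \<open>
  The torus \<open>\<T> = (\<complex>\<^sup>*)\<^sup>d\<close> acts on \<open>Z\<close> through characters \<open>tchar St i\<close>, commuting with \<open>G\<close>, and hence
  on \<open>[Z/G]\<close>.  The slice \<open>\<complex>\<^sup>d = {z. z\<^sub>i = 1 for \<rho>\<^sub>i \<not>\<subseteq> \<sigma>}\<close> of \<open>chart St \<sigma>\<close> induces
  \<open>[\<complex>\<^sup>d/G\<^sub>\<sigma>] \<cong> [chart St \<sigma> / G]\<close>.  That \<open>\<T>\<close> acts on this \<open>\<complex>\<^sup>d\<close> means that there is a homomorphism
  \<open>\<T> \<rightarrow> G\<close> (given by the dual homomorphism \<open>clift St \<sigma> : DG(\<beta>) \<rightarrow> X(\<T>)\<close>) such that
  \<open>\<T> \<rightarrow> G \<times> \<T>\<close> preserves the slice.  Since \<open>G\<^sub>\<sigma>\<close> is finite and \<open>\<T>\<close> is connected,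
  \<open>clift St \<sigma>\<close> is unique.
\<close>

record ('g, 'v) toric_stack = "('g, 'v) resolved_fan" +
  tchar :: "nat \<Rightarrow> nat \<Rightarrow> int"
  clift :: "'v set \<Rightarrow> dg \<Rightarrow> nat \<Rightarrow> int"

definition torus :: "('g, 'v, 'z) stacky_fan_scheme \<Rightarrow> (nat \<Rightarrow> complex) monoid" where
  "torus St = product_group {..<dimn St} (\<lambda>_. Cstar)"

definition XT :: "('g, 'v, 'z) stacky_fan_scheme \<Rightarrow> (nat \<Rightarrow> int) monoid" where
  "XT St = Zpow (dimn St)"

definition charval :: "('g, 'v, 'z) stacky_fan_scheme \<Rightarrow> (nat \<Rightarrow> int) \<Rightarrow> (nat \<Rightarrow> complex) \<Rightarrow> complex" where
  "charval St m t = (\<Prod>j<dimn St. t j powi m j)"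

definition chart_char :: "('g, 'v, 'z) toric_stack_scheme \<Rightarrow> 'v set \<Rightarrow> nat \<Rightarrow> nat \<Rightarrow> int" where
  "chart_char St \<sigma> i = clift St \<sigma> (beta_dual St i) \<otimes>\<^bsub>XT St\<^esub> tchar St i"

definition cone_rays :: "('g, 'v, 'z) stacky_fan_scheme \<Rightarrow> 'v set \<Rightarrow> nat set" where
  "cone_rays St \<sigma> = {i. i < nrays St \<and> ray St i \<subseteq> \<sigma>}"

definition torus_action :: "('g, 'v::ab_group_add, 'z) toric_stack_scheme \<Rightarrow> bool" where
  "torus_action St \<longleftrightarrow>
     (\<forall>i<nrays St. tchar St i \<in> carrier (XT St)) \<and>
     (\<forall>\<sigma>\<in>top_cones St.
        clift St \<sigma> \<in> hom (DG St) (XT St) \<and>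
        (\<forall>i\<in>{..<nrays St} - cone_rays St \<sigma>. chart_char St \<sigma> i = \<one>\<^bsub>XT St\<^esub>) \<and>
        (\<forall>c::nat \<Rightarrow> int. (\<forall>j<dimn St. (\<Sum>i\<in>cone_rays St \<sigma>. c i * chart_char St \<sigma> i j) = 0) \<longrightarrow>
           (\<forall>i\<in>cone_rays St \<sigma>. c i = 0)))"

type_synonym gt = "(dg \<Rightarrow> complex) \<times> (nat \<Rightarrow> complex)"

definition GT :: "('g, 'v, 'z) toric_stack_scheme \<Rightarrow> gt monoid" where
  "GT St = Ggrp St \<times>\<times> torus St"

definition act :: "('g, 'v, 'z) toric_stack_scheme \<Rightarrow> gt \<Rightarrow> pt \<Rightarrow> pt" where
  "act St h z = (\<lambda>i\<in>{..<nrays St}. alpha St i (fst h) * charval St (tchar St i) (snd h) * z i)"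

text \<open>The coordinate ring of \<open>G\<close> is spanned by the evaluations at elements of \<open>DG(\<beta>)\<close>.\<close>

definition GTZ :: "('g, 'v, 'z) toric_stack_scheme \<Rightarrow> (gt \<times> pt) variety" where
  "GTZ St = \<lparr>points = carrier (GT St) \<times> Zpoints St,
     funs = function_algebra
       ({(\<lambda>((g, t), z). g x) | x. x \<in> carrier (DG St)} \<union>
        {(\<lambda>((g, t), z). t j) | j. j < dimn St} \<union>
        {(\<lambda>((g, t), z). inverse (t j)) | j. j < dimn St} \<union>
        {(\<lambda>((g, t), z). z i) | i. i < nrays St})\<rparr>"


section \<open>Toric sheaves\<close>

text \<open>Sheaves on \<open>[Z/G]\<close> are \<open>G\<close>-equivariant sheaves on \<open>Z\<close>; hence \<open>\<T>\<close>-equivariant ones are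
  \<open>(G \<times> \<T>)\<close>-equivariant sheaves on \<open>Z\<close>.  Coherence, reflexivity and rank are those on the
  atlas \<open>Z\<close>.\<close>

type_synonym 'm tsheaf = "(pt, 'm, gt) linsheaf"

definition toric_sheaf :: "('g, 'v::ab_group_add, 'z) toric_stack_scheme \<Rightarrow> 'm tsheaf \<Rightarrow> bool" where
  "toric_sheaf St F \<longleftrightarrow> coherent (Zvar St) F \<and> linearised (GT St) (GTZ St) (Zvar St) (act St) F"

definition toric_subsheaf ::
  "('g, 'v::ab_group_add, 'z) toric_stack_scheme \<Rightarrow> 'm tsheaf \<Rightarrow> 'm tsheaf \<Rightarrow> bool" where
  "toric_subsheaf St E F \<longleftrightarrow> toric_sheaf St E \<and>
     (\<forall>U. zopen (Zvar St) U \<longrightarrow>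
        carrier (sect E U) \<subseteq> carrier (sect F U) \<and>
        sect E U = (sect F U)\<lparr>carrier := carrier (sect E U)\<rparr> \<and>
        (\<forall>s\<in>carrier (sect E U).
           (\<forall>V. zopen (Zvar St) V \<and> V \<subseteq> U \<longrightarrow> res E U V s = res F U V s) \<and>
           (\<forall>h\<in>carrier (GT St). lin E h U s = lin F h U s)))"

definition direct_sum :: "nat \<Rightarrow> (nat \<Rightarrow> 'm tsheaf) \<Rightarrow> (nat \<Rightarrow> 'm) tsheaf" where
  "direct_sum k E =
     \<lparr>sect = (\<lambda>U. \<lparr>carrier = (\<Pi>\<^sub>E j\<in>{..<k}. carrier (sect (E j) U)),
         monoid.mult = undefined, monoid.one = undefined,
         ring.zero = (\<lambda>j\<in>{..<k}. \<zero>\<^bsub>sect (E j) U\<^esub>),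
         ring.add = (\<lambda>s t. \<lambda>j\<in>{..<k}. s j \<oplus>\<^bsub>sect (E j) U\<^esub> t j),
         smult = (\<lambda>f s. \<lambda>j\<in>{..<k}. f \<odot>\<^bsub>sect (E j) U\<^esub> s j)\<rparr>),
      res = (\<lambda>U V s. \<lambda>j\<in>{..<k}. res (E j) U V (s j)),
      lin = (\<lambda>h U s. \<lambda>j\<in>{..<k}. lin (E j) h U (s j))\<rparr>"

definition toric_iso ::
  "('g, 'v::ab_group_add, 'z) toric_stack_scheme \<Rightarrow> 'm tsheaf \<Rightarrow> 'k tsheaf \<Rightarrow> bool" where
  "toric_iso St E F \<longleftrightarrow> (\<exists>\<phi>. \<forall>U. zopen (Zvar St) U \<longrightarrow>
     bij_betw (\<phi> U) (carrier (sect E U)) (carrier (sect F U)) \<and>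
     (\<forall>s\<in>carrier (sect E U). \<forall>t\<in>carrier (sect E U).
        \<phi> U (s \<oplus>\<^bsub>sect E U\<^esub> t) = \<phi> U s \<oplus>\<^bsub>sect F U\<^esub> \<phi> U t) \<and>
     (\<forall>f\<in>regular (Zvar St) U. \<forall>s\<in>carrier (sect E U).
        \<phi> U (f \<odot>\<^bsub>sect E U\<^esub> s) = f \<odot>\<^bsub>sect F U\<^esub> \<phi> U s) \<and>
     (\<forall>s\<in>carrier (sect E U).
        (\<forall>V. zopen (Zvar St) V \<and> V \<subseteq> U \<longrightarrow> \<phi> V (res E U V s) = res F U V (\<phi> U s)) \<and>
        (\<forall>h\<in>carrier (GT St).
           \<phi> (preim (Zvar St) (act St) h U) (lin E h U s) = lin F h U (\<phi> U s))))"

definition equivariantly_decomposable ::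
  "('g, 'v::ab_group_add, 'z) toric_stack_scheme \<Rightarrow> 'm tsheaf \<Rightarrow> bool" where
  "equivariantly_decomposable St F \<longleftrightarrow> (\<exists>k E. k \<ge> 2 \<and>
     (\<forall>j<k. toric_subsheaf St (E j) F \<and> \<not> zero_sheaf (Zvar St) (E j) \<and>
        sheaf_rank (Zvar St) (E j) < sheaf_rank (Zvar St) F) \<and>
     toric_iso St F (direct_sum k E))"


section \<open>S-families and boxes\<close>

text \<open>The homomorphism \<open>\<T> \<rightarrow> G \<times> \<T>\<close> through which \<open>\<T>\<close> acts on the slice \<open>\<complex>\<^sup>d\<close>.\<close>

definition slice_elt :: "('g, 'v, 'z) toric_stack_scheme \<Rightarrow> 'v set \<Rightarrow> (nat \<Rightarrow> complex) \<Rightarrow> gt" where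
  "slice_elt St \<sigma> t = ((\<lambda>x\<in>carrier (DG St). charval St (clift St \<sigma> x) t), t)"

text \<open>\<open>I M\<close> for \<open>M = F(chart St \<sigma>)\<close> and \<open>I = (z\<^sub>i - 1 | \<rho>\<^sub>i \<not>\<subseteq> \<sigma>)\<close> the ideal of the slice, so
  that \<open>M / I M\<close> is the module of global sections of the pullback of \<open>F\<close> to \<open>\<complex>\<^sup>d\<close>.\<close>

definition slice_submodule :: "('g, 'v, 'z) toric_stack_scheme \<Rightarrow> 'm tsheaf \<Rightarrow> 'v set \<Rightarrow> 'm set" where
  "slice_submodule St F \<sigma> =
     {finsum (sect F (chart St \<sigma>))
        (\<lambda>i. (\<lambda>z\<in>chart St \<sigma>. z i - 1) \<odot>\<^bsub>sect F (chart St \<sigma>)\<^esub> s i) ({..<nrays St} - cone_rays St \<sigma>) | s.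
      \<forall>i. s i \<in> carrier (sect F (chart St \<sigma>))}"

text \<open>The weight space \<open>F\<^sup>\<sigma>(m)\<close>, a set of cosets in \<open>M / I M\<close>.  \<open>\<T>\<close> acts on sections by pullback,
  so that multiplication by the coordinate \<open>z\<^sub>i\<close> has degree \<open>chart_char St \<sigma> i\<close>.\<close>

definition S_family ::
  "('g, 'v, 'z) toric_stack_scheme \<Rightarrow> 'm tsheaf \<Rightarrow> 'v set \<Rightarrow> (nat \<Rightarrow> int) \<Rightarrow> 'm set set" where
  "S_family St F \<sigma> m =
     {slice_submodule St F \<sigma> +>\<^bsub>sect F (chart St \<sigma>)\<^esub> s | s. s \<in> carrier (sect F (chart St \<sigma>)) \<and>
        (\<forall>t\<in>carrier (torus St). lin F (slice_elt St \<sigma> t) (chart St \<sigma>) s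
           \<ominus>\<^bsub>sect F (chart St \<sigma>)\<^esub>
           (\<lambda>z\<in>chart St \<sigma>. charval St m t) \<odot>\<^bsub>sect F (chart St \<sigma>)\<^esub> s \<in> slice_submodule St F \<sigma>)}"

definition box :: "('g, 'v, 'z) toric_stack_scheme \<Rightarrow> 'v set \<Rightarrow> (nat \<Rightarrow> int) set" where
  "box St \<sigma> = {b \<in> carrier (XT St). \<exists>q::nat \<Rightarrow> rat. (\<forall>i\<in>cone_rays St \<sigma>. 0 \<le> q i \<and> q i < 1) \<and>
     (\<forall>j<dimn St. of_int (b j) = (\<Sum>i\<in>cone_rays St \<sigma>. q i * of_int (chart_char St \<sigma> i j)))}"

text \<open>The coordinates of \<open>\<complex>\<^sup>d\<close> are indexed by \<open>cone_rays St \<sigma>\<close>; only these entries of \<open>l\<close> matter.\<close>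

definition box_summand :: "('g, 'v, 'z) toric_stack_scheme \<Rightarrow> 'm tsheaf \<Rightarrow> 'v set \<Rightarrow> (nat \<Rightarrow> int)
   \<Rightarrow> (nat \<Rightarrow> int) \<Rightarrow> 'm set set" where
  "box_summand St F \<sigma> b l =
     S_family St F \<sigma> (\<lambda>j\<in>{..<dimn St}. b j + (\<Sum>i\<in>cone_rays St \<sigma>. l i * chart_char St \<sigma> i j))"

definition nonzero_box_summand ::
  "('g, 'v, 'z) toric_stack_scheme \<Rightarrow> 'm tsheaf \<Rightarrow> 'v set \<Rightarrow> (nat \<Rightarrow> int) \<Rightarrow> bool" where
  "nonzero_box_summand St F \<sigma> b \<longleftrightarrow>
     (\<exists>l. box_summand St F \<sigma> b l \<noteq> {slice_submodule St F \<sigma>})"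

end

theory Submission
  imports Defs "HOL-Computational_Algebra.Polynomial" "HOL-Library.Real_Mod"
begin

text \<open>
  Distinct boxes \<open>b \<noteq> b'\<close> differ modulo the lattice spanned by the characters \<open>m\<^sub>k\<close> of the chart,
  so some torus element \<open>t\<close> of finite order satisfies \<open>m\<^sub>k(t) = 1\<close> for all \<open>k\<close> but \<open>b(t) \<noteq> b'(t)\<close>.
  Its image \<open>h\<close> in \<open>G \<times> \<T>\<close> acts trivially on all of \<open>Z\<close>, hence the linearisation of \<open>h\<close> is an
  \<open>\<O>\<close>-linear automorphism of \<open>F\<close> of finite order, commuting with \<open>G \<times> \<T>\<close>.  Its \<open>b(t)\<close>-eigensheaf
  and the complement split \<open>F\<close> globally; they are nonzero because the sections of the box summands
  \<open>b\<close> and \<open>b'\<close> have nonzero components in them.  Since \<open>F\<close> is reflexive it is torsion free, so nonzero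
  summands have positive rank, and ranks add up.
\<close>

section \<open>Opens and regular functions\<close>

text \<open>The boxes are seen on a single chart, whereas the splitting must exist on all of
  \<open>Z\<close>. The bridge is the formula for the action of
  \<open>slice_elt St \<sigma> t\<close>: it rescales the coordinates of every point of
  \<open>Z\<close> by the values \<open>charval St (chart_char St \<sigma> i) t\<close>. These
  characters are trivial for rays outside \<sigma>, and \<open>t\<close> is chosen to kill those
  inside, so nothing is left to act. A weight vector of the S-family is a coset modulo the multiples
  of the slice ideal, so a representing section is an eigenvector only modulo this submodule. The
  submodule is stable under every \<O>-linear endomorphism, hence the eigenprojection can be
  compared with its effect on the quotient. Finite order makes this projection a finite sum of
  powers, which exists on every module of sections. For the strict inequality of ranks it is enough
  to enlarge a maximal independent family of one summand by one nonzero section of the other. That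
  maximal families exist rests on irreducibility of \<open>Z\<close>: every nonempty open set meets
  a neighbourhood of one chosen point on which finitely many sections generate.\<close>

text \<open>Nonvanishing loci of single functions form a basis of the topology. In this pointwise
  form, openness of unions, intersections, preimages and slices needs only one function at each
  point.\<close>

lemma zopen_iff:
  "zopen Z U \<longleftrightarrow> U \<subseteq> points Z \<and>
     (\<forall>x\<in>U. \<exists>f\<in>funs Z. f x \<noteq> 0 \<and> (\<forall>y\<in>points Z. f y \<noteq> 0 \<longrightarrow> y \<in> U))" (is "_ \<longleftrightarrow> ?R")
proof
  assume "zopen Z U"
  then show ?R
    unfolding zopen_def by blast
next
  assume R: ?R
  let ?P = "{f \<in> funs Z. \<forall>y\<in>points Z. f y \<noteq> 0 \<longrightarrow> y \<in> U}"
  have "U = {x \<in> points Z. \<exists>f\<in>?P. f x \<noteq> 0}"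
    using R by blast
  then show "zopen Z U"
    unfolding zopen_def by (intro exI[of _ ?P]) blast
qed

lemma zopen_subset: "zopen Z U \<Longrightarrow> U \<subseteq> points Z"
  by (simp add: zopen_iff)

lemma zopen_Union: "(\<And>V. V \<in> C \<Longrightarrow> zopen Z V) \<Longrightarrow> zopen Z (\<Union>C)"
  unfolding zopen_iff by (metis Union_iff Sup_le_iff)

lemma regularD:
  assumes "f \<in> regular Z U" "x \<in> U"
  obtains V p q where "zopen Z V" "x \<in> V" "V \<subseteq> U" "p \<in> funs Z" "q \<in> funs Z"
    "\<forall>y\<in>V. q y \<noteq> 0 \<and> f y = p y / q y"
proof -
  from assms obtain V where "zopen Z V \<and> x \<in> V \<and> V \<subseteq> U \<and>
     (\<exists>p\<in>funs Z. \<exists>q\<in>funs Z. \<forall>y\<in>V. q y \<noteq> 0 \<and> f y = p y / q y)"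
    unfolding regular_def by blast
  then show thesis using that by blast
qed

lemma regularI:
  assumes "\<And>x. x \<in> U \<Longrightarrow> \<exists>V p q. zopen Z V \<and> x \<in> V \<and> V \<subseteq> U \<and> p \<in> funs Z \<and> q \<in> funs Z \<and>
    (\<forall>y\<in>V. q y \<noteq> 0 \<and> f y = p y / q y)"
  shows "restrict f U \<in> regular Z U"
  unfolding regular_def
proof (intro CollectI conjI ballI restrict_extensional)
  fix x assume x: "x \<in> U"
  then obtain V p q where V: "zopen Z V" "x \<in> V" "V \<subseteq> U" "p \<in> funs Z" "q \<in> funs Z"
    "\<forall>y\<in>V. q y \<noteq> 0 \<and> f y = p y / q y"
    using assms by blast
  have "\<forall>y\<in>V. q y \<noteq> 0 \<and> restrict f U y = p y / q y"
    using V(3,6) by auto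
  then show "\<exists>V. zopen Z V \<and> x \<in> V \<and> V \<subseteq> U \<and>
     (\<exists>p\<in>funs Z. \<exists>q\<in>funs Z. \<forall>y\<in>V. q y \<noteq> 0 \<and> restrict f U y = p y / q y)"
    using V by blast
qed

lemma regular_extensional: "f \<in> regular Z U \<Longrightarrow> f \<in> extensional U"
  by (simp add: regular_def)

locale affine_funs =
  fixes Z :: "'p variety" and S :: "('p \<Rightarrow> complex) set"
  assumes funs_eq: "funs Z = function_algebra S"
begin

lemma funs_const: "(\<lambda>_. c) \<in> funs Z"
  and funs_add: "f \<in> funs Z \<Longrightarrow> g \<in> funs Z \<Longrightarrow> (\<lambda>x. f x + g x) \<in> funs Z"
  and funs_mult: "f \<in> funs Z \<Longrightarrow> g \<in> funs Z \<Longrightarrow> (\<lambda>x. f x * g x) \<in> funs Z"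
  by (simp_all add: funs_eq function_algebra.intros)

lemma zopen_Int: assumes "zopen Z U" "zopen Z V" shows "zopen Z (U \<inter> V)"
proof -
  have "\<exists>f\<in>funs Z. f x \<noteq> 0 \<and> (\<forall>y\<in>points Z. f y \<noteq> 0 \<longrightarrow> y \<in> U \<inter> V)" if x: "x \<in> U \<inter> V" for x
  proof -
    obtain f g where "f \<in> funs Z" "f x \<noteq> 0" "\<forall>y\<in>points Z. f y \<noteq> 0 \<longrightarrow> y \<in> U"
      "g \<in> funs Z" "g x \<noteq> 0" "\<forall>y\<in>points Z. g y \<noteq> 0 \<longrightarrow> y \<in> V"
      using assms x unfolding zopen_iff by blast
    then show ?thesis
      by (intro bexI[of _ "\<lambda>x. f x * g x"]) (auto simp: funs_mult)
  qed
  then show ?thesis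
    using assms by (auto simp: zopen_iff)
qed

text \<open>The index set is nonempty because the empty intersection is \<open>UNIV\<close>, which
  need not lie in \<open>points Z\<close>.\<close>

lemma zopen_INT:
  assumes "finite I" "I \<noteq> {}" "\<And>i. i \<in> I \<Longrightarrow> zopen Z (V i)"
  shows "zopen Z (\<Inter>i\<in>I. V i)"
  using assms by (induction I rule: finite_ne_induct) (auto simp: zopen_Int)

lemma zopen_points: "zopen Z (points Z)"
  unfolding zopen_iff by (auto intro!: bexI[of _ "\<lambda>_. 1"] funs_const)

lemma regular_fun: assumes "zopen Z U" "p \<in> funs Z" shows "restrict p U \<in> regular Z U"
proof (rule regularI)
  fix x assume "x \<in> U"
  then show "\<exists>V p' q. zopen Z V \<and> x \<in> V \<and> V \<subseteq> U \<and> p' \<in> funs Z \<and> q \<in> funs Z \<and>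
    (\<forall>y\<in>V. q y \<noteq> 0 \<and> p y = p' y / q y)"
    using assms funs_const[of 1] by (intro exI[of _ U] exI[of _ p] exI[of _ "\<lambda>_. 1"]) auto
qed

lemma regular_const: "zopen Z U \<Longrightarrow> (\<lambda>x\<in>U. c) \<in> regular Z U"
  by (rule regular_fun) (auto simp: funs_const)

lemma regular_restrict:
  assumes "f \<in> regular Z U" "zopen Z V" "V \<subseteq> U"
  shows "restrict f V \<in> regular Z V"
proof (rule regularI)
  fix x assume x: "x \<in> V"
  with assms(3) have "x \<in> U" by blast
  obtain W p q where "zopen Z W" "x \<in> W" "W \<subseteq> U" "p \<in> funs Z" "q \<in> funs Z"
    "\<forall>y\<in>W. q y \<noteq> 0 \<and> f y = p y / q y"
    using regularD[OF assms(1) \<open>x \<in> U\<close>] by blast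
  then show "\<exists>V' p' q. zopen Z V' \<and> x \<in> V' \<and> V' \<subseteq> V \<and> p' \<in> funs Z \<and> q \<in> funs Z \<and>
    (\<forall>y\<in>V'. q y \<noteq> 0 \<and> f y = p' y / q y)"
    using x assms zopen_Int[of W V] by (intro exI[of _ "W \<inter> V"] exI[of _ p] exI[of _ q]) auto
qed

lemma regular_add_mult:
  assumes f: "f \<in> regular Z U" and g: "g \<in> regular Z U"
  shows "(\<lambda>x\<in>U. f x + g x) \<in> regular Z U" "(\<lambda>x\<in>U. f x * g x) \<in> regular Z U"
proof -
  have *: "\<exists>V p q p' q'. zopen Z V \<and> x \<in> V \<and> V \<subseteq> U \<and> p \<in> funs Z \<and> q \<in> funs Z \<and> p' \<in> funs Z \<and> q' \<in> funs Z \<and>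
    (\<forall>y\<in>V. q y \<noteq> 0 \<and> f y = p y / q y \<and> q' y \<noteq> 0 \<and> g y = p' y / q' y)" if x: "x \<in> U" for x
  proof -
    obtain W p q where 1: "zopen Z W" "x \<in> W" "W \<subseteq> U" "p \<in> funs Z" "q \<in> funs Z"
      "\<forall>y\<in>W. q y \<noteq> 0 \<and> f y = p y / q y"
      using regularD[OF f x] by blast
    obtain W' p' q' where 2: "zopen Z W'" "x \<in> W'" "W' \<subseteq> U" "p' \<in> funs Z" "q' \<in> funs Z"
      "\<forall>y\<in>W'. q' y \<noteq> 0 \<and> g y = p' y / q' y"
      using regularD[OF g x] by blast
    have "zopen Z (W \<inter> W') \<and> x \<in> W \<inter> W' \<and> W \<inter> W' \<subseteq> U" "\<forall>y\<in>W \<inter> W'. q y \<noteq> 0 \<and> f y = p y / q y \<and> q' y \<noteq> 0 \<and> g y = p' y / q' y"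
      using 1 2 zopen_Int[of W W'] by blast+
    then show ?thesis
      using 1(4,5) 2(4,5) by blast
  qed
  show "(\<lambda>x\<in>U. f x + g x) \<in> regular Z U"
  proof (rule regularI)
    fix x assume "x \<in> U"
    then obtain V p q p' q' where "zopen Z V" "x \<in> V" "V \<subseteq> U" "p \<in> funs Z" "q \<in> funs Z" "p' \<in> funs Z" "q' \<in> funs Z"
      "\<forall>y\<in>V. q y \<noteq> 0 \<and> f y = p y / q y \<and> q' y \<noteq> 0 \<and> g y = p' y / q' y"
      using * by blast
    then show "\<exists>V p q. zopen Z V \<and> x \<in> V \<and> V \<subseteq> U \<and> p \<in> funs Z \<and> q \<in> funs Z \<and>
      (\<forall>y\<in>V. q y \<noteq> 0 \<and> f y + g y = p y / q y)"
      by (intro exI[of _ V] exI[of _ "\<lambda>y. p y * q' y + p' y * q y"] exI[of _ "\<lambda>y. q y * q' y"])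
         (auto simp: funs_add funs_mult add_frac_eq)
  qed
  show "(\<lambda>x\<in>U. f x * g x) \<in> regular Z U"
  proof (rule regularI)
    fix x assume "x \<in> U"
    then obtain V p q p' q' where "zopen Z V" "x \<in> V" "V \<subseteq> U" "p \<in> funs Z" "q \<in> funs Z" "p' \<in> funs Z" "q' \<in> funs Z"
      "\<forall>y\<in>V. q y \<noteq> 0 \<and> f y = p y / q y \<and> q' y \<noteq> 0 \<and> g y = p' y / q' y"
      using * by blast
    then show "\<exists>V p q. zopen Z V \<and> x \<in> V \<and> V \<subseteq> U \<and> p \<in> funs Z \<and> q \<in> funs Z \<and>
      (\<forall>y\<in>V. q y \<noteq> 0 \<and> f y * g y = p y / q y)"
      by (intro exI[of _ V] exI[of _ "\<lambda>y. p y * p' y"] exI[of _ "\<lambda>y. q y * q' y"])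
         (auto simp: funs_mult)
  qed
qed

lemma regular_sum:
  assumes "zopen Z U" "finite I" "\<And>i. i \<in> I \<Longrightarrow> f i \<in> regular Z U"
  shows "(\<lambda>x\<in>U. \<Sum>i\<in>I. f i x) \<in> regular Z U"
  using assms(2,3)
proof (induction I rule: finite_induct)
  case empty
  then show ?case using regular_const[OF assms(1), of 0] by (simp only: sum.empty)
next
  case (insert i I)
  then have "(\<lambda>x\<in>U. f i x + (\<lambda>x\<in>U. \<Sum>i\<in>I. f i x) x) \<in> regular Z U"
    by (intro regular_add_mult) auto
  moreover have "(\<lambda>x\<in>U. \<Sum>j\<in>insert i I. f j x) = (\<lambda>x\<in>U. f i x + (\<lambda>x\<in>U. \<Sum>i\<in>I. f i x) x)"
    using insert.hyps by (intro restrict_ext) simp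
  ultimately show ?case by (simp only:)
qed

lemma zopen_nonzero:
  assumes f: "f \<in> regular Z U"
  shows "zopen Z {x \<in> U. f x \<noteq> 0}"
  unfolding zopen_iff
proof (intro conjI ballI)
  show "{x \<in> U. f x \<noteq> 0} \<subseteq> points Z"
    using f by (fastforce elim: regularD dest: zopen_subset)
  fix x assume x: "x \<in> {x \<in> U. f x \<noteq> 0}"
  then obtain V p q where V: "zopen Z V" "x \<in> V" "V \<subseteq> U" "p \<in> funs Z" "q \<in> funs Z"
    "\<forall>y\<in>V. q y \<noteq> 0 \<and> f y = p y / q y"
    using regularD[OF f, of x] by blast
  from V(1,2) obtain g where g: "g \<in> funs Z" "g x \<noteq> 0" "\<forall>y\<in>points Z. g y \<noteq> 0 \<longrightarrow> y \<in> V"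
    by (auto simp: zopen_iff)
  \<comment> \<open>The factor \<open>g\<close> confines the point to \<open>V\<close>, where
    \<open>f\<close> vanishes exactly when its numerator \<open>p\<close> does.\<close>
  show "\<exists>g\<in>funs Z. g x \<noteq> 0 \<and> (\<forall>y\<in>points Z. g y \<noteq> 0 \<longrightarrow> y \<in> {x \<in> U. f x \<noteq> 0})"
    using V g x by (intro bexI[of _ "\<lambda>y. g y * p y"]) (auto simp: funs_mult)
qed

lemma regular_inverse:
  assumes f: "f \<in> regular Z U" and nz: "\<And>x. x \<in> U \<Longrightarrow> f x \<noteq> 0"
  shows "(\<lambda>x\<in>U. inverse (f x)) \<in> regular Z U"
proof (rule regularI)
  fix x assume x: "x \<in> U"
  obtain V p q where V: "zopen Z V" "x \<in> V" "V \<subseteq> U" "p \<in> funs Z" "q \<in> funs Z"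
    "\<forall>y\<in>V. q y \<noteq> 0 \<and> f y = p y / q y"
    using regularD[OF f x] by blast
  then have "\<forall>y\<in>V. p y \<noteq> 0" using nz by fastforce
  with V show "\<exists>V p q. zopen Z V \<and> x \<in> V \<and> V \<subseteq> U \<and> p \<in> funs Z \<and> q \<in> funs Z \<and>
      (\<forall>y\<in>V. q y \<noteq> 0 \<and> inverse (f y) = p y / q y)"
    by (intro exI[of _ V] exI[of _ q] exI[of _ p]) auto
qed

end

section \<open>Regular functions on an irreducible variety\<close>

locale irreducible_funs = affine_funs +
  assumes irreducible: "zopen Z U \<Longrightarrow> zopen Z V \<Longrightarrow> U \<noteq> {} \<Longrightarrow> V \<noteq> {} \<Longrightarrow> U \<inter> V \<noteq> {}"
begin

text \<open>The two nonvanishing loci are nonempty open sets and therefore meet. Thus regular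
  functions on an open set have no zero divisors, which replaces the passage to the function field
  in the elimination below.\<close>

lemma regular_mult_nonzero:
  assumes "f \<in> regular Z U" "g \<in> regular Z U" "\<exists>x\<in>U. f x \<noteq> 0" "\<exists>x\<in>U. g x \<noteq> 0"
  shows "\<exists>x\<in>U. f x * g x \<noteq> 0"
proof -
  have "{x \<in> U. f x \<noteq> 0} \<inter> {x \<in> U. g x \<noteq> 0} \<noteq> {}"
    using assms by (intro irreducible zopen_nonzero) auto
  then show ?thesis by auto
qed

text \<open>Elimination: one column of the matrix is cleared by cross-multiplying with a nonzero
  entry of that column, which loses one row.\<close>

lemma regular_relation:
  fixes I :: "'b set"
  assumes W: "zopen Z W" "W \<noteq> {}" and "finite I" "k < card I"
    and "\<And>i j. i \<in> I \<Longrightarrow> j < k \<Longrightarrow> c i j \<in> regular Z W"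
  shows "\<exists>a. (\<forall>i\<in>I. a i \<in> regular Z W) \<and> (\<exists>i\<in>I. \<exists>x\<in>W. a i x \<noteq> 0) \<and>
    (\<forall>j<k. \<forall>x\<in>W. (\<Sum>i\<in>I. a i x * c i j x) = 0)"
  using assms(3-)
proof (induction k arbitrary: I c)
  case 0
  then have "I \<noteq> {}" by auto
  define a where "a i = (\<lambda>x\<in>W. 1::complex)" for i :: 'b
  have "a i \<in> regular Z W" for i
    unfolding a_def by (rule regular_const[OF W(1)])
  moreover have "\<exists>i\<in>I. \<exists>x\<in>W. a i x \<noteq> 0"
    using W(2) \<open>I \<noteq> {}\<close> by (fastforce simp: a_def)
  ultimately show ?case by auto
next
  case (Suc k)
  note cr = Suc.prems(3)
  show ?case
  proof (cases "\<forall>i\<in>I. \<forall>x\<in>W. c i k x = 0")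
    case True
    have "k < card I" using Suc.prems(2) by simp
    then have "\<exists>a. (\<forall>i\<in>I. a i \<in> regular Z W) \<and> (\<exists>i\<in>I. \<exists>x\<in>W. a i x \<noteq> 0) \<and>
      (\<forall>j<k. \<forall>x\<in>W. (\<Sum>i\<in>I. a i x * c i j x) = 0)"
      using cr by (intro Suc.IH Suc.prems) auto
    then obtain a where a: "\<forall>i\<in>I. a i \<in> regular Z W"
      "\<exists>i\<in>I. \<exists>x\<in>W. a i x \<noteq> 0" "\<forall>j<k. \<forall>x\<in>W. (\<Sum>i\<in>I. a i x * c i j x) = 0"
      by blast
    have "(\<Sum>i\<in>I. a i x * c i j x) = 0" if "j < Suc k" "x \<in> W" for j x
      using that a(3) True by (cases "j = k") auto
    then show ?thesis using a by blast
  next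
    case False
    then obtain i0 where i0: "i0 \<in> I" "\<exists>x\<in>W. c i0 k x \<noteq> 0" by blast
    define J where "J = I - {i0}"
    have J: "finite J" "k < card J" "I = insert i0 J" "i0 \<notin> J"
      using Suc.prems i0 by (auto simp: J_def)
    \<comment> \<open>The 2 by 2 minor of rows \<open>i0\<close>, \<open>i\<close> and columns
      \<open>k\<close>, \<open>j\<close>. The nested restrictions reproduce the shape in which sums
      and products of regular functions are known to be regular.\<close>
    define d where "d i j = (\<lambda>x\<in>W. (\<lambda>x\<in>W. c i0 k x * c i j x) x +
       (\<lambda>x\<in>W. (\<lambda>x\<in>W. -1) x * (\<lambda>x\<in>W. c i k x * c i0 j x) x) x)" for i j
    have dr: "d i j \<in> regular Z W" if "i \<in> J" "j < k" for i j
      unfolding d_def using that i0 J W by (intro regular_add_mult regular_const cr) auto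
    have d: "d i j x = c i0 k x * c i j x - c i k x * c i0 j x" if "x \<in> W" for i j x
      using that by (simp add: d_def)
    have "\<exists>a. (\<forall>i\<in>J. a i \<in> regular Z W) \<and> (\<exists>i\<in>J. \<exists>x\<in>W. a i x \<noteq> 0) \<and>
      (\<forall>j<k. \<forall>x\<in>W. (\<Sum>i\<in>J. a i x * d i j x) = 0)"
      by (intro Suc.IH J dr)
    then obtain a where a: "\<forall>i\<in>J. a i \<in> regular Z W"
      "\<exists>i\<in>J. \<exists>x\<in>W. a i x \<noteq> 0" "\<forall>j<k. \<forall>x\<in>W. (\<Sum>i\<in>J. a i x * d i j x) = 0"
      by blast
    \<comment> \<open>A relation \<open>a\<close> among the minors, unfolded into the original rows:
      multiplying by the pivot avoids division, and the coefficient of row \<open>i0\<close>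
      collects the terms subtracted in the minors.\<close>
    define b where "b i = (if i = i0 then (\<lambda>x\<in>W. (\<lambda>x\<in>W. -1) x * (\<lambda>x\<in>W. \<Sum>i\<in>J. (\<lambda>x\<in>W. a i x * c i k x) x) x)
       else (\<lambda>x\<in>W. a i x * c i0 k x))" for i
    have 1: "(\<lambda>x\<in>W. a i x * c i k x) \<in> regular Z W" if "i \<in> J" for i
      using that a(1) J cr by (intro regular_add_mult) auto
    have "b i0 \<in> regular Z W"
      unfolding b_def if_P[OF refl]
      by (rule regular_add_mult(2)[OF regular_const[OF W(1)] regular_sum[OF W(1) J(1) 1]])
    moreover have "b i \<in> regular Z W" if "i \<in> J" for i
    proof -
      have "b i = (\<lambda>x\<in>W. a i x * c i0 k x)"
        using that J by (auto simp: b_def)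
      then show ?thesis
        using that a(1) i0 cr by (simp only:) (intro regular_add_mult, auto)
    qed
    ultimately have br: "\<forall>i\<in>I. b i \<in> regular Z W"
      using J by simp
    have bz: "\<exists>i\<in>I. \<exists>x\<in>W. b i x \<noteq> 0"
    proof -
      from a(2) obtain i where i: "i \<in> J" "\<exists>x\<in>W. a i x \<noteq> 0" by blast
      then have "\<exists>x\<in>W. a i x * c i0 k x \<noteq> 0"
        using a(1) i0 cr by (intro regular_mult_nonzero) auto
      then show ?thesis
        using i J by (intro bexI[of _ i]) (auto simp: b_def)
    qed
    have "(\<Sum>i\<in>I. b i x * c i j x) = 0" if x: "x \<in> W" and j: "j < Suc k" for j x
    proof -
      have "(\<Sum>i\<in>I. b i x * c i j x) = b i0 x * c i0 j x + (\<Sum>i\<in>J. b i x * c i j x)"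
        using J by simp
      also have "(\<Sum>i\<in>J. b i x * c i j x) = (\<Sum>i\<in>J. a i x * c i0 k x * c i j x)"
        using J x by (intro sum.cong) (auto simp: b_def)
      also have "b i0 x * c i0 j x = - (\<Sum>i\<in>J. a i x * c i k x * c i0 j x)"
        using x by (simp add: b_def sum_distrib_right)
      finally have *: "(\<Sum>i\<in>I. b i x * c i j x) =
          (\<Sum>i\<in>J. a i x * (c i0 k x * c i j x - c i k x * c i0 j x))"
        by (simp add: sum_subtractf algebra_simps)
      show ?thesis
      proof (cases "j = k")
        case True
        then show ?thesis unfolding * by simp
      next
        case False
        then have "j < k" using j by simp
        then show ?thesis unfolding * using a(3) x d by fastforce
      qed
    qed
    then show ?thesis using br bz by blast
  qed
qed

end

section \<open>Endomorphisms of sheaves of modules\<close>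

text \<open>\<open>finsum\<close> is evaluated in a record, so replacing the carrier changes the
  term. This comparison lets sums of sections of a subsheaf be computed in the ambient
  sheaf.\<close>

lemma finsum_subgroup:
  assumes M: "abelian_group M" and N: "abelian_group (M\<lparr>carrier := N\<rparr>)"
    and "N \<subseteq> carrier M" "finite A" "f \<in> A \<rightarrow> N"
  shows "finsum (M\<lparr>carrier := N\<rparr>) f A = finsum M f A"
  using assms(4,5)
proof (induction A rule: finite_induct)
  case empty
  show ?case
    using abelian_monoid.finsum_empty[of "M\<lparr>carrier := N\<rparr>" f] abelian_monoid.finsum_empty[of M f] M N
    by (simp add: abelian_group_def)
next
  case (insert x A)
  have "f \<in> A \<rightarrow> carrier M" "f x \<in> carrier M" "f \<in> A \<rightarrow> N" "f x \<in> N"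
    using insert.prems assms(3) by auto
  then show ?case
    using abelian_monoid.finsum_insert[of "M\<lparr>carrier := N\<rparr>" A x f]
      abelian_monoid.finsum_insert[of M A x f] insert.hyps insert.IH M N
    by (simp add: abelian_group_def)
qed

lemma str_ring_simps [simp]:
  "carrier (str_ring Z U) = regular Z U"
  "f \<otimes>\<^bsub>str_ring Z U\<^esub> g = (\<lambda>x\<in>U. f x * g x)"
  "f \<oplus>\<^bsub>str_ring Z U\<^esub> g = (\<lambda>x\<in>U. f x + g x)"
  "\<one>\<^bsub>str_ring Z U\<^esub> = (\<lambda>x\<in>U. 1)"
  "\<zero>\<^bsub>str_ring Z U\<^esub> = (\<lambda>x\<in>U. 0)"
  by (simp_all add: str_ring_def)

text \<open>Complex scalars act as constant functions, cut off outside \<open>U\<close> because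
  \<open>regular\<close> demands extensional functions. The eigenspace arguments use only this
  vector space structure.\<close>

definition cscale :: "('p, 'm, 'z) osheaf_scheme \<Rightarrow> 'p set \<Rightarrow> complex \<Rightarrow> 'm \<Rightarrow> 'm" where
  "cscale F U c s = (\<lambda>x\<in>U. c) \<odot>\<^bsub>sect F U\<^esub> s"

definition sheaf_endo :: "'p variety \<Rightarrow> ('p, 'm, 'z) osheaf_scheme \<Rightarrow> ('p set \<Rightarrow> 'm \<Rightarrow> 'm) \<Rightarrow> bool" where
  "sheaf_endo Z F \<phi> \<longleftrightarrow> (\<forall>U. zopen Z U \<longrightarrow> (\<forall>s\<in>carrier (sect F U).
     \<phi> U s \<in> carrier (sect F U) \<and>
     (\<forall>t\<in>carrier (sect F U). \<phi> U (s \<oplus>\<^bsub>sect F U\<^esub> t) = \<phi> U s \<oplus>\<^bsub>sect F U\<^esub> \<phi> U t) \<and>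
     (\<forall>f\<in>regular Z U. \<phi> U (f \<odot>\<^bsub>sect F U\<^esub> s) = f \<odot>\<^bsub>sect F U\<^esub> \<phi> U s) \<and>
     (\<forall>V. zopen Z V \<and> V \<subseteq> U \<longrightarrow> \<phi> V (res F U V s) = res F U V (\<phi> U s))))"

text \<open>The inner clause of \<open>finite_type\<close> gets a name so that its witnesses can be
  obtained without exposing the alternating quantifiers to automation. The same is done for
  relations below.\<close>

definition generating ::
  "'p variety \<Rightarrow> ('p, 'm, 'z) osheaf_scheme \<Rightarrow> 'p set \<Rightarrow> nat \<Rightarrow> (nat \<Rightarrow> 'm) \<Rightarrow> bool" where
  "generating Z F U k s \<longleftrightarrow>
     (\<forall>V f y. zopen Z V \<and> V \<subseteq> U \<and> f \<in> carrier (sect F V) \<and> y \<in> V \<longrightarrow>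
        (\<exists>W c. zopen Z W \<and> y \<in> W \<and> W \<subseteq> V \<and> (\<forall>i<k. c i \<in> regular Z W) \<and>
           res F V W f = lincomb F U W k c s))"

lemma finite_type_iff: "finite_type Z F \<longleftrightarrow> (\<forall>x\<in>points Z. \<exists>U k s. zopen Z U \<and> x \<in> U \<and>
    (\<forall>i<k. s i \<in> carrier (sect F U)) \<and> generating Z F U k s)"
  unfolding finite_type_def generating_def by (rule refl)

definition generating_relations ::
  "'p variety \<Rightarrow> ('p, 'm, 'z) osheaf_scheme \<Rightarrow> 'p set \<Rightarrow> 'p set \<Rightarrow> nat \<Rightarrow> (nat \<Rightarrow> 'm) \<Rightarrow> nat \<Rightarrow>
     (nat \<Rightarrow> nat \<Rightarrow> 'p \<Rightarrow> complex) \<Rightarrow> bool" where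
  "generating_relations Z F U V k s l r \<longleftrightarrow>
     (\<forall>W c y. zopen Z W \<and> W \<subseteq> V \<and> y \<in> W \<and> (\<forall>i<k. c i \<in> regular Z W) \<and>
        lincomb F U W k c s = \<zero>\<^bsub>sect F W\<^esub> \<longrightarrow>
        (\<exists>W' a. zopen Z W' \<and> y \<in> W' \<and> W' \<subseteq> W \<and> (\<forall>j<l. a j \<in> regular Z W') \<and>
           (\<forall>i<k. \<forall>z\<in>W'. c i z = (\<Sum>j<l. a j z * r j i z))))"

lemma relations_finite_type_iff:
  "relations_finite_type Z F \<longleftrightarrow> (\<forall>U k s. zopen Z U \<and> (\<forall>i<k. s i \<in> carrier (sect F U)) \<longrightarrow>
     (\<forall>x\<in>U. \<exists>V l r. zopen Z V \<and> x \<in> V \<and> V \<subseteq> U \<and>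
        (\<forall>j<l. (\<forall>i<k. r j i \<in> regular Z V) \<and> lincomb F U V k (r j) s = \<zero>\<^bsub>sect F V\<^esub>) \<and>
        generating_relations Z F U V k s l r))"
  unfolding relations_finite_type_def generating_relations_def by (rule refl)

text \<open>For idempotent \<open>\<phi>\<close> the sections fixed by \<open>\<phi>\<close> form the image of \<open>\<phi>\<close>.\<close>

definition fixed_sheaf :: "('p set \<Rightarrow> 'm \<Rightarrow> 'm) \<Rightarrow> ('p, 'm, 'z) osheaf_scheme \<Rightarrow> ('p, 'm, 'z) osheaf_scheme" where
  "fixed_sheaf \<phi> F = F\<lparr>sect := \<lambda>U. (sect F U)\<lparr>carrier := {s \<in> carrier (sect F U). \<phi> U s = s}\<rparr>\<rparr>"

lemma fixed_sheaf_simps [simp]: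
  "carrier (sect (fixed_sheaf \<phi> F) U) = {s \<in> carrier (sect F U). \<phi> U s = s}"
  "s \<oplus>\<^bsub>sect (fixed_sheaf \<phi> F) U\<^esub> t = s \<oplus>\<^bsub>sect F U\<^esub> t"
  "f \<odot>\<^bsub>sect (fixed_sheaf \<phi> F) U\<^esub> t = f \<odot>\<^bsub>sect F U\<^esub> t"
  "\<zero>\<^bsub>sect (fixed_sheaf \<phi> F) U\<^esub> = \<zero>\<^bsub>sect F U\<^esub>"
  "res (fixed_sheaf \<phi> F) = res F"
  by (simp_all add: fixed_sheaf_def)

locale sheaf_of_modules = irreducible_funs Z S for Z :: "'p variety" and S +
  fixes F :: "('p, 'm, 'z) osheaf_scheme"
  assumes module_sheaf: "module_sheaf Z F"
begin

lemmas module_sheafD = module_sheaf[unfolded module_sheaf_def]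

lemma module_sect: "zopen Z U \<Longrightarrow> Module.module (str_ring Z U) (sect F U)"
  using module_sheafD[THEN conjunct1] by blast

lemma
  assumes "zopen Z U" "zopen Z V" "V \<subseteq> U" "s \<in> carrier (sect F U)"
  shows res_closed: "res F U V s \<in> carrier (sect F V)"
    and res_add: "t \<in> carrier (sect F U) \<Longrightarrow>
      res F U V (s \<oplus>\<^bsub>sect F U\<^esub> t) = res F U V s \<oplus>\<^bsub>sect F V\<^esub> res F U V t"
    and res_smult: "f \<in> regular Z U \<Longrightarrow>
      res F U V (f \<odot>\<^bsub>sect F U\<^esub> s) = restrict f V \<odot>\<^bsub>sect F V\<^esub> res F U V s"
  using module_sheafD[THEN conjunct2, THEN conjunct1] assms by blast+

lemma res_id: "zopen Z U \<Longrightarrow> s \<in> carrier (sect F U) \<Longrightarrow> res F U U s = s"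
  using module_sheafD[THEN conjunct2, THEN conjunct2, THEN conjunct1] by blast

lemma res_res: "zopen Z U \<Longrightarrow> zopen Z V \<Longrightarrow> zopen Z W \<Longrightarrow> W \<subseteq> V \<Longrightarrow> V \<subseteq> U \<Longrightarrow> s \<in> carrier (sect F U) \<Longrightarrow>
    res F V W (res F U V s) = res F U W s"
  using module_sheafD[THEN conjunct2, THEN conjunct2, THEN conjunct2, THEN conjunct1] by blast

lemma glue:
  assumes "\<And>V. V \<in> C \<Longrightarrow> zopen Z V \<and> u V \<in> carrier (sect F V)"
    and "\<And>V W. V \<in> C \<Longrightarrow> W \<in> C \<Longrightarrow> res F V (V \<inter> W) (u V) = res F W (V \<inter> W) (u W)"
  shows "\<exists>!t. t \<in> carrier (sect F (\<Union>C)) \<and> (\<forall>V\<in>C. res F (\<Union>C) V t = u V)"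
  using module_sheafD[THEN conjunct2, THEN conjunct2, THEN conjunct2, THEN conjunct2, rule_format, of C u] assms
  by blast

lemma abelian_group_sect: "zopen Z U \<Longrightarrow> abelian_group (sect F U)"
  using module_sect by (simp add: Module.module_def)

lemma smult_closed:
  "zopen Z U \<Longrightarrow> f \<in> regular Z U \<Longrightarrow> s \<in> carrier (sect F U) \<Longrightarrow> f \<odot>\<^bsub>sect F U\<^esub> s \<in> carrier (sect F U)"
  using module.smult_closed[OF module_sect, of U f s] by simp

lemma add_closed:
  "zopen Z U \<Longrightarrow> s \<in> carrier (sect F U) \<Longrightarrow> t \<in> carrier (sect F U) \<Longrightarrow> s \<oplus>\<^bsub>sect F U\<^esub> t \<in> carrier (sect F U)"
  using abelian_groupE(1)[OF abelian_group_sect] by blast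

lemma zero_closed: "zopen Z U \<Longrightarrow> \<zero>\<^bsub>sect F U\<^esub> \<in> carrier (sect F U)"
  using abelian_groupE(2)[OF abelian_group_sect] by blast

lemma cscale_closed: "zopen Z U \<Longrightarrow> s \<in> carrier (sect F U) \<Longrightarrow> cscale F U c s \<in> carrier (sect F U)"
  unfolding cscale_def by (intro smult_closed regular_const)

lemma cscale_add: "zopen Z U \<Longrightarrow> s \<in> carrier (sect F U) \<Longrightarrow>
   cscale F U (c + d) s = cscale F U c s \<oplus>\<^bsub>sect F U\<^esub> cscale F U d s"
proof -
  assume U: "zopen Z U" and s: "s \<in> carrier (sect F U)"
  have "(\<lambda>x\<in>U. c + d) = (\<lambda>x\<in>U. c) \<oplus>\<^bsub>str_ring Z U\<^esub> (\<lambda>x\<in>U. d)"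
    by (auto intro: restrict_ext)
  then show ?thesis
    unfolding cscale_def using module.smult_l_distr[OF module_sect[OF U]] regular_const[OF U] s
    by (simp only: str_ring_simps)
qed

lemma cscale_cscale: "zopen Z U \<Longrightarrow> s \<in> carrier (sect F U) \<Longrightarrow>
   cscale F U c (cscale F U d s) = cscale F U (c * d) s"
proof -
  assume U: "zopen Z U" and s: "s \<in> carrier (sect F U)"
  have "(\<lambda>x\<in>U. c * d) = (\<lambda>x\<in>U. c) \<otimes>\<^bsub>str_ring Z U\<^esub> (\<lambda>x\<in>U. d)"
    by (auto intro: restrict_ext)
  then show ?thesis
    unfolding cscale_def using module.smult_assoc1[OF module_sect[OF U]] regular_const[OF U] s
    by (simp only: str_ring_simps)
qed

lemma cscale_1: "zopen Z U \<Longrightarrow> s \<in> carrier (sect F U) \<Longrightarrow> cscale F U 1 s = s"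
  using module.smult_one[OF module_sect, of U s] by (simp add: cscale_def)

lemma cscale_0: "zopen Z U \<Longrightarrow> s \<in> carrier (sect F U) \<Longrightarrow> cscale F U 0 s = \<zero>\<^bsub>sect F U\<^esub>"
  using module.smult_l_null[OF module_sect, of U s] by (simp add: cscale_def)

lemma cscale_distrib: "zopen Z U \<Longrightarrow> s \<in> carrier (sect F U) \<Longrightarrow> t \<in> carrier (sect F U) \<Longrightarrow>
   cscale F U c (s \<oplus>\<^bsub>sect F U\<^esub> t) = cscale F U c s \<oplus>\<^bsub>sect F U\<^esub> cscale F U c t"
  using module.smult_r_distr[OF module_sect, of U] regular_const
  by (simp add: cscale_def)

lemma cscale_smult: "zopen Z U \<Longrightarrow> s \<in> carrier (sect F U) \<Longrightarrow> f \<in> regular Z U \<Longrightarrow>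
   cscale F U c (f \<odot>\<^bsub>sect F U\<^esub> s) = f \<odot>\<^bsub>sect F U\<^esub> cscale F U c s"
proof -
  assume U: "zopen Z U" and s: "s \<in> carrier (sect F U)" and f: "f \<in> regular Z U"
  have "(\<lambda>x\<in>U. c) \<otimes>\<^bsub>str_ring Z U\<^esub> f = f \<otimes>\<^bsub>str_ring Z U\<^esub> (\<lambda>x\<in>U. c)"
    by (auto intro: restrict_ext)
  then show ?thesis
    unfolding cscale_def using module.smult_assoc1[OF module_sect[OF U]] regular_const[OF U] s f
    by (metis str_ring_simps(1))
qed

lemma cscale_res: "zopen Z U \<Longrightarrow> zopen Z V \<Longrightarrow> V \<subseteq> U \<Longrightarrow> s \<in> carrier (sect F U) \<Longrightarrow>
   cscale F V c (res F U V s) = res F U V (cscale F U c s)"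
proof -
  assume *: "zopen Z U" "zopen Z V" "V \<subseteq> U" "s \<in> carrier (sect F U)"
  have "restrict (\<lambda>x\<in>U. c) V = (\<lambda>x\<in>V. c)"
    using *(3) by (intro restrict_ext) auto
  then show ?thesis
    unfolding cscale_def using res_smult[OF * regular_const] * by simp
qed

lemma cscale_zero: "zopen Z U \<Longrightarrow> cscale F U c \<zero>\<^bsub>sect F U\<^esub> = \<zero>\<^bsub>sect F U\<^esub>"
  using module.smult_r_null[OF module_sect, of U "\<lambda>x\<in>U. c"] regular_const
  by (simp add: cscale_def)

lemma res_zero: "zopen Z U \<Longrightarrow> zopen Z V \<Longrightarrow> V \<subseteq> U \<Longrightarrow> res F U V \<zero>\<^bsub>sect F U\<^esub> = \<zero>\<^bsub>sect F V\<^esub>"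
  using cscale_res[of U V "\<zero>\<^bsub>sect F U\<^esub>" 0] cscale_0 zero_closed res_closed by (metis cscale_zero)

lemma neg_cscale: "zopen Z U \<Longrightarrow> s \<in> carrier (sect F U) \<Longrightarrow> s \<oplus>\<^bsub>sect F U\<^esub> cscale F U (-1) s = \<zero>\<^bsub>sect F U\<^esub>"
  using cscale_add[of U s 1 "-1"] cscale_1 cscale_0 by simp

lemma a_inv_cscale:
  assumes U: "zopen Z U" and t: "t \<in> carrier (sect F U)"
  shows "\<ominus>\<^bsub>sect F U\<^esub> t = cscale F U (-1) t"
proof -
  interpret abelian_group "sect F U" by (rule abelian_group_sect[OF U])
  show ?thesis
    using neg_cscale[OF U t] t cscale_closed[OF U t] by (metis minus_unique minus_equality a_comm)
qed

lemma endoD: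
  assumes "sheaf_endo Z F \<phi>" "zopen Z U" "s \<in> carrier (sect F U)"
  shows endo_closed: "\<phi> U s \<in> carrier (sect F U)"
    and endo_add: "t \<in> carrier (sect F U) \<Longrightarrow> \<phi> U (s \<oplus>\<^bsub>sect F U\<^esub> t) = \<phi> U s \<oplus>\<^bsub>sect F U\<^esub> \<phi> U t"
    and endo_smult: "f \<in> regular Z U \<Longrightarrow> \<phi> U (f \<odot>\<^bsub>sect F U\<^esub> s) = f \<odot>\<^bsub>sect F U\<^esub> \<phi> U s"
    and endo_res: "zopen Z V \<Longrightarrow> V \<subseteq> U \<Longrightarrow> \<phi> V (res F U V s) = res F U V (\<phi> U s)"
    and endo_cscale: "\<phi> U (cscale F U c s) = cscale F U c (\<phi> U s)"
  using assms regular_const[OF assms(2)] unfolding sheaf_endo_def cscale_def by blast+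

lemma endo_zero: "sheaf_endo Z F \<phi> \<Longrightarrow> zopen Z U \<Longrightarrow> \<phi> U \<zero>\<^bsub>sect F U\<^esub> = \<zero>\<^bsub>sect F U\<^esub>"
  using endo_cscale[of \<phi> U "\<zero>\<^bsub>sect F U\<^esub>" 0] cscale_0 zero_closed endo_closed by metis

lemma endo_finsum:
  assumes "sheaf_endo Z F \<phi>" "zopen Z U" "finite A" "f \<in> A \<rightarrow> carrier (sect F U)"
  shows "\<phi> U (finsum (sect F U) f A) = finsum (sect F U) (\<lambda>i. \<phi> U (f i)) A"
  using assms(3,4)
proof (induction A rule: finite_induct)
  case empty
  interpret abelian_group "sect F U" by (rule abelian_group_sect[OF assms(2)])
  show ?case using endo_zero[OF assms(1,2)] by simp
next
  case (insert x A)
  interpret abelian_group "sect F U" by (rule abelian_group_sect[OF assms(2)])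
  have f: "f \<in> A \<rightarrow> carrier (sect F U)" "f x \<in> carrier (sect F U)" using insert by auto
  then have "(\<lambda>i. \<phi> U (f i)) \<in> A \<rightarrow> carrier (sect F U)"
    using endo_closed[OF assms(1,2)] by auto
  then show ?case
    using insert f endo_closed[OF assms(1,2)] endo_add[OF assms(1,2)] by simp
qed

lemma lincomb_closed:
  assumes "zopen Z U" "zopen Z W" "W \<subseteq> U" "\<And>i. i < k \<Longrightarrow> s i \<in> carrier (sect F U)"
    "\<And>i. i < k \<Longrightarrow> c i \<in> regular Z W"
  shows "lincomb F U W k c s \<in> carrier (sect F W)"
proof -
  interpret abelian_group "sect F W" by (rule abelian_group_sect[OF assms(2)])
  have "c i \<odot>\<^bsub>sect F W\<^esub> res F U W (s i) \<in> carrier (sect F W)" if "i < k" for i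
    using that by (intro smult_closed[OF assms(2)] res_closed[OF assms(1-3)] assms(4,5))
  then show ?thesis
    unfolding lincomb_def by (intro finsum_closed) auto
qed

text \<open>Coefficients stay and sections are replaced by their images. Generation by finitely many
  sections and algebraicity of the linearisation both pass to the image of a projection through this
  identity.\<close>

lemma endo_lincomb:
  assumes "sheaf_endo Z F \<phi>" "zopen Z U" "zopen Z W" "W \<subseteq> U"
    "\<And>i. i < k \<Longrightarrow> s i \<in> carrier (sect F U)" "\<And>i. i < k \<Longrightarrow> c i \<in> regular Z W"
  shows "\<phi> W (lincomb F U W k c s) = lincomb F U W k c (\<lambda>i. \<phi> U (s i))"
proof -
  interpret abelian_group "sect F W" by (rule abelian_group_sect[OF assms(3)])
  have r: "res F U W (s i) \<in> carrier (sect F W)" "c i \<odot>\<^bsub>sect F W\<^esub> res F U W (s i) \<in> carrier (sect F W)"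
    "c i \<odot>\<^bsub>sect F W\<^esub> res F U W (\<phi> U (s i)) \<in> carrier (sect F W)" if "i < k" for i
    by (intro smult_closed[OF assms(3)] res_closed[OF assms(2-4)] endo_closed[OF assms(1,2)]
        assms(5,6)[OF that])+
  have "\<phi> W (lincomb F U W k c s) = finsum (sect F W) (\<lambda>i. \<phi> W (c i \<odot>\<^bsub>sect F W\<^esub> res F U W (s i))) {..<k}"
    unfolding lincomb_def using r by (intro endo_finsum assms) auto
  also have "\<dots> = lincomb F U W k c (\<lambda>i. \<phi> U (s i))"
    unfolding lincomb_def using r assms
    by (intro finsum_cong') (auto simp: endo_smult[OF assms(1,3) r(1) assms(6)] endo_res[OF assms(1,2)])
  finally show ?thesis .
qed

end

section \<open>The image of an idempotent endomorphism of a coherent sheaf\<close>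

locale idempotent_endo = sheaf_of_modules +
  fixes \<phi>
  assumes endo: "sheaf_endo Z F \<phi>"
    and idem: "zopen Z U \<Longrightarrow> s \<in> carrier (sect F U) \<Longrightarrow> \<phi> U (\<phi> U s) = \<phi> U s"
begin

abbreviation "E \<equiv> fixed_sheaf \<phi> F"

lemma module_fixed: assumes U: "zopen Z U" shows "Module.module (str_ring Z U) (sect E U)"
proof -
  have "submodule {s \<in> carrier (sect F U). \<phi> U s = s} (str_ring Z U) (sect F U)"
    using endo_zero[OF endo U] endo_add[OF endo U] endo_smult[OF endo U] endo_cscale[OF endo U]
      a_inv_cscale[OF U] cscale_closed[OF U] smult_closed[OF U] add_closed[OF U] zero_closed[OF U]
    by (intro module.submoduleI[OF module_sect[OF U]]) auto
  then show ?thesis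
    unfolding fixed_sheaf_def using submodule.submodule_is_module[OF _ module_sect[OF U]] by simp
qed

lemma module_sheaf_fixed: "module_sheaf Z E"
  unfolding module_sheaf_def
proof (intro conjI allI impI, goal_cases)
  case (1 U)
  then show ?case by (rule module_fixed)
next
  case (2 U V)
  then show ?case using endo_res[OF endo] by (auto simp: res_closed)
next
  case (3 U V)
  then show ?case by (auto simp: res_add)
next
  case (4 U V)
  then show ?case by (auto simp: res_smult)
next
  case (5 U)
  then show ?case by (auto simp: res_id)
next
  case (6 U V W)
  then show ?case by (auto simp: res_res)
next
  case (7 C u)
  have op: "zopen Z (\<Union>C)" using 7 by (intro zopen_Union) auto
  from 7 have ex: "\<exists>!t. t \<in> carrier (sect F (\<Union>C)) \<and> (\<forall>V\<in>C. res F (\<Union>C) V t = u V)"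
    by (intro glue) auto
  then obtain t where t: "t \<in> carrier (sect F (\<Union>C))" "\<forall>V\<in>C. res F (\<Union>C) V t = u V" by blast
  \<comment> \<open>The image of the glued section under \<phi> has the same restrictions, because
    each \<open>u V\<close> is fixed. Uniqueness of gluing in \<open>F\<close> then makes
    \<open>t\<close> itself fixed.\<close>
  have "res F (\<Union>C) V (\<phi> (\<Union>C) t) = u V" if "V \<in> C" for V
    using endo_res[OF endo op t(1), of V] 7 t(2) that Union_upper[OF that] by auto
  then have "\<phi> (\<Union>C) t = t"
    using ex t endo_closed[OF endo op t(1)] by blast
  then have "t \<in> carrier (sect E (\<Union>C)) \<and> (\<forall>V\<in>C. res E (\<Union>C) V t = u V)"
    using t by simp
  then show ?case
    using ex by auto
qed

text \<open>All terms are fixed by \<phi>, so the sum may be taken in either sheaf. Relations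
  between sections of the image are thus exactly their relations in \<open>F\<close>.\<close>

lemma lincomb_fixed:
  assumes "zopen Z U" "zopen Z W" "W \<subseteq> U" "\<And>i. i < k \<Longrightarrow> s i \<in> carrier (sect E U)"
    "\<And>i. i < k \<Longrightarrow> c i \<in> regular Z W"
  shows "lincomb E U W k c s = lincomb F U W k c s"
proof -
  let ?K = "{s \<in> carrier (sect F W). \<phi> W s = s}"
  let ?f = "\<lambda>i. c i \<odot>\<^bsub>sect F W\<^esub> res F U W (s i)"
  have E: "sect E W = (sect F W)\<lparr>carrier := ?K\<rparr>"
    by (simp add: fixed_sheaf_def)
  have ab: "abelian_group (sect E W)"
    using module_fixed[OF assms(2)] by (simp add: Module.module_def)
  have cl: "?f \<in> {..<k} \<rightarrow> ?K"
  proof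
    fix i assume "i \<in> {..<k}"
    then have i: "i < k" by simp
    then have s: "s i \<in> carrier (sect F U)" "\<phi> U (s i) = s i" using assms(4) by auto
    note r = res_closed[OF assms(1-3) s(1)]
    have "\<phi> W (res F U W (s i)) = res F U W (s i)"
      using endo_res[OF endo assms(1) s(1) assms(2,3)] s(2) by simp
    then show "c i \<odot>\<^bsub>sect F W\<^esub> res F U W (s i) \<in> ?K"
      using endo_smult[OF endo assms(2) r assms(5)[OF i]] smult_closed[OF assms(2) assms(5)[OF i] r] by simp
  qed
  have "?K \<subseteq> carrier (sect F W)" by auto
  from finsum_subgroup[OF abelian_group_sect[OF assms(2)] ab[unfolded E] this finite_lessThan cl]
  have "finsum (sect E W) ?f {..<k} = finsum (sect F W) ?f {..<k}"
    by (simp only: E[symmetric])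
  then show ?thesis
    unfolding lincomb_def by (simp only: fixed_sheaf_simps)
qed

text \<open>The images of local generators generate: apply \<phi> to an expression of a fixed
  section and keep the coefficients.\<close>

lemma finite_type_fixed: assumes "finite_type Z F" shows "finite_type Z E"
  unfolding finite_type_iff
proof
  fix x assume "x \<in> points Z"
  then obtain U k s where U: "zopen Z U" "x \<in> U" and s: "\<forall>i<k. s i \<in> carrier (sect F U)"
    and gen: "generating Z F U k s"
    using assms unfolding finite_type_iff by blast
  have s': "\<And>i. i < k \<Longrightarrow> \<phi> U (s i) \<in> carrier (sect E U)"
    using s U endo_closed[OF endo] idem by auto
  have "generating Z E U k (\<lambda>i. \<phi> U (s i))"
    unfolding generating_def
  proof (intro allI impI, elim conjE)
    fix V f y assume V: "zopen Z V" "V \<subseteq> U" "f \<in> carrier (sect E V)" "y \<in> V"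
    then have f: "f \<in> carrier (sect F V)" "\<phi> V f = f" by auto
    obtain W c where W: "zopen Z W" "y \<in> W" "W \<subseteq> V" "\<forall>i<k. c i \<in> regular Z W"
      "res F V W f = lincomb F U W k c s"
      using gen V f(1) unfolding generating_def by blast
    have "res F V W f = \<phi> W (res F V W f)"
      using endo_res[OF endo V(1) f(1) W(1,3)] f(2) by simp
    also have "\<dots> = lincomb F U W k c (\<lambda>i. \<phi> U (s i))"
      unfolding W(5) using V W U s by (intro endo_lincomb endo) auto
    also have "\<dots> = lincomb E U W k c (\<lambda>i. \<phi> U (s i))"
      using V(2) W(3,4) by (intro lincomb_fixed[symmetric] U W(1) s') auto
    finally show "\<exists>W c. zopen Z W \<and> y \<in> W \<and> W \<subseteq> V \<and> (\<forall>i<k. c i \<in> regular Z W) \<and>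
           res E V W f = lincomb E U W k c (\<lambda>i. \<phi> U (s i))"
      using W(1-4) unfolding fixed_sheaf_simps by blast
  qed
  then show "\<exists>U k s. zopen Z U \<and> x \<in> U \<and> (\<forall>i<k. s i \<in> carrier (sect E U)) \<and> generating Z E U k s"
    using U s' by (intro exI[of _ U] exI[of _ k] exI[of _ "\<lambda>i. \<phi> U (s i)"] conjI allI impI)
qed

text \<open>Sections of the image are sections of \<open>F\<close> with the same relations, so the
  generating relations found for \<open>F\<close> serve unchanged.\<close>

lemma relations_fixed: assumes "relations_finite_type Z F" shows "relations_finite_type Z E"
  unfolding relations_finite_type_iff
proof (intro allI impI ballI, elim conjE)
  fix U and k :: nat and s x
  assume U: "zopen Z U" and s: "\<forall>i<k. s i \<in> carrier (sect E U)" and x: "x \<in> U"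
  have "\<forall>i<k. s i \<in> carrier (sect F U)" using s by simp
  with assms U x obtain V and l :: nat and r where
    V: "zopen Z V" "x \<in> V" "V \<subseteq> U"
    and r: "\<forall>j<l. (\<forall>i<k. r j i \<in> regular Z V) \<and> lincomb F U V k (r j) s = \<zero>\<^bsub>sect F V\<^esub>"
    and rel: "generating_relations Z F U V k s l r"
    unfolding relations_finite_type_iff by blast
  have eq: "lincomb E U W k c s = lincomb F U W k c s"
    if "zopen Z W" "W \<subseteq> V" "\<forall>i<k. c i \<in> regular Z W" for W c
    using that V(3) s by (intro lincomb_fixed U) auto
  have "\<forall>j<l. (\<forall>i<k. r j i \<in> regular Z V) \<and> lincomb E U V k (r j) s = \<zero>\<^bsub>sect E V\<^esub>"
    using r eq[OF V(1) subset_refl] by simp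
  moreover have "generating_relations Z E U V k s l r"
    unfolding generating_relations_def
  proof (intro allI impI, elim conjE)
    fix W c y assume W: "zopen Z W" "W \<subseteq> V" "y \<in> W" "\<forall>i<k. c i \<in> regular Z W"
      "lincomb E U W k c s = \<zero>\<^bsub>sect E W\<^esub>"
    then have "lincomb F U W k c s = \<zero>\<^bsub>sect F W\<^esub>" using eq by simp
    then show "\<exists>W' a. zopen Z W' \<and> y \<in> W' \<and> W' \<subseteq> W \<and> (\<forall>j<l. a j \<in> regular Z W') \<and>
              (\<forall>i<k. \<forall>z\<in>W'. c i z = (\<Sum>j<l. a j z * r j i z))"
      using rel[unfolded generating_relations_def] W(1-4) by blast
  qed
  ultimately show "\<exists>V l r. zopen Z V \<and> x \<in> V \<and> V \<subseteq> U \<and>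
        (\<forall>j<l. (\<forall>i<k. r j i \<in> regular Z V) \<and> lincomb E U V k (r j) s = \<zero>\<^bsub>sect E V\<^esub>) \<and>
        generating_relations Z E U V k s l r"
    using V by blast
qed

lemma coherent_fixed: "coherent Z F \<Longrightarrow> coherent Z E"
  unfolding coherent_def using module_sheaf_fixed finite_type_fixed relations_fixed by blast

end

section \<open>Linear combinations, torsion and rank\<close>

context sheaf_of_modules
begin

context
  fixes U W and s :: "nat \<Rightarrow> 'm"
  assumes U: "zopen Z U" and W: "zopen Z W" "W \<subseteq> U"
begin

interpretation abelian_group "sect F W"
  by (rule abelian_group_sect[OF W(1)])

lemma lincomb_term_closed:
  "s i \<in> carrier (sect F U) \<Longrightarrow> f \<in> regular Z W \<Longrightarrow> f \<odot>\<^bsub>sect F W\<^esub> res F U W (s i) \<in> carrier (sect F W)"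
  by (intro smult_closed[OF W(1)] res_closed[OF U W])

lemma lincomb_Suc:
  assumes "\<And>i. i < Suc k \<Longrightarrow> s i \<in> carrier (sect F U)" "\<And>i. i < Suc k \<Longrightarrow> c i \<in> regular Z W"
  shows "lincomb F U W (Suc k) c s =
    (c k \<odot>\<^bsub>sect F W\<^esub> res F U W (s k)) \<oplus>\<^bsub>sect F W\<^esub> lincomb F U W k c s"
proof -
  have "c i \<odot>\<^bsub>sect F W\<^esub> res F U W (s i) \<in> carrier (sect F W)" if "i < Suc k" for i
    using assms[OF that] by (rule lincomb_term_closed)
  then show ?thesis
    unfolding lincomb_def lessThan_Suc by (intro finsum_insert) auto
qed

lemma lincomb_append:
  assumes "\<And>i. i < k + l \<Longrightarrow> s i \<in> carrier (sect F U)" "\<And>i. i < k + l \<Longrightarrow> c i \<in> regular Z W"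
  shows "lincomb F U W (k + l) c s =
    lincomb F U W k c s \<oplus>\<^bsub>sect F W\<^esub> finsum (sect F W) (\<lambda>i. c i \<odot>\<^bsub>sect F W\<^esub> res F U W (s i)) {k..<k + l}"
proof -
  have t: "c i \<odot>\<^bsub>sect F W\<^esub> res F U W (s i) \<in> carrier (sect F W)" if "i < k + l" for i
    using assms[OF that] by (rule lincomb_term_closed)
  have "{..<k + l} = {..<k} \<union> {k..<k + l}" "{..<k} \<inter> {k..<k + l} = {}" by auto
  then show ?thesis
    unfolding lincomb_def using t by (simp only:) (rule finsum_Un_disjoint; simp)
qed

lemma lincomb_add:
  assumes "\<And>i. i < k \<Longrightarrow> s i \<in> carrier (sect F U)" "\<And>i. i < k \<Longrightarrow> c i \<in> regular Z W"
    "\<And>i. i < k \<Longrightarrow> d i \<in> regular Z W"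
  shows "lincomb F U W k (\<lambda>i. \<lambda>x\<in>W. c i x + d i x) s =
    lincomb F U W k c s \<oplus>\<^bsub>sect F W\<^esub> lincomb F U W k d s"
proof -
  have t: "c i \<odot>\<^bsub>sect F W\<^esub> res F U W (s i) \<in> carrier (sect F W)"
    "d i \<odot>\<^bsub>sect F W\<^esub> res F U W (s i) \<in> carrier (sect F W)" if "i < k" for i
    using assms[OF that] by (auto intro: lincomb_term_closed)
  have "(\<lambda>x\<in>W. c i x + d i x) \<odot>\<^bsub>sect F W\<^esub> res F U W (s i) =
      (c i \<odot>\<^bsub>sect F W\<^esub> res F U W (s i)) \<oplus>\<^bsub>sect F W\<^esub> (d i \<odot>\<^bsub>sect F W\<^esub> res F U W (s i))" if "i < k" for i
    using module.smult_l_distr[OF module_sect[OF W(1)], of "c i" "d i" "res F U W (s i)"]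
      res_closed[OF U W assms(1)[OF that]] assms(2,3)[OF that] by simp
  then have "lincomb F U W k (\<lambda>i. \<lambda>x\<in>W. c i x + d i x) s =
    finsum (sect F W) (\<lambda>i. (c i \<odot>\<^bsub>sect F W\<^esub> res F U W (s i)) \<oplus>\<^bsub>sect F W\<^esub> (d i \<odot>\<^bsub>sect F W\<^esub> res F U W (s i))) {..<k}"
    unfolding lincomb_def using t by (intro finsum_cong') auto
  also have "\<dots> = lincomb F U W k c s \<oplus>\<^bsub>sect F W\<^esub> lincomb F U W k d s"
    unfolding lincomb_def using t by (intro finsum_addf) auto
  finally show ?thesis .
qed

lemma lincomb_smult:
  assumes "\<And>i. i < k \<Longrightarrow> s i \<in> carrier (sect F U)" "\<And>i. i < k \<Longrightarrow> c i \<in> regular Z W"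
    "f \<in> regular Z W"
  shows "lincomb F U W k (\<lambda>i. \<lambda>x\<in>W. f x * c i x) s = f \<odot>\<^bsub>sect F W\<^esub> lincomb F U W k c s"
proof -
  have t: "c i \<odot>\<^bsub>sect F W\<^esub> res F U W (s i) \<in> carrier (sect F W)"
    "f \<odot>\<^bsub>sect F W\<^esub> (c i \<odot>\<^bsub>sect F W\<^esub> res F U W (s i)) \<in> carrier (sect F W)" if "i < k" for i
    using lincomb_term_closed[OF assms(1)[OF that] assms(2)[OF that]] smult_closed[OF W(1) assms(3)] by auto
  have eq: "(\<lambda>x\<in>W. f x * c i x) \<odot>\<^bsub>sect F W\<^esub> res F U W (s i) =
      f \<odot>\<^bsub>sect F W\<^esub> (c i \<odot>\<^bsub>sect F W\<^esub> res F U W (s i))" if "i < k" for i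
    using module.smult_assoc1[OF module_sect[OF W(1)], of f "c i" "res F U W (s i)"]
      res_closed[OF U W assms(1)[OF that]] assms(2)[OF that] assms(3) by simp
  have "f \<odot>\<^bsub>sect F W\<^esub> lincomb F U W k c s =
      finsum (sect F W) (\<lambda>i. f \<odot>\<^bsub>sect F W\<^esub> (c i \<odot>\<^bsub>sect F W\<^esub> res F U W (s i))) {..<k}"
    unfolding lincomb_def using t assms(3)
    by (intro module.finsum_smult_ldistr[OF module_sect[OF W(1)]]) auto
  also have "\<dots> = lincomb F U W k (\<lambda>i. \<lambda>x\<in>W. f x * c i x) s"
    unfolding lincomb_def using t eq by (intro finsum_cong') auto
  finally show ?thesis ..
qed

lemma lincomb_zero_coeffs:
  assumes "\<And>i. i < k \<Longrightarrow> s i \<in> carrier (sect F U)" "\<And>i. i < k \<Longrightarrow> c i = (\<lambda>x\<in>W. 0)"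
  shows "lincomb F U W k c s = \<zero>\<^bsub>sect F W\<^esub>"
proof -
  have "c i \<odot>\<^bsub>sect F W\<^esub> res F U W (s i) = \<zero>\<^bsub>sect F W\<^esub>" if "i < k" for i
    using cscale_0[OF W(1) res_closed[OF U W assms(1)[OF that]]] assms(2)[OF that]
    by (simp only: cscale_def)
  then have "lincomb F U W k c s = finsum (sect F W) (\<lambda>i. \<zero>\<^bsub>sect F W\<^esub>) {..<k}"
    unfolding lincomb_def by (intro finsum_cong') auto
  then show ?thesis by simp
qed

text \<open>Substituting combinations of \<open>s\<close> into a combination with coefficients
  \<open>a\<close> multiplies the row \<open>a\<close> by the matrix \<open>d\<close>. A row
  annihilating the matrix therefore gives a relation.\<close>

lemma lincomb_relation:
  fixes l :: nat
  assumes "\<And>j. j < k \<Longrightarrow> s j \<in> carrier (sect F U)"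
    "\<And>i j. i < l \<Longrightarrow> j < k \<Longrightarrow> d i j \<in> regular Z W" "\<And>i. i < l \<Longrightarrow> a i \<in> regular Z W"
  shows "finsum (sect F W) (\<lambda>i. a i \<odot>\<^bsub>sect F W\<^esub> lincomb F U W k (d i) s) {..<l} =
    lincomb F U W k (\<lambda>j. \<lambda>x\<in>W. \<Sum>i<l. a i x * d i j x) s"
  using assms(2,3)
proof (induction l)
  case 0
  show ?case
    using lincomb_zero_coeffs[of k "\<lambda>j. \<lambda>x\<in>W. 0"] assms(1)
    by (simp only: lessThan_0 sum.empty finsum_empty)
next
  case (Suc l)
  let ?t = "\<lambda>i. a i \<odot>\<^bsub>sect F W\<^esub> lincomb F U W k (d i) s"
  have t: "?t i \<in> carrier (sect F W)" if "i < Suc l" for i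
    using Suc.prems that
    by (intro smult_closed[OF W(1)] lincomb_closed[OF U W] assms(1)) auto
  have r: "(\<lambda>x\<in>W. a i x * d i j x) \<in> regular Z W" if "i < Suc l" "j < k" for i j
    using Suc.prems that by (intro regular_add_mult) auto
  have "finsum (sect F W) ?t {..<Suc l} = ?t l \<oplus>\<^bsub>sect F W\<^esub> finsum (sect F W) ?t {..<l}"
    unfolding lessThan_Suc using t by (intro finsum_insert) auto
  also have "finsum (sect F W) ?t {..<l} = lincomb F U W k (\<lambda>j. \<lambda>x\<in>W. \<Sum>i<l. a i x * d i j x) s"
    using Suc.prems by (intro Suc.IH) auto
  also have "(\<lambda>j. \<lambda>x\<in>W. \<Sum>i<l. a i x * d i j x) = (\<lambda>j. \<lambda>x\<in>W. \<Sum>i<l. (\<lambda>x\<in>W. a i x * d i j x) x)"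
    by (intro ext restrict_ext) simp
  also have "?t l = lincomb F U W k (\<lambda>j. \<lambda>x\<in>W. a l x * d l j x) s"
    using Suc.prems by (intro lincomb_smult[symmetric] assms(1)) auto
  also have "lincomb F U W k (\<lambda>j. \<lambda>x\<in>W. a l x * d l j x) s \<oplus>\<^bsub>sect F W\<^esub>
      lincomb F U W k (\<lambda>j. \<lambda>x\<in>W. \<Sum>i<l. (\<lambda>x\<in>W. a i x * d i j x) x) s =
    lincomb F U W k (\<lambda>j. \<lambda>x\<in>W. (\<lambda>x\<in>W. a l x * d l j x) x + (\<lambda>x\<in>W. \<Sum>i<l. (\<lambda>x\<in>W. a i x * d i j x) x) x) s"
    by (rule lincomb_add[symmetric]) (use assms(1) r in \<open>auto intro!: regular_sum[OF W(1)] simp del: restrict_apply\<close>)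
  also have "(\<lambda>j. \<lambda>x\<in>W. (\<lambda>x\<in>W. a l x * d l j x) x + (\<lambda>x\<in>W. \<Sum>i<l. (\<lambda>x\<in>W. a i x * d i j x) x) x) =
    (\<lambda>j. \<lambda>x\<in>W. \<Sum>i<Suc l. a i x * d i j x)"
    by (intro ext restrict_ext) (simp add: add.commute)
  finally show ?case .
qed

lemma lincomb_res:
  assumes V: "zopen Z V" "V \<subseteq> W" and s: "\<And>i. i < k \<Longrightarrow> s i \<in> carrier (sect F U)"
    and c: "\<And>i. i < k \<Longrightarrow> c i \<in> regular Z W"
  shows "res F W V (lincomb F U W k c s) = lincomb F U V k (\<lambda>i. restrict (c i) V) s"
  using s c
proof (induction k)
  case 0
  interpret V: abelian_group "sect F V" by (rule abelian_group_sect[OF V(1)])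
  show ?case using res_zero[OF W(1) V] by (simp add: lincomb_def)
next
  case (Suc k)
  have VU: "V \<subseteq> U" using V W by blast
  interpret V: abelian_group "sect F V" by (rule abelian_group_sect[OF V(1)])
  have r: "restrict (c i) V \<in> regular Z V" if "i < Suc k" for i
    by (rule regular_restrict[OF Suc.prems(2)[OF that] V])
  have t: "restrict (c i) V \<odot>\<^bsub>sect F V\<^esub> res F U V (s i) \<in> carrier (sect F V)" if "i < Suc k" for i
    by (intro smult_closed[OF V(1)] r that res_closed[OF U V(1) VU] Suc.prems(1))
  have "res F W V (lincomb F U W (Suc k) c s) =
     res F W V (c k \<odot>\<^bsub>sect F W\<^esub> res F U W (s k)) \<oplus>\<^bsub>sect F V\<^esub> res F W V (lincomb F U W k c s)"
    using Suc.prems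
    by (subst lincomb_Suc) (auto intro!: res_add[OF W(1) V] lincomb_term_closed lincomb_closed[OF U W])
  also have "res F W V (lincomb F U W k c s) = lincomb F U V k (\<lambda>i. restrict (c i) V) s"
    using Suc.prems by (intro Suc.IH) auto
  also have "res F W V (c k \<odot>\<^bsub>sect F W\<^esub> res F U W (s k)) = restrict (c k) V \<odot>\<^bsub>sect F V\<^esub> res F U V (s k)"
    using res_smult[OF W(1) V res_closed[OF U W Suc.prems(1)[OF lessI]] Suc.prems(2)[OF lessI]]
      res_res[OF U W(1) V(1) V(2) W(2) Suc.prems(1)[OF lessI]] by (simp only:)
  also have "(restrict (c k) V \<odot>\<^bsub>sect F V\<^esub> res F U V (s k)) \<oplus>\<^bsub>sect F V\<^esub> lincomb F U V k (\<lambda>i. restrict (c i) V) s =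
     lincomb F U V (Suc k) (\<lambda>i. restrict (c i) V) s"
    unfolding lincomb_def lessThan_Suc using t by (intro V.finsum_insert[symmetric]) auto
  finally show ?case .
qed

text \<open>Independence is a statement about sections over a fixed open set. This permits two
  families living over different open sets to be moved to their intersection first.\<close>

lemma lincomb_res_sections:
  assumes V: "zopen Z V" "V \<subseteq> W" and s: "\<And>i. i < k \<Longrightarrow> s i \<in> carrier (sect F U)"
    and u: "\<And>i. i < k \<Longrightarrow> u i = res F U W (s i)"
    and c: "\<And>i. i < k \<Longrightarrow> c i \<in> regular Z V"
  shows "lincomb F W V k c u = lincomb F U V k c s"
proof -
  have VU: "V \<subseteq> U" using V W by blast
  interpret V: abelian_group "sect F V" by (rule abelian_group_sect[OF V(1)])
  have "res F W V (u i) = res F U V (s i)" "c i \<odot>\<^bsub>sect F V\<^esub> res F U V (s i) \<in> carrier (sect F V)" if "i < k" for i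
    using res_res[OF U W(1) V(1) V(2) W(2) s[OF that]] u[OF that]
      smult_closed[OF V(1) c[OF that] res_closed[OF U V(1) VU s[OF that]]] by auto
  then show ?thesis
    unfolding lincomb_def by (intro V.finsum_cong') auto
qed

end

text \<open>Every functional sends \<open>s\<close> to a regular function that vanishes on a
  nonempty open set, hence everywhere by irreducibility. So \<open>s\<close> and the zero section
  have the same image in the bidual, and injectivity identifies them.\<close>

lemma torsion_free:
  assumes inj: "inj_on (bidual_map Z F U) (carrier (sect F U))"
    and U: "zopen Z U" and V: "zopen Z V" "V \<subseteq> U" "V \<noteq> {}"
    and s: "s \<in> carrier (sect F U)" and zero: "res F U V s = \<zero>\<^bsub>sect F V\<^esub>"
  shows "s = \<zero>\<^bsub>sect F U\<^esub>"
proof -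
  \<comment> \<open>Stated for an arbitrary \<open>t\<close>, since it is applied both to
    \<open>s\<close> and to the zero section.\<close>
  have van: "\<phi> W (res F U W t) = (\<lambda>x\<in>W. 0)"
    if t: "t \<in> carrier (sect F U)" "res F U V t = \<zero>\<^bsub>sect F V\<^esub>"
      and W: "zopen Z W" "W \<subseteq> U" and \<phi>: "\<phi> \<in> dual_sections Z F W" for W \<phi> t
  proof -
    let ?f = "\<phi> W (res F U W t)"
    let ?VW = "V \<inter> W"
    have VW: "zopen Z ?VW" "?VW \<subseteq> W" "?VW \<subseteq> U" "?VW \<subseteq> V" using V W zopen_Int by auto
    note \<phi>D = \<phi>[unfolded dual_sections_def, THEN CollectD, THEN conjunct2, rule_format]
    note rt = res_closed[OF U W t(1)]
    have f: "?f \<in> regular Z W"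
      using \<phi>D[of W, THEN conjunct1] W rt by auto
    have "\<phi> ?VW \<zero>\<^bsub>sect F ?VW\<^esub> = (\<lambda>x\<in>?VW. 0)"
    proof -
      have z: "\<zero>\<^bsub>sect F ?VW\<^esub> \<in> carrier (sect F ?VW)" by (rule zero_closed[OF VW(1)])
      have "\<phi> ?VW ((\<lambda>x\<in>?VW. 0) \<odot>\<^bsub>sect F ?VW\<^esub> \<zero>\<^bsub>sect F ?VW\<^esub>) =
          (\<lambda>x\<in>?VW. (\<lambda>x\<in>?VW. 0) x * \<phi> ?VW \<zero>\<^bsub>sect F ?VW\<^esub> x)"
        using \<phi>D[of ?VW, THEN conjunct2, THEN conjunct2, THEN conjunct1] VW z regular_const[OF VW(1)]
        by blast
      also have "\<dots> = (\<lambda>x\<in>?VW. 0)" by (intro restrict_ext) simp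
      finally show ?thesis
        using cscale_zero[OF VW(1), of 0] by (simp only: cscale_def)
    qed
    moreover have "res F W ?VW (res F U W t) = \<zero>\<^bsub>sect F ?VW\<^esub>"
      using res_res[OF U W(1) VW(1,2) W(2) t(1)] res_res[OF U V(1) VW(1,4) V(2) t(1)]
        res_zero[OF V(1) VW(1,4)] t(2) by simp
    moreover have "\<phi> ?VW (res F W ?VW (res F U W t)) = restrict ?f ?VW"
      using \<phi>D[of W, THEN conjunct2, THEN conjunct2, THEN conjunct2] VW W rt by blast
    ultimately have f0: "?f x = 0" if "x \<in> ?VW" for x
      using that by (metis restrict_apply')
    have "?f x = 0" if x: "x \<in> W" for x
    proof (rule ccontr)
      assume nz: "?f x \<noteq> 0"
      have "V \<inter> {x \<in> W. ?f x \<noteq> 0} \<noteq> {}"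
        using x nz V by (intro irreducible zopen_nonzero f) auto
      then show False using f0 by auto
    qed
    then show ?thesis
      using regular_extensional[OF f] by (intro extensionalityI[of _ W]) auto
  qed
  have "bidual_map Z F U s = bidual_map Z F U \<zero>\<^bsub>sect F U\<^esub>"
    unfolding bidual_map_def
    using van[OF s zero] van[OF zero_closed[OF U] res_zero[OF U V(1,2)]]
    by (intro restrict_ext) auto
  then show ?thesis
    using inj s zero_closed[OF U] by (auto dest: inj_onD)
qed

text \<open>Where the coefficient of a relation is nonzero it is invertible, so the relation kills
  \<open>s\<close> on that nonempty open set, and torsion-freeness kills \<open>s\<close>
  altogether.\<close>

lemma generically_independent_single:
  assumes inj: "\<And>U. zopen Z U \<Longrightarrow> inj_on (bidual_map Z F U) (carrier (sect F U))"
    and U: "zopen Z U" and s: "s \<in> carrier (sect F U)" "s \<noteq> \<zero>\<^bsub>sect F U\<^esub>"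
  shows "generically_independent Z F U 1 (\<lambda>_. s)"
  unfolding generically_independent_def
proof (intro allI impI ballI, elim conjE, rule ccontr)
  fix V c i x
  assume V: "zopen Z V" "V \<subseteq> U" and c: "\<forall>i<1::nat. c i \<in> regular Z V"
    and rel: "lincomb F U V 1 c (\<lambda>_. s) = \<zero>\<^bsub>sect F V\<^esub>" and i: "i < 1" and x: "x \<in> V" "c i x \<noteq> 0"
  have c: "c 0 \<in> regular Z V" "c 0 x \<noteq> 0" using c x i by auto
  let ?r = "res F U V s"
  have r: "?r \<in> carrier (sect F V)" by (rule res_closed[OF U V s(1)])
  interpret V: abelian_group "sect F V" by (rule abelian_group_sect[OF V(1)])
  have rel': "c 0 \<odot>\<^bsub>sect F V\<^esub> ?r = \<zero>\<^bsub>sect F V\<^esub>"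
    using rel lincomb_Suc[OF U V, of 0 "\<lambda>_. s" c] s(1) c smult_closed[OF V(1) c(1) r]
    by (simp add: lincomb_def)
  define V' where "V' = {x \<in> V. c 0 x \<noteq> 0}"
  have V': "zopen Z V'" "V' \<subseteq> V" "V' \<noteq> {}" "V' \<subseteq> U"
    using zopen_nonzero[OF c(1)] x c V by (auto simp: V'_def)
  let ?c = "restrict (c 0) V'"
  have c': "?c \<in> regular Z V'" by (rule regular_restrict[OF c(1) V'(1,2)])
  have inv: "(\<lambda>x\<in>V'. inverse (?c x)) \<in> regular Z V'"
    by (rule regular_inverse[OF c']) (auto simp: V'_def)
  let ?s = "res F U V' s"
  have s': "?s \<in> carrier (sect F V')" by (rule res_closed[OF U V'(1,4) s(1)])
  have "?c \<odot>\<^bsub>sect F V'\<^esub> ?s = \<zero>\<^bsub>sect F V'\<^esub>"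
    using res_smult[OF V(1) V'(1,2) r c(1)] rel' res_zero[OF V(1) V'(1,2)]
      res_res[OF U V(1) V'(1,2) V(2) s(1)] by simp
  then have "(\<lambda>x\<in>V'. inverse (?c x)) \<odot>\<^bsub>sect F V'\<^esub> (?c \<odot>\<^bsub>sect F V'\<^esub> ?s) = \<zero>\<^bsub>sect F V'\<^esub>"
    using module.smult_r_null[OF module_sect[OF V'(1)], of "\<lambda>x\<in>V'. inverse (?c x)"] inv
    by (simp only: str_ring_simps)
  moreover have "(\<lambda>x\<in>V'. inverse (?c x)) \<odot>\<^bsub>sect F V'\<^esub> (?c \<odot>\<^bsub>sect F V'\<^esub> ?s) =
      (\<lambda>x\<in>V'. (\<lambda>x\<in>V'. inverse (?c x)) x * ?c x) \<odot>\<^bsub>sect F V'\<^esub> ?s"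
    using module.smult_assoc1[OF module_sect[OF V'(1)], of "\<lambda>x\<in>V'. inverse (?c x)" ?c ?s] inv c' s'
    by (simp only: str_ring_simps)
  moreover have "(\<lambda>x\<in>V'. (\<lambda>x\<in>V'. inverse (?c x)) x * ?c x) = (\<lambda>x\<in>V'. 1)"
    by (intro restrict_ext) (simp add: V'_def)
  ultimately have "?s = \<zero>\<^bsub>sect F V'\<^esub>"
    using cscale_1[OF V'(1) s'] by (simp only: cscale_def)
  then have "s = \<zero>\<^bsub>sect F U\<^esub>"
    by (rule torsion_free[OF inj[OF U] U V'(1,4,3) s(1)])
  then show False using s(2) by simp
qed

text \<open>The number \<open>k0\<close> of generators near one chosen point bounds all independent
  families, wherever they live: over the intersection with their own open set, more than
  \<open>k0\<close> sections expressed in these generators admit a nontrivial relation.\<close>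

lemma independent_bound:
  assumes ft: "finite_type Z F" and ne: "points Z \<noteq> {}"
  shows "\<exists>K. \<forall>k U s. zopen Z U \<and> U \<noteq> {} \<and> (\<forall>i<k. s i \<in> carrier (sect F U)) \<and>
    generically_independent Z F U k s \<longrightarrow> k \<le> K"
proof -
  from ne obtain x where "x \<in> points Z" by blast
  with ft obtain U0 k0 s0 where U0: "zopen Z U0" "x \<in> U0" and s0: "\<forall>i<k0. s0 i \<in> carrier (sect F U0)"
    and gen: "generating Z F U0 k0 s0"
    unfolding finite_type_iff by blast
  have "k \<le> k0" if U: "zopen Z U" "U \<noteq> {}" and s: "\<forall>i<k. s i \<in> carrier (sect F U)"
    and ind: "generically_independent Z F U k s" for k :: nat and U s
  proof (rule ccontr)
    assume "\<not> k \<le> k0"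
    then have k: "k0 < k" by simp
    define V where "V = U \<inter> U0"
    have V: "zopen Z V" "V \<subseteq> U" "V \<subseteq> U0" "V \<noteq> {}"
      using U U0 zopen_Int irreducible[of U U0] by (auto simp: V_def)
    then obtain y where y: "y \<in> V" by blast
    \<comment> \<open>Neighbourhood and coefficients are packed into one pair, so that a single
      choice function over \<open>i\<close> supplies both.\<close>
    have "\<forall>i<k. \<exists>Wc. zopen Z (fst Wc) \<and> y \<in> fst Wc \<and> fst Wc \<subseteq> V \<and> (\<forall>j<k0. snd Wc j \<in> regular Z (fst Wc)) \<and>
        res F V (fst Wc) (res F U V (s i)) = lincomb F U0 (fst Wc) k0 (snd Wc) s0"
    proof (intro allI impI)
      fix i assume "i < k"
      then have "res F U V (s i) \<in> carrier (sect F V)"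
        using s by (intro res_closed[OF U(1) V(1,2)]) auto
      then obtain W c where "zopen Z W \<and> y \<in> W \<and> W \<subseteq> V \<and> (\<forall>j<k0. c j \<in> regular Z W) \<and>
        res F V W (res F U V (s i)) = lincomb F U0 W k0 c s0"
        using gen V y unfolding generating_def by blast
      then show "\<exists>Wc. zopen Z (fst Wc) \<and> y \<in> fst Wc \<and> fst Wc \<subseteq> V \<and> (\<forall>j<k0. snd Wc j \<in> regular Z (fst Wc)) \<and>
        res F V (fst Wc) (res F U V (s i)) = lincomb F U0 (fst Wc) k0 (snd Wc) s0"
        by (intro exI[of _ "(W, c)"]) simp
    qed
    then obtain Wc where Wc: "\<forall>i<k. zopen Z (fst (Wc i)) \<and> y \<in> fst (Wc i) \<and> fst (Wc i) \<subseteq> V \<and>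
        (\<forall>j<k0. snd (Wc i) j \<in> regular Z (fst (Wc i))) \<and>
        res F V (fst (Wc i)) (res F U V (s i)) = lincomb F U0 (fst (Wc i)) k0 (snd (Wc i)) s0"
      unfolding choice_iff' by blast
    \<comment> \<open>A finite, nonempty intersection, as \<open>k0 < k\<close>. All the sections
      now have coefficients over the same open set, namely the entries of the matrix
      \<open>d\<close>.\<close>
    define W where "W = (\<Inter>i\<in>{..<k}. fst (Wc i))"
    have W: "zopen Z W" unfolding W_def using Wc k by (intro zopen_INT) auto
    have yW: "y \<in> W" using Wc by (auto simp: W_def)
    have Wi: "W \<subseteq> fst (Wc i)" if "i < k" for i using that by (auto simp: W_def)
    have WV: "W \<subseteq> V" using Wi[of 0] Wc k by auto
    define d where "d i j = restrict (snd (Wc i) j) W" for i j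
    have d: "d i j \<in> regular Z W" if "i < k" "j < k0" for i j
      unfolding d_def using Wc that by (intro regular_restrict[OF _ W Wi]) auto
    have sW: "res F U W (s i) = lincomb F U0 W k0 (d i) s0" if i: "i < k" for i
    proof -
      let ?W = "fst (Wc i)"
      have wi: "zopen Z ?W" "?W \<subseteq> V" "\<And>j. j < k0 \<Longrightarrow> snd (Wc i) j \<in> regular Z ?W"
        and eq: "res F V ?W (res F U V (s i)) = lincomb F U0 ?W k0 (snd (Wc i)) s0"
        using Wc i by auto
      have si: "s i \<in> carrier (sect F U)" using s i by auto
      have WU: "?W \<subseteq> U" "?W \<subseteq> U0" using wi V by auto
      have "res F U W (s i) = res F ?W W (res F U ?W (s i))"
        by (rule res_res[OF U(1) wi(1) W Wi[OF i] WU(1) si, symmetric])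
      also have "res F U ?W (s i) = lincomb F U0 ?W k0 (snd (Wc i)) s0"
        using res_res[OF U(1) V(1) wi(1,2) V(2) si] eq by simp
      also have "res F ?W W (lincomb F U0 ?W k0 (snd (Wc i)) s0) = lincomb F U0 W k0 (d i) s0"
        unfolding d_def using s0 wi(3) by (intro lincomb_res[OF U0(1) wi(1) WU(2) W Wi[OF i]]) auto
      finally show ?thesis .
    qed
    have "\<exists>a. (\<forall>i\<in>{..<k}. a i \<in> regular Z W) \<and> (\<exists>i\<in>{..<k}. \<exists>x\<in>W. a i x \<noteq> 0) \<and>
      (\<forall>j<k0. \<forall>x\<in>W. (\<Sum>i\<in>{..<k}. a i x * d i j x) = 0)"
      using yW k d by (intro regular_relation W) auto
    then obtain a where a: "\<And>i. i < k \<Longrightarrow> a i \<in> regular Z W" "\<exists>i<k. \<exists>x\<in>W. a i x \<noteq> 0"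
      "\<And>j x. j < k0 \<Longrightarrow> x \<in> W \<Longrightarrow> (\<Sum>i<k. a i x * d i j x) = 0"
      by auto
    have WU: "W \<subseteq> U" "W \<subseteq> U0" using WV V by auto
    interpret W: abelian_group "sect F W" by (rule abelian_group_sect[OF W])
    have t: "a i \<odot>\<^bsub>sect F W\<^esub> lincomb F U0 W k0 (d i) s0 \<in> carrier (sect F W)" if "i < k" for i
      using that s0 d by (intro smult_closed[OF W] a lincomb_closed[OF U0(1) W WU(2)]) auto
    have "lincomb F U W k a s = finsum (sect F W) (\<lambda>i. a i \<odot>\<^bsub>sect F W\<^esub> lincomb F U0 W k0 (d i) s0) {..<k}"
      unfolding lincomb_def[of F U] using sW t by (intro W.finsum_cong') auto
    also have "\<dots> = lincomb F U0 W k0 (\<lambda>j. \<lambda>x\<in>W. \<Sum>i<k. a i x * d i j x) s0"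
      using s0 d a(1) by (intro lincomb_relation[OF U0(1) W WU(2)]) auto
    also have "\<dots> = \<zero>\<^bsub>sect F W\<^esub>"
      using s0 a(3) by (intro lincomb_zero_coeffs[OF U0(1) W WU(2)] restrict_ext) auto
    finally have "lincomb F U W k a s = \<zero>\<^bsub>sect F W\<^esub>" .
    with ind W yW WU a(1) have "\<forall>i<k. \<forall>x\<in>W. a i x = 0"
      unfolding generically_independent_def by blast
    with a(2) show False by blast
  qed
  then show ?thesis by blast
qed

definition independent_sizes :: "nat set" where
  "independent_sizes = {k. \<exists>U s. zopen Z U \<and> U \<noteq> {} \<and>
     (\<forall>i<k. s i \<in> carrier (sect F U)) \<and> generically_independent Z F U k s}"

text \<open>The uniform bound makes the set of sizes finite, and the empty family makes it nonempty,
  so the \<open>Sup\<close> of naturals in \<open>sheaf_rank\<close> is a \<open>Max\<close> and is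
  attained.\<close>

lemma sheaf_rank_bounds:
  assumes "finite_type Z F" "points Z \<noteq> {}"
  shows "k \<in> independent_sizes \<Longrightarrow> k \<le> sheaf_rank Z F"
    and "sheaf_rank Z F \<in> independent_sizes"
proof -
  obtain K where "\<forall>k\<in>independent_sizes. k \<le> K"
    using independent_bound[OF assms] unfolding independent_sizes_def by blast
  then have fin: "finite independent_sizes"
    by (meson finite_nat_set_iff_bounded_le)
  have "0 \<in> independent_sizes"
    unfolding independent_sizes_def using assms(2) zopen_points
    by (auto simp: generically_independent_def intro!: exI[of _ "points Z"])
  then have "independent_sizes \<noteq> {}" by blast
  moreover have "sheaf_rank Z F = Sup independent_sizes"
    by (simp add: sheaf_rank_def independent_sizes_def)
  ultimately have *: "sheaf_rank Z F = Max independent_sizes" "independent_sizes \<noteq> {}"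
    using fin by (simp_all add: cSup_eq_Max)
  show "k \<in> independent_sizes \<Longrightarrow> k \<le> sheaf_rank Z F"
    using fin * by simp
  show "sheaf_rank Z F \<in> independent_sizes"
    using fin * Max_in by metis
qed

end

context idempotent_endo
begin

lemma generically_independent_fixed:
  assumes U: "zopen Z U" and s: "\<And>i. i < k \<Longrightarrow> s i \<in> carrier (sect E U)"
  shows "generically_independent Z E U k s \<longleftrightarrow> generically_independent Z F U k s"
proof -
  have "lincomb E U V k c s = lincomb F U V k c s"
    if "zopen Z V" "V \<subseteq> U" "\<forall>i<k. c i \<in> regular Z V" for V c
    using that(3) by (intro lincomb_fixed U that s) auto
  then show ?thesis
    unfolding generically_independent_def fixed_sheaf_simps by (simp cong: conj_cong)
qed

lemma sheaf_of_modules_fixed: "sheaf_of_modules Z S E"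
  by unfold_locales (rule module_sheaf_fixed)

end

section \<open>Splittings by complementary projections, and the drop of rank\<close>

locale complementary_endos = sheaf_of_modules +
  fixes \<phi> \<psi>
  assumes endo1: "sheaf_endo Z F \<phi>" and endo2: "sheaf_endo Z F \<psi>"
    and sum: "zopen Z U \<Longrightarrow> s \<in> carrier (sect F U) \<Longrightarrow> \<phi> U s \<oplus>\<^bsub>sect F U\<^esub> \<psi> U s = s"
    and comp1: "zopen Z U \<Longrightarrow> s \<in> carrier (sect F U) \<Longrightarrow> \<phi> U (\<psi> U s) = \<zero>\<^bsub>sect F U\<^esub>"
    and comp2: "zopen Z U \<Longrightarrow> s \<in> carrier (sect F U) \<Longrightarrow> \<psi> U (\<phi> U s) = \<zero>\<^bsub>sect F U\<^esub>"
begin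

text \<open>The hypotheses are symmetric, so whatever is shown for the first summand holds for the
  second.\<close>

lemma swap: "complementary_endos Z S F \<psi> \<phi>"
proof unfold_locales
  fix U s assume U: "zopen Z U" and s: "s \<in> carrier (sect F U)"
  then show "\<psi> U s \<oplus>\<^bsub>sect F U\<^esub> \<phi> U s = s"
    using sum[OF U s] abelian_monoid.a_comm[OF abelian_group.axioms(1)[OF abelian_group_sect[OF U]]]
      endo_closed[OF endo1 U s] endo_closed[OF endo2 U s] by metis
qed (use endo1 endo2 comp1 comp2 in auto)

text \<open>Apply \<phi> to the decomposition of \<open>s\<close> into \<phi>- and \<psi>-parts; the
  mixed term vanishes.\<close>

lemma idempotent1: "idempotent_endo Z S F \<phi>"
proof unfold_locales
  fix U s assume U: "zopen Z U" and s: "s \<in> carrier (sect F U)"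
  interpret abelian_group "sect F U" by (rule abelian_group_sect[OF U])
  note c = endo_closed[OF endo1 U s] endo_closed[OF endo2 U s]
  have "\<phi> U s = \<phi> U (\<phi> U s \<oplus>\<^bsub>sect F U\<^esub> \<psi> U s)"
    using sum[OF U s] by simp
  also have "\<dots> = \<phi> U (\<phi> U s) \<oplus>\<^bsub>sect F U\<^esub> \<phi> U (\<psi> U s)"
    by (rule endo_add[OF endo1 U c])
  also have "\<dots> = \<phi> U (\<phi> U s)"
    using comp1[OF U s] endo_closed[OF endo1 U c(1)] by simp
  finally show "\<phi> U (\<phi> U s) = \<phi> U s" ..
qed (rule endo1)

lemma idempotent2: "idempotent_endo Z S F \<psi>"
  by (rule complementary_endos.idempotent1[OF swap])

abbreviation "E1 \<equiv> fixed_sheaf \<phi> F"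
abbreviation "E2 \<equiv> fixed_sheaf \<psi> F"

lemma endo_other_vanishes:
  assumes U: "zopen Z U"
  shows "s \<in> carrier (sect E2 U) \<Longrightarrow> \<phi> U s = \<zero>\<^bsub>sect F U\<^esub>"
    and "s \<in> carrier (sect E1 U) \<Longrightarrow> \<psi> U s = \<zero>\<^bsub>sect F U\<^esub>"
  using comp1[OF U, of s] comp2[OF U, of s] by auto

text \<open>Over the common open set, \<phi> turns a relation of the joint family into one among the
  members of \<open>s\<close>, and \<psi> turns it into one among the members of \<open>t\<close>.
  Both sets of coefficients therefore vanish.\<close>

lemma independent_append:
  assumes U1: "zopen Z U1" "U1 \<noteq> {}" and U2: "zopen Z U2" "U2 \<noteq> {}"
    and s: "\<And>i. i < k \<Longrightarrow> s i \<in> carrier (sect E1 U1)" and t: "\<And>i. i < l \<Longrightarrow> t i \<in> carrier (sect E2 U2)"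
    and inds: "generically_independent Z F U1 k s" and indt: "generically_independent Z F U2 l t"
  shows "k + l \<in> independent_sizes"
proof -
  define U where "U = U1 \<inter> U2"
  have U: "zopen Z U" "U \<subseteq> U1" "U \<subseteq> U2" "U \<noteq> {}"
    using U1 U2 zopen_Int irreducible[OF U1(1) U2(1)] by (auto simp: U_def)
  define u where "u i = (if i < k then res F U1 U (s i) else res F U2 U (t (i - k)))" for i
  have us: "u i \<in> carrier (sect F U)" "\<phi> U (u i) = res F U1 U (s i)" "\<psi> U (u i) = \<zero>\<^bsub>sect F U\<^esub>"
    if i: "i < k" for i
  proof -
    have si: "s i \<in> carrier (sect F U1)" "\<phi> U1 (s i) = s i" using s[OF i] by auto
    have u: "u i = res F U1 U (s i)" using i by (simp add: u_def)
    then show 1: "u i \<in> carrier (sect F U)"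
      using res_closed[OF U1(1) U(1,2) si(1)] by simp
    show 2: "\<phi> U (u i) = res F U1 U (s i)"
      using endo_res[OF endo1 U1(1) si(1) U(1,2)] si(2) u by simp
    show "\<psi> U (u i) = \<zero>\<^bsub>sect F U\<^esub>"
      using endo_other_vanishes(2)[OF U(1), of "u i"] 1 2 u by simp
  qed
  have ut: "u (i + k) \<in> carrier (sect F U)" "\<psi> U (u (i + k)) = res F U2 U (t i)" "\<phi> U (u (i + k)) = \<zero>\<^bsub>sect F U\<^esub>"
    if i: "i < l" for i
  proof -
    have ti: "t i \<in> carrier (sect F U2)" "\<psi> U2 (t i) = t i" using t[OF i] by auto
    have u: "u (i + k) = res F U2 U (t i)" by (simp add: u_def)
    then show 1: "u (i + k) \<in> carrier (sect F U)"
      using res_closed[OF U2(1) U(1,3) ti(1)] by simp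
    show 2: "\<psi> U (u (i + k)) = res F U2 U (t i)"
      using endo_res[OF endo2 U2(1) ti(1) U(1,3)] ti(2) u by simp
    show "\<phi> U (u (i + k)) = \<zero>\<^bsub>sect F U\<^esub>"
      using endo_other_vanishes(1)[OF U(1), of "u (i + k)"] 1 2 u by simp
  qed
  have ut': "u i \<in> carrier (sect F U)" "\<phi> U (u i) = \<zero>\<^bsub>sect F U\<^esub>" if "k \<le> i" "i < k + l" for i
    using ut[of "i - k"] that by auto
  have uc: "u i \<in> carrier (sect F U)" if "i < k + l" for i
    using us(1) ut'(1) that by (cases "i < k") auto
  have "generically_independent Z F U (k + l) u"
    unfolding generically_independent_def
  proof (intro allI impI, elim conjE)
    fix V c n
    assume V: "zopen Z V" "V \<noteq> {}" "V \<subseteq> U" and n: "n < k + l" and c: "\<forall>i<k + l. c i \<in> regular Z V"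
      and rel: "lincomb F U V (k + l) c u = \<zero>\<^bsub>sect F V\<^esub>"
    interpret V: abelian_group "sect F V" by (rule abelian_group_sect[OF V(1)])
    have cr: "c i \<in> regular Z V" if "i < k + l" for i using c that by auto
    have V12: "V \<subseteq> U1" "V \<subseteq> U2" using V U by auto
    \<comment> \<open>The index set is arbitrary because the block killed by \<phi> is the final one
      and the block killed by \<psi> is the initial one.\<close>
    have van: "finsum (sect F V) (\<lambda>i. c i \<odot>\<^bsub>sect F V\<^esub> res F U V (v i)) A = \<zero>\<^bsub>sect F V\<^esub>"
      if "\<And>i. i \<in> A \<Longrightarrow> v i = \<zero>\<^bsub>sect F U\<^esub>" "A \<subseteq> {..<k + l}" for v A
    proof (rule V.add.finprod_one_eqI)
      fix i assume "i \<in> A"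
      then show "c i \<odot>\<^bsub>sect F V\<^esub> res F U V (v i) = \<zero>\<^bsub>sect F V\<^esub>"
        using that cr[of i] res_zero[OF U(1) V(1,3)] module.smult_r_null[OF module_sect[OF V(1)], of "c i"]
        by auto
    qed
    have "\<zero>\<^bsub>sect F V\<^esub> = \<phi> V (lincomb F U V (k + l) c u)"
      using rel endo_zero[OF endo1 V(1)] by simp
    also have "\<dots> = lincomb F U V (k + l) c (\<lambda>i. \<phi> U (u i))"
      by (rule endo_lincomb[OF endo1 U(1) V(1,3) uc cr])
    also have "\<dots> = lincomb F U V k c (\<lambda>i. \<phi> U (u i)) \<oplus>\<^bsub>sect F V\<^esub>
       finsum (sect F V) (\<lambda>i. c i \<odot>\<^bsub>sect F V\<^esub> res F U V (\<phi> U (u i))) {k..<k + l}"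
      by (rule lincomb_append[OF U(1) V(1,3) endo_closed[OF endo1 U(1) uc] cr])
    also have "finsum (sect F V) (\<lambda>i. c i \<odot>\<^bsub>sect F V\<^esub> res F U V (\<phi> U (u i))) {k..<k + l} = \<zero>\<^bsub>sect F V\<^esub>"
      by (rule van) (use ut' in auto)
    also have "lincomb F U V k c (\<lambda>i. \<phi> U (u i)) = lincomb F U1 V k c s"
      by (rule lincomb_res_sections[OF U1(1) U(1,2) V(1,3)]) (use us s cr in auto)
    finally have "lincomb F U1 V k c s = \<zero>\<^bsub>sect F V\<^esub>"
      using lincomb_closed[OF U1(1) V(1) V12(1), of k s c] s cr by simp
    then have ck: "\<forall>i<k. \<forall>x\<in>V. c i x = 0"
      using inds V V12 cr unfolding generically_independent_def by (meson trans_less_add1)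
    have "\<zero>\<^bsub>sect F V\<^esub> = \<psi> V (lincomb F U V (k + l) c u)"
      using rel endo_zero[OF endo2 V(1)] by simp
    also have "\<dots> = lincomb F U V (k + l) c (\<lambda>i. \<psi> U (u i))"
      by (rule endo_lincomb[OF endo2 U(1) V(1,3) uc cr])
    also have "\<dots> = lincomb F U V k c (\<lambda>i. \<psi> U (u i)) \<oplus>\<^bsub>sect F V\<^esub>
       finsum (sect F V) (\<lambda>i. c i \<odot>\<^bsub>sect F V\<^esub> res F U V (\<psi> U (u i))) {k..<k + l}"
      by (rule lincomb_append[OF U(1) V(1,3) endo_closed[OF endo2 U(1) uc] cr])
    also have "lincomb F U V k c (\<lambda>i. \<psi> U (u i)) = \<zero>\<^bsub>sect F V\<^esub>"
      unfolding lincomb_def by (rule van) (use us in auto)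
    \<comment> \<open>The surviving block starts at \<open>k\<close>; it is reindexed to start at
      \<open>0\<close>, the form in which independence of \<open>t\<close> is stated.\<close>
    also have "finsum (sect F V) (\<lambda>i. c i \<odot>\<^bsub>sect F V\<^esub> res F U V (\<psi> U (u i))) {k..<k + l} =
       finsum (sect F V) (\<lambda>i. c i \<odot>\<^bsub>sect F V\<^esub> res F U V (\<psi> U (u i))) ((\<lambda>i. i + k) ` {..<l})"
      by (simp add: lessThan_atLeast0 add.commute)
    also have "\<dots> = finsum (sect F V) (\<lambda>i. c (i + k) \<odot>\<^bsub>sect F V\<^esub> res F U V (\<psi> U (u (i + k)))) {..<l}"
    proof (rule V.finsum_reindex)
      show "(\<lambda>i. c i \<odot>\<^bsub>sect F V\<^esub> res F U V (\<psi> U (u i))) \<in> (\<lambda>i. i + k) ` {..<l} \<rightarrow> carrier (sect F V)"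
        using cr by (auto intro!: lincomb_term_closed[OF U(1) V(1,3)] endo_closed[OF endo2 U(1)] ut(1))
    qed simp
    also have "\<dots> = lincomb F U V l (\<lambda>i. c (i + k)) (\<lambda>i. \<psi> U (u (i + k)))"
      by (simp add: lincomb_def)
    also have "\<dots> = lincomb F U2 V l (\<lambda>i. c (i + k)) t"
      by (rule lincomb_res_sections[OF U2(1) U(1,3) V(1,3)]) (use ut t cr in auto)
    finally have "lincomb F U2 V l (\<lambda>i. c (i + k)) t = \<zero>\<^bsub>sect F V\<^esub>"
      using lincomb_closed[OF U2(1) V(1) V12(2), of l t "\<lambda>i. c (i + k)"] t cr by simp
    moreover have "\<forall>i<l. c (i + k) \<in> regular Z V" using cr by auto
    ultimately have cl: "\<forall>i<l. \<forall>x\<in>V. c (i + k) x = 0"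
      using indt[unfolded generically_independent_def, rule_format, of V "\<lambda>i. c (i + k)"] V V12 by simp
    have "c i x = 0" if "i < k + l" "x \<in> V" for i x
    proof (cases "i < k")
      case False
      then show ?thesis using cl[rule_format, of "i - k" x] that by simp
    qed (use ck that in auto)
    then show "\<forall>x\<in>V. c n x = 0" using n by blast
  qed
  then show ?thesis
    unfolding independent_sizes_def using U uc by blast
qed

text \<open>A maximal independent family of \<open>E1\<close> followed by the single section
  \<open>t\<close> of \<open>E2\<close> is independent in \<open>F\<close>, so the rank of
  \<open>F\<close> is at least one more.\<close>

lemma sheaf_rank_less:
  assumes ft: "finite_type Z F"
    and inj: "\<And>U. zopen Z U \<Longrightarrow> inj_on (bidual_map Z F U) (carrier (sect F U))"
    and U: "zopen Z U" "U \<noteq> {}" and t: "t \<in> carrier (sect E2 U)" "t \<noteq> \<zero>\<^bsub>sect F U\<^esub>"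
  shows "sheaf_rank Z E1 < sheaf_rank Z F"
proof -
  interpret E1: sheaf_of_modules Z S E1
    by (rule idempotent_endo.sheaf_of_modules_fixed[OF idempotent1])
  have ne: "points Z \<noteq> {}" using U zopen_subset by blast
  have "finite_type Z E1"
    by (rule idempotent_endo.finite_type_fixed[OF idempotent1 ft])
  from E1.sheaf_rank_bounds(2)[OF this ne] obtain U1 s where
    U1: "zopen Z U1" "U1 \<noteq> {}" and s: "\<forall>i<sheaf_rank Z E1. s i \<in> carrier (sect E1 U1)"
    and ind: "generically_independent Z E1 U1 (sheaf_rank Z E1) s"
    unfolding E1.independent_sizes_def by blast
  have "generically_independent Z F U1 (sheaf_rank Z E1) s"
    using ind s by (subst (asm) idempotent_endo.generically_independent_fixed[OF idempotent1 U1(1)]) auto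
  moreover have "generically_independent Z F U 1 (\<lambda>_. t)"
    using t by (intro generically_independent_single inj U) auto
  ultimately have "sheaf_rank Z E1 + 1 \<in> independent_sizes"
    using s t by (intro independent_append[OF U1 U]) auto
  then show ?thesis
    using sheaf_rank_bounds(1)[OF ft ne] by fastforce
qed

end

section \<open>Equivariant endomorphisms\<close>

definition algebraic_lin ::
  "'h monoid \<Rightarrow> ('h \<times> 'p) variety \<Rightarrow> 'p variety \<Rightarrow> ('h \<Rightarrow> 'p \<Rightarrow> 'p) \<Rightarrow> ('p, 'm, 'h) linsheaf \<Rightarrow>
     'p set \<Rightarrow> 'm \<Rightarrow> 'h \<Rightarrow> 'p \<Rightarrow> bool" where
  "algebraic_lin H HZ Z a F U s h0 x0 \<longleftrightarrow>
     (\<exists>\<Omega> V k f t. zopen HZ \<Omega> \<and> (h0, x0) \<in> \<Omega> \<and> zopen Z V \<and>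
        (\<forall>h x. (h, x) \<in> \<Omega> \<longrightarrow> x \<in> V \<and> a h x \<in> U) \<and>
        (\<forall>j<k. f j \<in> regular HZ \<Omega> \<and> t j \<in> carrier (sect F V)) \<and>
        (\<forall>h\<in>carrier H. res F (preim Z a h U) {x. (h, x) \<in> \<Omega>} (lin F h U s) =
           lincomb F V {x. (h, x) \<in> \<Omega>} k (\<lambda>j. \<lambda>x\<in>{x. (h, x) \<in> \<Omega>}. f j (h, x)) t))"

lemma lin_fixed_sheaf [simp]: "lin (fixed_sheaf \<phi> F) = lin F"
  by (simp add: fixed_sheaf_def)

text \<open>Besides the linearisation, the locale records the geometry that its clauses presuppose:
  acting by a fixed \<open>h\<close> is continuous, and the inclusion of the slice at
  \<open>h\<close> into the product is a morphism.\<close>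

locale equivariant_sheaf = sheaf_of_modules Z S F
  for Z :: "'p variety" and S and F :: "('p, 'm, 'h) linsheaf" +
  fixes H :: "'h monoid" and HZ and a
  assumes linearised: "linearised H HZ Z a F"
    and zopen_preim: "h \<in> carrier H \<Longrightarrow> zopen Z U \<Longrightarrow> zopen Z (preim Z a h U)"
    and zopen_slice: "h \<in> carrier H \<Longrightarrow> zopen HZ \<Omega> \<Longrightarrow> zopen Z {x. (h, x) \<in> \<Omega>}"
    and regular_slice: "h \<in> carrier H \<Longrightarrow> zopen HZ \<Omega> \<Longrightarrow> f \<in> regular HZ \<Omega> \<Longrightarrow>
      (\<lambda>x\<in>{x. (h, x) \<in> \<Omega>}. f (h, x)) \<in> regular Z {x. (h, x) \<in> \<Omega>}"
begin

lemmas linearisedD = linearised[unfolded linearised_def, folded algebraic_lin_def]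

lemma
  assumes "h \<in> carrier H" "zopen Z U" "s \<in> carrier (sect F U)"
  shows lin_closed: "lin F h U s \<in> carrier (sect F (preim Z a h U))"
    and lin_add: "t \<in> carrier (sect F U) \<Longrightarrow>
      lin F h U (s \<oplus>\<^bsub>sect F U\<^esub> t) = lin F h U s \<oplus>\<^bsub>sect F (preim Z a h U)\<^esub> lin F h U t"
    and lin_smult: "f \<in> regular Z U \<Longrightarrow> lin F h U (f \<odot>\<^bsub>sect F U\<^esub> s) =
      (\<lambda>x\<in>preim Z a h U. f (a h x)) \<odot>\<^bsub>sect F (preim Z a h U)\<^esub> lin F h U s"
    and lin_res: "zopen Z V \<Longrightarrow> V \<subseteq> U \<Longrightarrow>
      lin F h V (res F U V s) = res F (preim Z a h U) (preim Z a h V) (lin F h U s)"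
  using linearisedD[THEN conjunct1, rule_format, OF assms(1,2)] assms(3) by blast+

lemma lin_one: "zopen Z U \<Longrightarrow> s \<in> carrier (sect F U) \<Longrightarrow> lin F \<one>\<^bsub>H\<^esub> U s = s"
  using linearisedD[THEN conjunct2, THEN conjunct1] by blast

lemma lin_mult: "zopen Z U \<Longrightarrow> s \<in> carrier (sect F U) \<Longrightarrow> h \<in> carrier H \<Longrightarrow> h' \<in> carrier H \<Longrightarrow>
    lin F (h \<otimes>\<^bsub>H\<^esub> h') U s = lin F h' (preim Z a h U) (lin F h U s)"
  using linearisedD[THEN conjunct2, THEN conjunct1] by blast

lemma lin_algebraic: "zopen Z U \<Longrightarrow> s \<in> carrier (sect F U) \<Longrightarrow> h0 \<in> carrier H \<Longrightarrow> x0 \<in> points Z \<Longrightarrow>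
    a h0 x0 \<in> U \<Longrightarrow> algebraic_lin H HZ Z a F U s h0 x0"
  using linearisedD[THEN conjunct2, THEN conjunct2] by blast

lemma lin_cscale:
  assumes "h \<in> carrier H" "zopen Z U" "s \<in> carrier (sect F U)"
  shows "lin F h U (cscale F U c s) = cscale F (preim Z a h U) c (lin F h U s)"
proof -
  have "(\<lambda>x\<in>preim Z a h U. (\<lambda>x\<in>U. c) (a h x)) = (\<lambda>x\<in>preim Z a h U. c)"
    by (intro restrict_ext) (simp add: preim_def)
  then show ?thesis
    unfolding cscale_def using lin_smult[OF assms regular_const[OF assms(2)], of c] by simp
qed

definition equivariant_endo :: "('p set \<Rightarrow> 'm \<Rightarrow> 'm) \<Rightarrow> bool" where
  "equivariant_endo \<phi> \<longleftrightarrow> sheaf_endo Z F \<phi> \<and>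
     (\<forall>h\<in>carrier H. \<forall>U. zopen Z U \<longrightarrow> (\<forall>s\<in>carrier (sect F U).
        \<phi> (preim Z a h U) (lin F h U s) = lin F h U (\<phi> U s)))"

lemma equivariant_endoD:
  "equivariant_endo \<phi> \<Longrightarrow> sheaf_endo Z F \<phi>"
  "equivariant_endo \<phi> \<Longrightarrow> h \<in> carrier H \<Longrightarrow> zopen Z U \<Longrightarrow> s \<in> carrier (sect F U) \<Longrightarrow>
    \<phi> (preim Z a h U) (lin F h U s) = lin F h U (\<phi> U s)"
  by (simp_all add: equivariant_endo_def)

lemma equivariant_endo_id: "equivariant_endo (\<lambda>U s. s)"
  unfolding equivariant_endo_def sheaf_endo_def by blast

lemma equivariant_endo_comp:
  assumes p: "equivariant_endo \<phi>" and q: "equivariant_endo \<psi>"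
  shows "equivariant_endo (\<lambda>U s. \<phi> U (\<psi> U s))"
proof -
  note e = p[THEN equivariant_endoD(1)] q[THEN equivariant_endoD(1)]
  show ?thesis
    unfolding equivariant_endo_def sheaf_endo_def
    using endoD[OF e(1)] endoD[OF e(2)] equivariant_endoD(2)[OF p] equivariant_endoD(2)[OF q]
    by simp
qed

lemma equivariant_endo_cscale: "equivariant_endo (\<lambda>U. cscale F U c)"
  unfolding equivariant_endo_def sheaf_endo_def
  using cscale_closed cscale_distrib cscale_smult cscale_res lin_cscale by simp

lemma equivariant_endo_add:
  assumes p: "equivariant_endo \<phi>" and q: "equivariant_endo \<psi>"
  shows "equivariant_endo (\<lambda>U s. \<phi> U s \<oplus>\<^bsub>sect F U\<^esub> \<psi> U s)"
proof -
  note e = p[THEN equivariant_endoD(1)] q[THEN equivariant_endoD(1)]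
  have add: "\<phi> U (s \<oplus>\<^bsub>sect F U\<^esub> t) \<oplus>\<^bsub>sect F U\<^esub> \<psi> U (s \<oplus>\<^bsub>sect F U\<^esub> t) =
     (\<phi> U s \<oplus>\<^bsub>sect F U\<^esub> \<psi> U s) \<oplus>\<^bsub>sect F U\<^esub> (\<phi> U t \<oplus>\<^bsub>sect F U\<^esub> \<psi> U t)"
    if U: "zopen Z U" and s: "s \<in> carrier (sect F U)" and t: "t \<in> carrier (sect F U)" for U s t
  proof -
    interpret abelian_group "sect F U" by (rule abelian_group_sect[OF U])
    show ?thesis
      using endo_add[OF e(1) U s t] endo_add[OF e(2) U s t]
        endo_closed[OF e(1) U] endo_closed[OF e(2) U] s t by (simp add: a_ac)
  qed
  have smult: "\<phi> U (f \<odot>\<^bsub>sect F U\<^esub> s) \<oplus>\<^bsub>sect F U\<^esub> \<psi> U (f \<odot>\<^bsub>sect F U\<^esub> s) =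
      f \<odot>\<^bsub>sect F U\<^esub> (\<phi> U s \<oplus>\<^bsub>sect F U\<^esub> \<psi> U s)"
    if U: "zopen Z U" and s: "s \<in> carrier (sect F U)" and f: "f \<in> regular Z U" for U s f
    using endo_smult[OF e(1) U s f] endo_smult[OF e(2) U s f] endo_closed[OF e(1) U s]
      endo_closed[OF e(2) U s] module.smult_r_distr[OF module_sect[OF U], of f] f by simp
  have res: "\<phi> V (res F U V s) \<oplus>\<^bsub>sect F V\<^esub> \<psi> V (res F U V s) = res F U V (\<phi> U s \<oplus>\<^bsub>sect F U\<^esub> \<psi> U s)"
    if U: "zopen Z U" and s: "s \<in> carrier (sect F U)" and V: "zopen Z V" "V \<subseteq> U" for U V s
    using endo_res[OF e(1) U s V] endo_res[OF e(2) U s V]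
      res_add[OF U V endo_closed[OF e(1) U s] endo_closed[OF e(2) U s]] by simp
  have lin: "\<phi> (preim Z a h U) (lin F h U s) \<oplus>\<^bsub>sect F (preim Z a h U)\<^esub> \<psi> (preim Z a h U) (lin F h U s) =
     lin F h U (\<phi> U s \<oplus>\<^bsub>sect F U\<^esub> \<psi> U s)"
    if h: "h \<in> carrier H" and U: "zopen Z U" and s: "s \<in> carrier (sect F U)" for h U s
    using equivariant_endoD(2)[OF p h U s] equivariant_endoD(2)[OF q h U s]
      lin_add[OF h U endo_closed[OF e(1) U s] endo_closed[OF e(2) U s]] by simp
  show ?thesis
    unfolding equivariant_endo_def sheaf_endo_def
    using add smult res lin add_closed endo_closed[OF e(1)] endo_closed[OF e(2)] by simp
qed

text \<open>As \<open>g\<close> fixes all points, preimages under \<open>g\<close> are unchanged and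
  twisting a function by \<open>g\<close> does nothing, so the semilinear map \<open>lin F g\<close>
  is \<O>-linear. The cocycle rule for \<open>g\<close> times \<open>h\<close> and \<open>h\<close>
  times \<open>g\<close> gives compatibility with \<open>lin F h\<close>.\<close>

lemma equivariant_endo_lin:
  assumes g: "g \<in> carrier H" and triv: "\<And>x. x \<in> points Z \<Longrightarrow> a g x = x"
    and comm: "\<And>h. h \<in> carrier H \<Longrightarrow> g \<otimes>\<^bsub>H\<^esub> h = h \<otimes>\<^bsub>H\<^esub> g"
  shows "equivariant_endo (lin F g)"
proof -
  have pre: "preim Z a g U = U" if "zopen Z U" for U
    using zopen_subset[OF that] triv by (auto simp: preim_def)
  have smult: "lin F g U (f \<odot>\<^bsub>sect F U\<^esub> s) = f \<odot>\<^bsub>sect F U\<^esub> lin F g U s"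
    if U: "zopen Z U" and s: "s \<in> carrier (sect F U)" and f: "f \<in> regular Z U" for U s f
  proof -
    have "(\<lambda>x\<in>U. f (a g x)) = f"
      using regular_extensional[OF f] zopen_subset[OF U] triv
      by (intro extensionalityI[of _ U]) auto
    then show ?thesis using lin_smult[OF g U s f] pre[OF U] by simp
  qed
  have lin: "lin F g (preim Z a h U) (lin F h U s) = lin F h U (lin F g U s)"
    if h: "h \<in> carrier H" and U: "zopen Z U" and s: "s \<in> carrier (sect F U)" for h U s
    using lin_mult[OF U s h g] lin_mult[OF U s g h] comm[OF h] pre[OF U] by simp
  show ?thesis
    unfolding equivariant_endo_def sheaf_endo_def
    using smult lin lin_closed[OF g] lin_add[OF g] lin_res[OF g] pre by simp
qed

text \<open>The delicate clause is algebraicity. Applying \<phi> to a local expansion of the pulled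
  back section keeps the coefficient functions on the product and replaces each \<open>t j\<close>
  by its image, which is a section of the subsheaf.\<close>

lemma linearised_fixed:
  assumes eq: "equivariant_endo \<phi>"
    and idem: "\<And>U s. zopen Z U \<Longrightarrow> s \<in> carrier (sect F U) \<Longrightarrow> \<phi> U (\<phi> U s) = \<phi> U s"
  shows "linearised H HZ Z a (fixed_sheaf \<phi> F)"
proof -
  note endo = equivariant_endoD(1)[OF eq]
  interpret E: idempotent_endo Z S F \<phi>
    by unfold_locales (auto simp: endo idem)
  have "algebraic_lin H HZ Z a E.E U s h0 x0"
    if U: "zopen Z U" and s: "s \<in> carrier (sect E.E U)" and h0: "h0 \<in> carrier H" and x0: "x0 \<in> points Z"
      "a h0 x0 \<in> U" for U s h0 x0
  proof -
    from s have sF: "s \<in> carrier (sect F U)" "\<phi> U s = s" by auto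
    obtain \<Omega> V k f t where \<Omega>: "zopen HZ \<Omega>" "(h0, x0) \<in> \<Omega>" and V: "zopen Z V"
      and sub: "\<forall>h x. (h, x) \<in> \<Omega> \<longrightarrow> x \<in> V \<and> a h x \<in> U"
      and ft: "\<forall>j<k. f j \<in> regular HZ \<Omega> \<and> t j \<in> carrier (sect F V)"
      and eqn: "\<forall>h\<in>carrier H. res F (preim Z a h U) {x. (h, x) \<in> \<Omega>} (lin F h U s) =
           lincomb F V {x. (h, x) \<in> \<Omega>} k (\<lambda>j. \<lambda>x\<in>{x. (h, x) \<in> \<Omega>}. f j (h, x)) t"
      using lin_algebraic[OF U sF(1) h0 x0] unfolding algebraic_lin_def by blast
    have t': "\<phi> V (t j) \<in> carrier (sect E.E V)" if "j < k" for j
      using ft that endo_closed[OF endo V] idem[OF V] by simp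
    have "res F (preim Z a h U) {x. (h, x) \<in> \<Omega>} (lin F h U s) =
       lincomb E.E V {x. (h, x) \<in> \<Omega>} k (\<lambda>j. \<lambda>x\<in>{x. (h, x) \<in> \<Omega>}. f j (h, x)) (\<lambda>j. \<phi> V (t j))"
      if h: "h \<in> carrier H" for h
    proof -
      let ?W = "{x. (h, x) \<in> \<Omega>}"
      let ?P = "preim Z a h U"
      let ?c = "\<lambda>j. \<lambda>x\<in>?W. f j (h, x)"
      have W: "zopen Z ?W" by (rule zopen_slice[OF h \<Omega>(1)])
      have P: "zopen Z ?P" by (rule zopen_preim[OF h U])
      have WV: "?W \<subseteq> V" "?W \<subseteq> ?P"
        using sub zopen_subset[OF W] by (auto simp: preim_def)
      have c: "?c j \<in> regular Z ?W" if "j < k" for j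
        using ft that by (intro regular_slice[OF h \<Omega>(1)]) auto
      have l: "lin F h U s \<in> carrier (sect F ?P)" "\<phi> ?P (lin F h U s) = lin F h U s"
        using lin_closed[OF h U sF(1)] equivariant_endoD(2)[OF eq h U sF(1)] sF(2) by simp_all
      have "res F ?P ?W (lin F h U s) = \<phi> ?W (res F ?P ?W (lin F h U s))"
        using endo_res[OF endo P l(1) W WV(2)] l(2) by simp
      also have "\<dots> = \<phi> ?W (lincomb F V ?W k ?c t)"
        using eqn h by simp
      also have "\<dots> = lincomb F V ?W k ?c (\<lambda>j. \<phi> V (t j))"
        using ft c by (intro endo_lincomb[OF endo V W WV(1)]) auto
      also have "\<dots> = lincomb E.E V ?W k ?c (\<lambda>j. \<phi> V (t j))"
        using t' c by (intro E.lincomb_fixed[OF V W WV(1), symmetric])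
      finally show ?thesis .
    qed
    then have eqn': "\<forall>h\<in>carrier H. res E.E (preim Z a h U) {x. (h, x) \<in> \<Omega>} (lin E.E h U s) =
       lincomb E.E V {x. (h, x) \<in> \<Omega>} k (\<lambda>j. \<lambda>x\<in>{x. (h, x) \<in> \<Omega>}. f j (h, x)) (\<lambda>j. \<phi> V (t j))"
      by simp
    have ft': "\<forall>j<k. f j \<in> regular HZ \<Omega> \<and> \<phi> V (t j) \<in> carrier (sect E.E V)"
      using ft t' by blast
    show ?thesis
      unfolding algebraic_lin_def
      by (intro exI[of _ \<Omega>] exI[of _ V] exI[of _ k] exI[of _ f] exI[of _ "\<lambda>j. \<phi> V (t j)"] conjI
          \<Omega> V sub ft' eqn')
  qed
  moreover have "lin F h U s \<in> carrier (sect E.E (preim Z a h U))"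
    if "h \<in> carrier H" "zopen Z U" "s \<in> carrier (sect E.E U)" for h U s
    using that equivariant_endoD(2)[OF eq that(1,2)] lin_closed[OF that(1,2)] by auto
  ultimately show ?thesis
    unfolding linearised_def algebraic_lin_def[symmetric]
    using lin_add lin_smult lin_res lin_one lin_mult by simp
qed

end

section \<open>The projection to an eigenspace of an endomorphism of finite order\<close>

text \<open>\<open>N\<close> is some exponent of \<open>L\<close>, not its exact order, and \<mu> is
  any root of unity of that exponent. Whether \<mu> occurs as an eigenvalue is settled later by
  exhibiting a section.\<close>

locale finite_order_endo = equivariant_sheaf +
  fixes L and N :: nat and \<mu> :: complex
  assumes equivariant_L: "equivariant_endo L"
    and order_L: "zopen Z U \<Longrightarrow> s \<in> carrier (sect F U) \<Longrightarrow> (L U ^^ N) s = s"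
    and N_pos: "0 < N" and root: "\<mu> ^ N = 1"
begin

text \<open>Horner's scheme for \<open>\<Sum>\<^sub>i\<^sub><\<^sub>n \<mu>\<^sup>-\<^sup>i L\<^sup>i\<close>.\<close>

primrec psum :: "nat \<Rightarrow> 'a set \<Rightarrow> 'b \<Rightarrow> 'b" where
  "psum 0 = (\<lambda>U. cscale F U 0)"
| "psum (Suc n) = (\<lambda>U s. s \<oplus>\<^bsub>sect F U\<^esub> cscale F U (inverse \<mu>) (L U (psum n U s)))"

text \<open>The averaged character sum of the cyclic group of order \<open>N\<close>, acting through
  powers of \<open>L\<close>: the projection onto the eigenspace for \<mu>.\<close>

definition proj :: "'a set \<Rightarrow> 'b \<Rightarrow> 'b" where
  "proj U s = cscale F U (1 / of_nat N) (psum N U s)"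

definition coproj :: "'a set \<Rightarrow> 'b \<Rightarrow> 'b" where
  "coproj U s = s \<oplus>\<^bsub>sect F U\<^esub> cscale F U (-1) (proj U s)"

lemma root_nonzero: "\<mu> \<noteq> 0"
  using root N_pos by (auto simp: power_0_left)

text \<open>Horner's form uses only sums, composites and scalings, under which equivariant
  endomorphisms are closed; the empty sum is written as scaling by \<open>0\<close> to fit this
  pattern.\<close>

lemma equivariant_psum: "equivariant_endo (psum n)"
proof (induction n)
  case 0
  then show ?case using equivariant_endo_cscale[of 0] by simp
next
  case (Suc n)
  then show ?case
    using equivariant_endo_add[OF equivariant_endo_id equivariant_endo_comp[OF
        equivariant_endo_cscale[of "inverse \<mu>"] equivariant_endo_comp[OF equivariant_L Suc]]]
    by simp
qed

lemma equivariant_proj: "equivariant_endo proj"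
  using equivariant_endo_comp[OF equivariant_endo_cscale[of "1 / of_nat N"] equivariant_psum[of N]]
  by (simp add: proj_def[abs_def])

lemma equivariant_coproj: "equivariant_endo coproj"
  using equivariant_endo_add[OF equivariant_endo_id equivariant_endo_comp[OF
      equivariant_endo_cscale[of "-1"] equivariant_proj]]
  by (simp add: coproj_def[abs_def])

lemmas endo_L = equivariant_endoD(1)[OF equivariant_L]
  and endo_psum = equivariant_endoD(1)[OF equivariant_psum]
  and endo_proj = equivariant_endoD(1)[OF equivariant_proj]
  and endo_coproj = equivariant_endoD(1)[OF equivariant_coproj]

context
  fixes U s assumes U: "zopen Z U" and s: "s \<in> carrier (sect F U)"
begin

interpretation abelian_group "sect F U"
  by (rule abelian_group_sect[OF U])

lemma pow_L_closed: "(L U ^^ n) s \<in> carrier (sect F U)"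
  by (induction n) (auto simp: s endo_closed[OF endo_L U])

text \<open>The same sum grown at its highest term, whereas the defining recursion grows it at its
  lowest. Comparing the two recursions shows that the full sum is an eigenvector.\<close>

lemma psum_Suc':
  "psum (Suc n) U s = psum n U s \<oplus>\<^bsub>sect F U\<^esub> cscale F U (inverse \<mu> ^ n) ((L U ^^ n) s)"
proof (induction n)
  case 0
  have "L U \<zero>\<^bsub>sect F U\<^esub> = \<zero>\<^bsub>sect F U\<^esub>" by (rule endo_zero[OF endo_L U])
  then show ?case
    using s by (simp add: cscale_0[OF U s] cscale_1[OF U s] cscale_zero[OF U])
next
  case (Suc n)
  let ?T = "psum n U s" and ?M = "(L U ^^ n) s"
  have c: "?T \<in> carrier (sect F U)" "?M \<in> carrier (sect F U)" "L U ?T \<in> carrier (sect F U)" "L U ?M \<in> carrier (sect F U)"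
    using endo_closed[OF endo_psum U s] pow_L_closed endo_closed[OF endo_L U] by auto
  note cc = cscale_closed[OF U c(2)] cscale_closed[OF U c(3)] cscale_closed[OF U c(4)]
  have "psum (Suc (Suc n)) U s = s \<oplus>\<^bsub>sect F U\<^esub> cscale F U (inverse \<mu>) (L U (psum (Suc n) U s))"
    by simp
  also have "L U (psum (Suc n) U s) = L U ?T \<oplus>\<^bsub>sect F U\<^esub> cscale F U (inverse \<mu> ^ n) (L U ?M)"
    unfolding Suc using endo_add[OF endo_L U c(1) cc(1)] endo_cscale[OF endo_L U c(2)] by simp
  also have "cscale F U (inverse \<mu>) \<dots> = cscale F U (inverse \<mu>) (L U ?T) \<oplus>\<^bsub>sect F U\<^esub>
      cscale F U (inverse \<mu> ^ Suc n) (L U ?M)"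
    using cscale_distrib[OF U c(3) cc(3)] cscale_cscale[OF U c(4)] by simp
  also have "s \<oplus>\<^bsub>sect F U\<^esub> \<dots> = psum (Suc n) U s \<oplus>\<^bsub>sect F U\<^esub> cscale F U (inverse \<mu> ^ Suc n) ((L U ^^ Suc n) s)"
    using s cc by (simp add: a_assoc)
  finally show ?case .
qed

lemma L_proj: "L U (proj U s) = cscale F U \<mu> (proj U s)"
proof -
  let ?T = "psum N U s"
  have c: "?T \<in> carrier (sect F U)" "L U ?T \<in> carrier (sect F U)"
    using endo_closed[OF endo_psum U s] endo_closed[OF endo_L U] by auto
  \<comment> \<open>Both sides are \<open>psum (Suc N) U s\<close>. The highest term has wrapped
    around to \<open>s\<close>, since the \<open>N\<close>-th powers of \<open>L\<close> and of
    \<mu> are trivial; \<open>s\<close> then cancels.\<close>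
  have "s \<oplus>\<^bsub>sect F U\<^esub> cscale F U (inverse \<mu>) (L U ?T) = ?T \<oplus>\<^bsub>sect F U\<^esub> s"
    using psum_Suc'[of N] order_L[OF U s] root cscale_1[OF U s] by (simp add: power_inverse)
  then have "cscale F U (inverse \<mu>) (L U ?T) = ?T"
    using s c cscale_closed[OF U c(2)] by (simp add: a_comm)
  then have "L U ?T = cscale F U \<mu> ?T"
    using cscale_cscale[OF U c(2), of \<mu> "inverse \<mu>"] cscale_1[OF U c(2)] root_nonzero by simp
  then show ?thesis
    unfolding proj_def using endo_cscale[OF endo_L U c(1)] cscale_cscale[OF U c(1)]
    by (simp add: mult.commute)
qed

lemma proj_eigenvector:
  assumes "L U s = cscale F U \<mu> s"
  shows "proj U s = s"
proof -
  have "psum n U s = cscale F U (of_nat n) s" for n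
  proof (induction n)
    case (Suc n)
    have "L U (psum n U s) = cscale F U (of_nat n * \<mu>) s"
      using Suc endo_cscale[OF endo_L U s] assms cscale_cscale[OF U s] by simp
    then have "psum (Suc n) U s = s \<oplus>\<^bsub>sect F U\<^esub> cscale F U (of_nat n) s"
      using cscale_cscale[OF U s] root_nonzero by (simp add: field_simps)
    then show ?case
      using cscale_add[OF U s, of 1 "of_nat n"] cscale_1[OF U s] by simp
  qed simp
  then show ?thesis
    unfolding proj_def using cscale_cscale[OF U s] cscale_1[OF U s] N_pos by simp
qed

lemma proj_add_coproj: "proj U s \<oplus>\<^bsub>sect F U\<^esub> coproj U s = s"
proof -
  have p: "proj U s \<in> carrier (sect F U)" "cscale F U (-1) (proj U s) \<in> carrier (sect F U)"
    using endo_closed[OF endo_proj U s] cscale_closed[OF U] by auto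
  show ?thesis
    unfolding coproj_def using neg_cscale[OF U p(1)] p s by (simp add: a_lcomm)
qed

end

lemma proj_proj:
  assumes U: "zopen Z U" and s: "s \<in> carrier (sect F U)"
  shows "proj U (proj U s) = proj U s"
  by (rule proj_eigenvector[OF U endo_closed[OF endo_proj U s] L_proj[OF U s]])

lemma complementary_proj: "complementary_endos Z S F proj coproj"
proof unfold_locales
  fix U s assume U: "zopen Z U" and s: "s \<in> carrier (sect F U)"
  note p = endo_closed[OF endo_proj U s]
  show "proj U s \<oplus>\<^bsub>sect F U\<^esub> coproj U s = s" by (rule proj_add_coproj[OF U s])
  show "proj U (coproj U s) = \<zero>\<^bsub>sect F U\<^esub>"
    unfolding coproj_def using endo_add[OF endo_proj U s cscale_closed[OF U p]]
      endo_cscale[OF endo_proj U p] proj_proj[OF U s] neg_cscale[OF U p] by simp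
  show "coproj U (proj U s) = \<zero>\<^bsub>sect F U\<^esub>"
    unfolding coproj_def using proj_proj[OF U s] neg_cscale[OF U p] by simp
qed (rule endo_proj endo_coproj)+

end

section \<open>Multiples of an ideal\<close>

text \<open>The submodule \<open>I M\<close> for \<open>M\<close> the sections over \<open>U\<close>
  and \<open>I\<close> generated by the functions \<open>g i\<close>. With \<open>g i\<close> the
  functions \<open>z i - 1\<close> it is \<open>slice_submodule\<close>.\<close>

definition ideal_sections ::
  "('p, 'm, 'z) osheaf_scheme \<Rightarrow> 'p set \<Rightarrow> (nat \<Rightarrow> 'p \<Rightarrow> complex) \<Rightarrow> nat set \<Rightarrow> 'm set" where
  "ideal_sections F U g A =
     {finsum (sect F U) (\<lambda>i. g i \<odot>\<^bsub>sect F U\<^esub> s i) A | s. \<forall>i. s i \<in> carrier (sect F U)}"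

context sheaf_of_modules
begin

context
  fixes U and g :: "nat \<Rightarrow> 'p \<Rightarrow> complex" and A assumes U: "zopen Z U" and A: "finite A" and regular_g: "\<forall>i\<in>A. g i \<in> regular Z U"
begin

interpretation abelian_group "sect F U"
  by (rule abelian_group_sect[OF U])

private lemmas g = bspec[OF regular_g]

lemma ideal_sectionsI:
  "(\<And>i. s i \<in> carrier (sect F U)) \<Longrightarrow>
     finsum (sect F U) (\<lambda>i. g i \<odot>\<^bsub>sect F U\<^esub> s i) A \<in> ideal_sections F U g A"
  unfolding ideal_sections_def by (intro CollectI exI[of _ s] conjI refl allI)

lemma ideal_sections_closed: "x \<in> ideal_sections F U g A \<Longrightarrow> x \<in> carrier (sect F U)"
  unfolding ideal_sections_def using smult_closed[OF U g] by (auto intro!: finsum_closed)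

text \<open>A linear map passes through the coefficients \<open>g i\<close>. Hence \<open>L\<close>
  induces a map on the quotient \<open>M / I M\<close>, where the weights are defined.\<close>

lemma ideal_sections_endo:
  assumes "sheaf_endo Z F \<phi>" "x \<in> ideal_sections F U g A"
  shows "\<phi> U x \<in> ideal_sections F U g A"
proof -
  from assms(2) obtain s where s: "\<And>i. s i \<in> carrier (sect F U)"
    and x: "x = finsum (sect F U) (\<lambda>i. g i \<odot>\<^bsub>sect F U\<^esub> s i) A"
    unfolding ideal_sections_def by blast
  note t = smult_closed[OF U g s] smult_closed[OF U g endo_closed[OF assms(1) U s]]
  have "\<phi> U x = finsum (sect F U) (\<lambda>i. \<phi> U (g i \<odot>\<^bsub>sect F U\<^esub> s i)) A"
    unfolding x using t by (intro endo_finsum[OF assms(1) U A]) auto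
  also have "\<dots> = finsum (sect F U) (\<lambda>i. g i \<odot>\<^bsub>sect F U\<^esub> \<phi> U (s i)) A"
    using t endo_smult[OF assms(1) U s g] by (intro finsum_cong') auto
  finally show ?thesis
    using ideal_sectionsI[OF endo_closed[OF assms(1) U s]] by simp
qed

lemma ideal_sections_add:
  assumes "x \<in> ideal_sections F U g A" "y \<in> ideal_sections F U g A"
  shows "x \<oplus>\<^bsub>sect F U\<^esub> y \<in> ideal_sections F U g A"
proof -
  from assms obtain s t where s: "\<And>i. s i \<in> carrier (sect F U)" and t: "\<And>i. t i \<in> carrier (sect F U)"
    and xy: "x = finsum (sect F U) (\<lambda>i. g i \<odot>\<^bsub>sect F U\<^esub> s i) A"
      "y = finsum (sect F U) (\<lambda>i. g i \<odot>\<^bsub>sect F U\<^esub> t i) A"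
    unfolding ideal_sections_def by blast
  note c = smult_closed[OF U g s] smult_closed[OF U g t]
  have "x \<oplus>\<^bsub>sect F U\<^esub> y = finsum (sect F U) (\<lambda>i. (g i \<odot>\<^bsub>sect F U\<^esub> s i) \<oplus>\<^bsub>sect F U\<^esub> (g i \<odot>\<^bsub>sect F U\<^esub> t i)) A"
    unfolding xy using c by (intro finsum_addf[symmetric]) auto
  also have "\<dots> = finsum (sect F U) (\<lambda>i. g i \<odot>\<^bsub>sect F U\<^esub> (s i \<oplus>\<^bsub>sect F U\<^esub> t i)) A"
    using c module.smult_r_distr[OF module_sect[OF U], of "g _" "s _" "t _"] g s t add_closed[OF U s t]
    by (intro finsum_cong') (auto intro!: smult_closed[OF U])
  finally show ?thesis
    using ideal_sectionsI[OF add_closed[OF U s t]] by simp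
qed

lemma ideal_sections_cscale:
  assumes "x \<in> ideal_sections F U g A"
  shows "cscale F U c x \<in> ideal_sections F U g A"
proof -
  have "sheaf_endo Z F (\<lambda>U. cscale F U c)"
    unfolding sheaf_endo_def using cscale_closed cscale_distrib cscale_smult cscale_res by simp
  from ideal_sections_endo[OF this assms] show ?thesis .
qed

lemma ideal_sections_zero: "\<zero>\<^bsub>sect F U\<^esub> \<in> ideal_sections F U g A"
proof -
  have "finsum (sect F U) (\<lambda>i. g i \<odot>\<^bsub>sect F U\<^esub> \<zero>\<^bsub>sect F U\<^esub>) A \<in> ideal_sections F U g A"
    by (rule ideal_sectionsI[OF zero_closed])
  from ideal_sections_cscale[OF this, of 0] cscale_0[OF U ideal_sections_closed[OF this]]
  show ?thesis by simp
qed

lemma ideal_sections_coset: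
  assumes s: "s \<in> ideal_sections F U g A"
  shows "ideal_sections F U g A +>\<^bsub>sect F U\<^esub> s = ideal_sections F U g A"
proof
  show "ideal_sections F U g A +>\<^bsub>sect F U\<^esub> s \<subseteq> ideal_sections F U g A"
    unfolding a_r_coset_def' using ideal_sections_add[OF _ s] by auto
  show "ideal_sections F U g A \<subseteq> ideal_sections F U g A +>\<^bsub>sect F U\<^esub> s"
  proof
    fix x assume x: "x \<in> ideal_sections F U g A"
    let ?y = "x \<oplus>\<^bsub>sect F U\<^esub> cscale F U (-1) s"
    have "?y \<oplus>\<^bsub>sect F U\<^esub> s = x \<oplus>\<^bsub>sect F U\<^esub> (s \<oplus>\<^bsub>sect F U\<^esub> cscale F U (-1) s)"
      using ideal_sections_closed[OF s] ideal_sections_closed[OF x]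
        cscale_closed[OF U ideal_sections_closed[OF s], of "-1"] by (simp add: a_ac)
    then have "?y \<oplus>\<^bsub>sect F U\<^esub> s = x"
      using neg_cscale[OF U ideal_sections_closed[OF s]] ideal_sections_closed[OF x] by simp
    moreover have "?y \<in> ideal_sections F U g A"
      by (intro ideal_sections_add x ideal_sections_cscale s)
    ultimately show "x \<in> ideal_sections F U g A +>\<^bsub>sect F U\<^esub> s"
      unfolding a_r_coset_def' by force
  qed
qed

end

end

section \<open>Weight vectors modulo an ideal, and their components in the splitting\<close>

context finite_order_endo
begin

context
  fixes U g A s and \<nu> :: complex
  assumes U: "zopen Z U" and A: "finite A" and g: "\<forall>i\<in>A. g i \<in> regular Z U"
    and s: "s \<in> carrier (sect F U)" and s_notin: "s \<notin> ideal_sections F U g A"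
    and weight: "L U s \<ominus>\<^bsub>sect F U\<^esub> cscale F U \<nu> s \<in> ideal_sections F U g A"
begin

interpretation abelian_group "sect F U"
  by (rule abelian_group_sect[OF U])

lemma weight_decomposition:
  obtains v where "v \<in> ideal_sections F U g A" "L U s = cscale F U \<nu> s \<oplus>\<^bsub>sect F U\<^esub> v"
proof
  let ?v = "L U s \<ominus>\<^bsub>sect F U\<^esub> cscale F U \<nu> s"
  show "?v \<in> ideal_sections F U g A" by (rule weight)
  have "L U s \<in> carrier (sect F U)" "cscale F U \<nu> s \<in> carrier (sect F U)"
    using endo_closed[OF endo_L U s] cscale_closed[OF U s] by auto
  then show "L U s = cscale F U \<nu> s \<oplus>\<^bsub>sect F U\<^esub> ?v"
    by (simp add: a_minus_def a_lcomm r_neg)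
qed

text \<open>Modulo \<open>I M\<close> the section \<open>s\<close> is an eigenvector for \<mu>, so
  the induction gives \<open>psum n U s\<close> congruent to \<open>n\<close> times
  \<open>s\<close>, and \<open>proj U s\<close> is congruent to \<open>s\<close>. If it were zero,
  \<open>s\<close> would lie in \<open>I M\<close>.\<close>

lemma proj_nonzero:
  assumes "\<nu> = \<mu>"
  shows "proj U s \<noteq> \<zero>\<^bsub>sect F U\<^esub>"
proof
  let ?I = "ideal_sections F U g A"
  note I_cl = ideal_sections_closed[OF U A g]
    and I_add = ideal_sections_add[OF U A g] and I_sc = ideal_sections_cscale[OF U A g]
    and I_endo = ideal_sections_endo[OF U A g]
  obtain v where v: "v \<in> ?I" "L U s = cscale F U \<mu> s \<oplus>\<^bsub>sect F U\<^esub> v"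
    using weight_decomposition assms by blast
  have "\<exists>u\<in>?I. psum n U s = cscale F U (of_nat n) s \<oplus>\<^bsub>sect F U\<^esub> u" for n
  proof (induction n)
    case 0
    show ?case
      using ideal_sections_zero[OF U A g] cscale_0[OF U s] by (intro bexI[of _ "\<zero>\<^bsub>sect F U\<^esub>"]) auto
  next
    case (Suc n)
    then obtain u where u: "u \<in> ?I" "psum n U s = cscale F U (of_nat n) s \<oplus>\<^bsub>sect F U\<^esub> u" by blast
    let ?c = "inverse \<mu>"
    let ?w = "cscale F U (?c * of_nat n) v \<oplus>\<^bsub>sect F U\<^esub> cscale F U ?c (L U u)"
    note Lu = I_endo[OF endo_L u(1)]
    have cl: "v \<in> carrier (sect F U)" "u \<in> carrier (sect F U)" "L U u \<in> carrier (sect F U)"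
      using I_cl v(1) u(1) endo_closed[OF endo_L U] by auto
    note sc = cscale_closed[OF U s] cscale_closed[OF U cl(1)] cscale_closed[OF U cl(2)] cscale_closed[OF U cl(3)]
    have "L U (psum n U s) = cscale F U (of_nat n) (cscale F U \<mu> s \<oplus>\<^bsub>sect F U\<^esub> v) \<oplus>\<^bsub>sect F U\<^esub> L U u"
      unfolding u(2) using endo_add[OF endo_L U sc(1) cl(2)] endo_cscale[OF endo_L U s] v(2) by simp
    also have "\<dots> = (cscale F U (of_nat n * \<mu>) s \<oplus>\<^bsub>sect F U\<^esub> cscale F U (of_nat n) v) \<oplus>\<^bsub>sect F U\<^esub> L U u"
      using cscale_distrib[OF U sc(1) cl(1)] cscale_cscale[OF U s] by simp
    finally have "cscale F U ?c (L U (psum n U s)) =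
        cscale F U ?c (cscale F U (of_nat n * \<mu>) s \<oplus>\<^bsub>sect F U\<^esub> cscale F U (of_nat n) v) \<oplus>\<^bsub>sect F U\<^esub>
        cscale F U ?c (L U u)"
      by (simp only: cscale_distrib[OF U a_closed[OF sc(1,2)] cl(3)])
    also have "cscale F U ?c (cscale F U (of_nat n * \<mu>) s \<oplus>\<^bsub>sect F U\<^esub> cscale F U (of_nat n) v) =
        cscale F U (?c * (of_nat n * \<mu>)) s \<oplus>\<^bsub>sect F U\<^esub> cscale F U (?c * of_nat n) v"
      by (simp only: cscale_distrib[OF U sc(1,2)] cscale_cscale[OF U s] cscale_cscale[OF U cl(1)])
    also have "?c * (of_nat n * \<mu>) = of_nat n"
      using root_nonzero by simp
    also note a_assoc[OF sc(1,2,4)]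
    finally have "cscale F U ?c (L U (psum n U s)) = cscale F U (of_nat n) s \<oplus>\<^bsub>sect F U\<^esub> ?w" .
    then have "psum (Suc n) U s = cscale F U (of_nat (Suc n)) s \<oplus>\<^bsub>sect F U\<^esub> ?w"
      using cscale_add[OF U s, of 1 "of_nat n"] cscale_1[OF U s] sc s by (simp add: a_assoc)
    moreover have "?w \<in> ?I"
      by (rule I_add[OF I_sc[OF v(1)] I_sc[OF Lu]])
    ultimately show ?case by blast
  qed
  then obtain u where u: "u \<in> ?I" "psum N U s = cscale F U (of_nat N) s \<oplus>\<^bsub>sect F U\<^esub> u" by blast
  note cl = I_cl[OF u(1)] cscale_closed[OF U s] cscale_closed[OF U I_cl[OF u(1)]]
  let ?u = "cscale F U (1 / of_nat N) u"
  assume "proj U s = \<zero>\<^bsub>sect F U\<^esub>"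
  then have z: "s \<oplus>\<^bsub>sect F U\<^esub> ?u = \<zero>\<^bsub>sect F U\<^esub>"
    unfolding proj_def u(2) using cscale_distrib[OF U cl(2,1)] cscale_cscale[OF U s] cscale_1[OF U s] N_pos
    by simp
  have "s = cscale F U (-1) ?u"
    using z neg_cscale[OF U cl(3)] s cl(3) cscale_closed[OF U cl(3)] by (metis minus_unique a_comm)
  then have "s \<in> ?I"
    using I_sc[OF I_sc[OF u(1)]] by metis
  then show False using s_notin by simp
qed

text \<open>If the complementary part vanished, \<open>s\<close> would be a genuine eigenvector for
  \<mu>, while its eigenvalue modulo \<open>I M\<close> is \<nu>. Then \<mu> - \<nu> times
  \<open>s\<close>, and hence \<open>s\<close>, would lie in \<open>I M\<close>.\<close>

lemma coproj_nonzero: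
  assumes "\<nu> \<noteq> \<mu>"
  shows "coproj U s \<noteq> \<zero>\<^bsub>sect F U\<^esub>"
proof
  note p = endo_closed[OF endo_proj U s]
  assume "coproj U s = \<zero>\<^bsub>sect F U\<^esub>"
  then have ps: "proj U s = s"
    using proj_add_coproj[OF U s] p by simp
  obtain v where v: "v \<in> ideal_sections F U g A" "L U s = cscale F U \<nu> s \<oplus>\<^bsub>sect F U\<^esub> v"
    by (rule weight_decomposition)
  have vc: "v \<in> carrier (sect F U)" by (rule ideal_sections_closed[OF U A g v(1)])
  note sc = cscale_closed[OF U s]
  have "cscale F U \<nu> s \<oplus>\<^bsub>sect F U\<^esub> v = cscale F U (\<nu> + (\<mu> - \<nu>)) s"
    using L_proj[OF U s] ps v(2) by simp
  also have "\<dots> = cscale F U \<nu> s \<oplus>\<^bsub>sect F U\<^esub> cscale F U (\<mu> - \<nu>) s"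
    by (rule cscale_add[OF U s])
  finally have "v = cscale F U (\<mu> - \<nu>) s"
    using vc sc by simp
  then have "cscale F U (inverse (\<mu> - \<nu>)) v = s"
    using cscale_cscale[OF U s] cscale_1[OF U s] assms by simp
  then have "s \<in> ideal_sections F U g A"
    using ideal_sections_cscale[OF U A g v(1)] by metis
  then show False using s_notin by simp
qed

end

end

section \<open>The variety of a stacky fan\<close>

lemma function_algebra_prod:
  assumes "finite J" "\<And>i. i \<in> J \<Longrightarrow> f i \<in> function_algebra S"
  shows "(\<lambda>z. \<Prod>i\<in>J. f i z) \<in> function_algebra S"
  using assms
proof (induction J rule: finite_induct)
  case empty
  show ?case using function_algebra.const[of 1 S] by simp
next
  case (insert i J)
  then show ?case using function_algebra.mult[of "f i" S "\<lambda>z. \<Prod>i\<in>J. f i z"] by simp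
qed

definition coords :: "nat \<Rightarrow> (pt \<Rightarrow> complex) set" where
  "coords n = {(\<lambda>z. z i) | i. i < n}"

lemma funs_Zvar: "funs (Zvar St) = function_algebra (coords (nrays St))"
  by (simp add: Zvar_def coords_def)

lemma points_Zvar: "points (Zvar St) = Zpoints St"
  by (simp add: Zvar_def)

text \<open>Restriction to an affine line reduces irreducibility to the finiteness of the roots of a
  polynomial in one variable.\<close>

lemma function_algebra_line:
  assumes "f \<in> function_algebra (coords n)"
  shows "\<exists>p::complex poly. \<forall>l. f (\<lambda>i\<in>{..<n}. x i + l * (y i - x i)) = poly p l"
  using assms
proof (induction rule: function_algebra.induct)
  case (const c)
  show ?case by (intro exI[of _ "[:c:]"]) simp
next
  case (gen f)
  then obtain i where "i < n" "f = (\<lambda>z. z i)" by (auto simp: coords_def)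
  then show ?case by (intro exI[of _ "[:x i, y i - x i:]"]) simp
next
  case (add f g)
  then obtain p q :: "complex poly" where "\<forall>l. f (\<lambda>i\<in>{..<n}. x i + l * (y i - x i)) = poly p l"
    "\<forall>l. g (\<lambda>i\<in>{..<n}. x i + l * (y i - x i)) = poly q l" by blast
  then show ?case by (intro exI[of _ "p + q"]) (simp only: poly_add simp_thms)
next
  case (mult f g)
  then obtain p q :: "complex poly" where "\<forall>l. f (\<lambda>i\<in>{..<n}. x i + l * (y i - x i)) = poly p l"
    "\<forall>l. g (\<lambda>i\<in>{..<n}. x i + l * (y i - x i)) = poly q l" by blast
  then show ?case by (intro exI[of _ "p * q"]) (simp only: poly_mult simp_thms)
qed

lemma Zpoints_iff:
  "z \<in> Zpoints St \<longleftrightarrow> z \<in> extensional {..<nrays St} \<and> (\<exists>\<sigma>\<in>fan St. \<forall>i<nrays St. \<not> ray St i \<subseteq> \<sigma> \<longrightarrow> z i \<noteq> 0)"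
  by (auto simp: Zpoints_def PiE_def)

text \<open>The complex line through a point of each open set has parameters where the functions
  cutting out neighbourhoods are both nonzero, since these are nonzero polynomials along the
  line.\<close>

lemma irreducible_Zvar: "irreducible_funs (Zvar St) (coords (nrays St))"
proof unfold_locales
  show "funs (Zvar St) = function_algebra (coords (nrays St))" by (rule funs_Zvar)
  fix U V assume U: "zopen (Zvar St) U" and V: "zopen (Zvar St) V" and ne: "U \<noteq> {}" "V \<noteq> {}"
  let ?n = "nrays St"
  from ne obtain x y where xy: "x \<in> U" "y \<in> V" by blast
  with U V obtain f g where f: "f \<in> function_algebra (coords ?n)" "f x \<noteq> 0" "\<forall>z\<in>Zpoints St. f z \<noteq> 0 \<longrightarrow> z \<in> U"
    and g: "g \<in> function_algebra (coords ?n)" "g y \<noteq> 0" "\<forall>z\<in>Zpoints St. g z \<noteq> 0 \<longrightarrow> z \<in> V"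
    unfolding zopen_iff funs_Zvar points_Zvar by blast
  have x: "x \<in> Zpoints St" and y: "y \<in> Zpoints St"
    using xy zopen_subset[OF U] zopen_subset[OF V] by (auto simp: points_Zvar)
  then obtain \<sigma> where \<sigma>: "\<sigma> \<in> fan St" "\<forall>i<?n. \<not> ray St i \<subseteq> \<sigma> \<longrightarrow> x i \<noteq> 0"
    by (auto simp: Zpoints_iff)
  \<comment> \<open>A third function is required because the line may leave \<open>Z\<close>: where
    \<open>h\<close> is nonzero the point lies in the chart of \<sigma>, which is part of
    \<open>Z\<close>.\<close>
  define h where "h z = (\<Prod>i\<in>{i. i < ?n \<and> \<not> ray St i \<subseteq> \<sigma>}. z i)" for z :: pt
  have h: "h \<in> function_algebra (coords ?n)"
    unfolding h_def by (intro function_algebra_prod function_algebra.gen) (auto simp: coords_def)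
  define line where "line l = (\<lambda>i\<in>{..<?n}. x i + l * (y i - x i))" for l
  have x0: "line 0 = x" and y1: "line 1 = y"
    using x y by (auto simp: line_def Zpoints_iff intro!: extensionalityI[of _ "{..<?n}"])
  obtain p where p: "\<And>l. f (line l) = poly p l"
    using function_algebra_line[OF f(1)] unfolding line_def by metis
  obtain q where q: "\<And>l. g (line l) = poly q l"
    using function_algebra_line[OF g(1)] unfolding line_def by metis
  obtain r where r: "\<And>l. h (line l) = poly r l"
    using function_algebra_line[OF h] unfolding line_def by metis
  have "h x \<noteq> 0" using \<sigma> by (simp add: h_def)
  then have "poly p 0 \<noteq> 0" "poly q 1 \<noteq> 0" "poly r 0 \<noteq> 0"
    using f(2) g(2) p[of 0] q[of 1] r[of 0] x0 y1 by auto
  then have "p * q * r \<noteq> 0" by auto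
  then have "finite {l. poly (p * q * r) l = 0}" by (rule poly_roots_finite)
  then have "\<exists>l. l \<notin> {l. poly (p * q * r) l = 0}"
    using infinite_UNIV_char_0 ex_new_if_finite by blast
  then obtain l where l: "poly p l \<noteq> 0" "poly q l \<noteq> 0" "poly r l \<noteq> 0" by auto
  have "h (line l) \<noteq> 0" using l r by simp
  then have "line l \<in> Zpoints St"
    unfolding Zpoints_iff using \<sigma>(1) by (auto simp: h_def line_def)
  then have "line l \<in> U \<inter> V"
    using f(3) g(3) l p q by auto
  then show "U \<inter> V \<noteq> {}" by blast
qed

lemma zopen_chart:
  assumes "\<sigma> \<in> fan St"
  shows "zopen (Zvar St) (chart St \<sigma>)"
proof -
  let ?J = "{i. i < nrays St \<and> \<not> ray St i \<subseteq> \<sigma>}"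
  let ?h = "\<lambda>z :: pt. \<Prod>i\<in>?J. z i"
  have h: "?h \<in> function_algebra (coords (nrays St))"
    by (intro function_algebra_prod function_algebra.gen) (auto simp: coords_def)
  have nz: "?h z \<noteq> 0 \<longleftrightarrow> (\<forall>i<nrays St. \<not> ray St i \<subseteq> \<sigma> \<longrightarrow> z i \<noteq> 0)" for z
    by auto
  show ?thesis
    unfolding zopen_iff funs_Zvar points_Zvar
  proof (intro conjI subsetI ballI bexI[of _ ?h] h)
    fix z assume z: "z \<in> chart St \<sigma>"
    then show "z \<in> Zpoints St" using assms by (auto simp: chart_def Zpoints_iff PiE_def)
    show "?h z \<noteq> 0" using z unfolding nz by (auto simp: chart_def)
    show "?h y \<noteq> 0 \<longrightarrow> y \<in> chart St \<sigma>" if "y \<in> Zpoints St" for y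
      using that unfolding nz by (auto simp: chart_def Zpoints_iff PiE_def)
  qed
qed

lemma chart_nonempty: "chart St \<sigma> \<noteq> {}"
proof -
  have "(\<lambda>i\<in>{..<nrays St}. 1) \<in> chart St \<sigma>" by (auto simp: chart_def)
  then show ?thesis by blast
qed

section \<open>The action of the torus\<close>

lemma Cstar_simps [simp]:
  "carrier Cstar = UNIV - {0}" "x \<otimes>\<^bsub>Cstar\<^esub> y = x * y" "\<one>\<^bsub>Cstar\<^esub> = 1"
  by (simp_all add: Cstar_def)

lemma hom_group_simps [simp]:
  "carrier (hom_group A B) = hom A B \<inter> extensional (carrier A)"
  "f \<otimes>\<^bsub>hom_group A B\<^esub> g = (\<lambda>x\<in>carrier A. f x \<otimes>\<^bsub>B\<^esub> g x)"
  "\<one>\<^bsub>hom_group A B\<^esub> = (\<lambda>x\<in>carrier A. \<one>\<^bsub>B\<^esub>)"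
  by (simp_all add: hom_group_def)

lemma XT_simps [simp]:
  "carrier (XT St) = ({..<dimn St} \<rightarrow>\<^sub>E UNIV)"
  "m \<otimes>\<^bsub>XT St\<^esub> m' = (\<lambda>j\<in>{..<dimn St}. m j + m' j)"
  "\<one>\<^bsub>XT St\<^esub> = (\<lambda>j\<in>{..<dimn St}. 0)"
  by (simp_all add: XT_def Zpow_def)

lemma torus_simps [simp]:
  "carrier (torus St) = ({..<dimn St} \<rightarrow>\<^sub>E UNIV - {0})"
  "t \<otimes>\<^bsub>torus St\<^esub> t' = (\<lambda>j\<in>{..<dimn St}. t j * t' j)"
  "\<one>\<^bsub>torus St\<^esub> = (\<lambda>j\<in>{..<dimn St}. 1)"
  by (simp_all add: torus_def)

lemma beta_dual_closed:
  assumes "i < nrays St"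
  shows "beta_dual St i \<in> carrier (DG St)"
proof -
  have "(\<lambda>y\<in>carrier (cone_src St). fst y i) \<in> carrier (hom_group (cone_src St) integer_group)"
    using assms by (auto simp: hom_def cone_src_def Zpow_def PiE_def)
  then show ?thesis
    by (auto simp: beta_dual_def DG_def FactGroup_def RCOSETS_def)
qed

lemma alpha_nonzero:
  assumes "g \<in> carrier (Ggrp St)" "i < nrays St"
  shows "alpha St i g \<noteq> 0"
  using assms beta_dual_closed[OF assms(2)] by (auto simp: alpha_def Ggrp_def hom_def Pi_def)

lemma charval_nonzero: "t \<in> carrier (torus St) \<Longrightarrow> charval St m t \<noteq> 0"
  by (auto simp: charval_def power_int_eq_0_iff PiE_def Pi_def)

lemma GT_comm: "g \<in> carrier (GT St) \<Longrightarrow> h \<in> carrier (GT St) \<Longrightarrow> g \<otimes>\<^bsub>GT St\<^esub> h = h \<otimes>\<^bsub>GT St\<^esub> g"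
  by (cases g; cases h) (auto simp: GT_def Ggrp_def mult.commute)

lemma function_algebra_scale:
  assumes "f \<in> function_algebra (coords n)"
  shows "(\<lambda>z. f (\<lambda>i\<in>{..<n}. c i * z i)) \<in> function_algebra (coords n)"
  using assms
proof (induction rule: function_algebra.induct)
  case (const c')
  then show ?case by (rule function_algebra.const)
next
  case (gen f)
  then obtain i where i: "i < n" "f = (\<lambda>z. z i)" by (auto simp: coords_def)
  have "(\<lambda>z. c i * z i) \<in> function_algebra (coords n)"
    using i by (intro function_algebra.mult function_algebra.const function_algebra.gen) (auto simp: coords_def)
  then show ?case using i by simp
next
  case (add f g)
  show ?case using function_algebra.add[OF add.IH] .
next
  case (mult f g)
  show ?case using function_algebra.mult[OF mult.IH] .
qed

text \<open>The action rescales each coordinate by a nonzero number, so the set of vanishing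
  coordinates, which decides membership in \<open>Z\<close>, is preserved.\<close>

lemma act_point:
  assumes "h \<in> carrier (GT St)" "z \<in> Zpoints St"
  shows "act St h z \<in> Zpoints St"
proof -
  have nz: "alpha St i (fst h) \<noteq> 0" "charval St m (snd h) \<noteq> 0" if "i < nrays St" for i m
  proof -
    have "fst h \<in> carrier (Ggrp St)" "snd h \<in> carrier (torus St)"
      using assms(1) by (auto simp: GT_def simp del: torus_simps)
    then show "alpha St i (fst h) \<noteq> 0" "charval St m (snd h) \<noteq> 0"
      using alpha_nonzero[OF _ that] charval_nonzero by blast+
  qed
  obtain \<sigma> where "\<sigma> \<in> fan St" "\<forall>i<nrays St. \<not> ray St i \<subseteq> \<sigma> \<longrightarrow> z i \<noteq> 0"
    using assms(2) unfolding Zpoints_iff by blast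
  then show ?thesis
    using nz unfolding Zpoints_iff by (intro conjI bexI[of _ \<sigma>]) (auto simp: act_def)
qed

lemma zopen_preim_act:
  assumes h: "h \<in> carrier (GT St)" and U: "zopen (Zvar St) U"
  shows "zopen (Zvar St) (preim (Zvar St) (act St) h U)"
  unfolding zopen_iff funs_Zvar points_Zvar
proof (intro conjI ballI)
  show "preim (Zvar St) (act St) h U \<subseteq> Zpoints St"
    by (auto simp: preim_def points_Zvar)
  fix z assume z: "z \<in> preim (Zvar St) (act St) h U"
  then obtain f where f: "f \<in> function_algebra (coords (nrays St))" "f (act St h z) \<noteq> 0"
    "\<forall>y\<in>Zpoints St. f y \<noteq> 0 \<longrightarrow> y \<in> U"
    using U unfolding zopen_iff funs_Zvar points_Zvar preim_def by blast
  have "(\<lambda>z. f (act St h z)) \<in> function_algebra (coords (nrays St))"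
    unfolding act_def by (rule function_algebra_scale[OF f(1)])
  moreover have "\<forall>y\<in>Zpoints St. f (act St h y) \<noteq> 0 \<longrightarrow> y \<in> preim (Zvar St) (act St) h U"
    using f(3) act_point[OF h] by (simp add: preim_def points_Zvar)
  ultimately show "\<exists>f\<in>function_algebra (coords (nrays St)). f z \<noteq> 0 \<and>
      (\<forall>y\<in>Zpoints St. f y \<noteq> 0 \<longrightarrow> y \<in> preim (Zvar St) (act St) h U)"
    using f(2) by (intro bexI[of _ "\<lambda>z. f (act St h z)"]) auto
qed

text \<open>For fixed \<open>h\<close>, generators from \<open>G\<close> and the torus become
  constants and only the coordinates of \<open>Z\<close> survive.\<close>

lemma funs_slice:
  assumes "f \<in> funs (GTZ St)"
  shows "(\<lambda>z. f (h, z)) \<in> funs (Zvar St)"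
proof -
  from assms have "f \<in> function_algebra ({(\<lambda>((g, t), z). g x) | x. x \<in> carrier (DG St)} \<union>
        {(\<lambda>((g, t), z). t j) | j. j < dimn St} \<union>
        {(\<lambda>((g, t), z). inverse (t j)) | j. j < dimn St} \<union>
        {(\<lambda>((g, t), z). z i) | i. i < nrays St})"
    by (simp add: GTZ_def)
  then have "(\<lambda>z. f (h, z)) \<in> function_algebra (coords (nrays St))"
  proof (induction rule: function_algebra.induct)
    case (const c)
    show ?case by (rule function_algebra.const)
  next
    case (gen f)
    then consider c where "\<And>z. f (h, z) = c" | i where "i < nrays St" "\<And>z. f (h, z) = z i"
      by (cases h) auto
    then show ?case
    proof cases
      case (1 c)
      then show ?thesis using function_algebra.const[of c] by simp
    next
      case (2 i)
      then show ?thesis using function_algebra.gen[of "\<lambda>z. z i" "coords (nrays St)"] by (auto simp: coords_def)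
    qed
  next
    case (add f g)
    show ?case by (rule function_algebra.add[OF add.IH])
  next
    case (mult f g)
    show ?case by (rule function_algebra.mult[OF mult.IH])
  qed
  then show ?thesis by (simp add: funs_Zvar)
qed

lemma zopen_slice_GTZ:
  assumes h: "h \<in> carrier (GT St)" and \<Omega>: "zopen (GTZ St) \<Omega>"
  shows "zopen (Zvar St) {z. (h, z) \<in> \<Omega>}"
  unfolding zopen_iff
proof (intro conjI ballI)
  have pt: "points (GTZ St) = carrier (GT St) \<times> points (Zvar St)"
    by (simp add: GTZ_def Zvar_def)
  show "{z. (h, z) \<in> \<Omega>} \<subseteq> points (Zvar St)"
    using zopen_subset[OF \<Omega>] unfolding pt by auto
  fix z assume "z \<in> {z. (h, z) \<in> \<Omega>}"
  then obtain f where "f \<in> funs (GTZ St)" "f (h, z) \<noteq> 0" "\<forall>y\<in>points (GTZ St). f y \<noteq> 0 \<longrightarrow> y \<in> \<Omega>"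
    using \<Omega> unfolding zopen_iff by blast
  then show "\<exists>f\<in>funs (Zvar St). f z \<noteq> 0 \<and> (\<forall>y\<in>points (Zvar St). f y \<noteq> 0 \<longrightarrow> y \<in> {z. (h, z) \<in> \<Omega>})"
    using h funs_slice[of f St h] unfolding pt by (intro bexI[of _ "\<lambda>z. f (h, z)"]) auto
qed

lemma regular_slice_GTZ:
  assumes h: "h \<in> carrier (GT St)" and f: "f \<in> regular (GTZ St) \<Omega>"
  shows "(\<lambda>z\<in>{z. (h, z) \<in> \<Omega>}. f (h, z)) \<in> regular (Zvar St) {z. (h, z) \<in> \<Omega>}"
proof (rule regularI)
  fix z assume "z \<in> {z. (h, z) \<in> \<Omega>}"
  then have "(h, z) \<in> \<Omega>" by simp
  then obtain V p q where V: "zopen (GTZ St) V" "(h, z) \<in> V" "V \<subseteq> \<Omega>" "p \<in> funs (GTZ St)" "q \<in> funs (GTZ St)"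
    "\<forall>y\<in>V. q y \<noteq> 0 \<and> f y = p y / q y"
    using regularD[OF f] by blast
  have "zopen (Zvar St) {z. (h, z) \<in> V} \<and> z \<in> {z. (h, z) \<in> V} \<and> {z. (h, z) \<in> V} \<subseteq> {z. (h, z) \<in> \<Omega>} \<and>
    (\<lambda>z. p (h, z)) \<in> funs (Zvar St) \<and> (\<lambda>z. q (h, z)) \<in> funs (Zvar St) \<and>
    (\<forall>y\<in>{z. (h, z) \<in> V}. q (h, y) \<noteq> 0 \<and> f (h, y) = p (h, y) / q (h, y))"
    using V zopen_slice_GTZ[OF h V(1)] funs_slice[OF V(4)] funs_slice[OF V(5)] by auto
  then show "\<exists>V p q. zopen (Zvar St) V \<and> z \<in> V \<and> V \<subseteq> {z. (h, z) \<in> \<Omega>} \<and> p \<in> funs (Zvar St) \<and>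
      q \<in> funs (Zvar St) \<and> (\<forall>y\<in>V. q y \<noteq> 0 \<and> f (h, y) = p y / q y)"
    by (intro exI[of _ "{z. (h, z) \<in> V}"] exI[of _ "\<lambda>z. p (h, z)"] exI[of _ "\<lambda>z. q (h, z)"])
qed

lemma equivariant_sheaf_toric:
  assumes "toric_sheaf St F"
  shows "equivariant_sheaf (Zvar St) (coords (nrays St)) F (GT St) (GTZ St) (act St)"
proof -
  interpret irreducible_funs "Zvar St" "coords (nrays St)" by (rule irreducible_Zvar)
  show ?thesis
    using assms zopen_preim_act zopen_slice_GTZ regular_slice_GTZ
    by unfold_locales (auto simp: toric_sheaf_def coherent_def)
qed

section \<open>A torus element of finite order\<close>

lemma common_denominator:
  fixes c :: "'i \<Rightarrow> rat"
  assumes "finite I"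
  obtains D :: nat and k :: "'i \<Rightarrow> int" where "0 < D" "\<And>i. i \<in> I \<Longrightarrow> of_nat D * c i = of_int (k i)"
proof -
  have "\<exists>D::nat. 0 < D \<and> (\<forall>i\<in>I. \<exists>k::int. of_nat D * c i = of_int k)"
    using assms
  proof (induction I rule: finite_induct)
    case (insert i I)
    then obtain D :: nat where D: "0 < D" "\<forall>i\<in>I. \<exists>k::int. of_nat D * c i = of_int k" by blast
    obtain a b where ab: "c i = of_int a / of_int b" "0 < b"
      by (cases "c i") (auto simp: Fract_of_int_quotient)
    have "of_nat (D * nat b) * c i = of_int (int D * a)"
      using ab by simp
    then have "\<exists>k::int. of_nat (D * nat b) * c i = of_int k" by blast
    moreover have "\<exists>k::int. of_nat (D * nat b) * c j = of_int k" if "j \<in> I" for j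
    proof -
      from D that obtain k :: int where "of_nat D * c j = of_int k" by blast
      then have "of_nat (D * nat b) * c j = of_int (b * k)"
        using ab(2) by (simp add: mult.commute mult.left_commute)
      then show ?thesis by blast
    qed
    moreover have "0 < D * nat b" using D(1) ab(2) by simp
    ultimately show ?case by blast
  qed auto
  then show thesis using that by metis
qed

text \<open>Induction as in the extension of a dual basis: a vector \<open>v\<close> is found that
  pairs to \<open>1\<close> with the new \<open>m a\<close> and to \<open>0\<close> with the old
  ones, and each old dual vector is corrected by a multiple of \<open>v\<close>.\<close>

lemma dual_vectors:
  fixes m :: "'i \<Rightarrow> nat \<Rightarrow> rat"
  assumes "finite I" "\<And>c. (\<forall>j<d. (\<Sum>i\<in>I. c i * m i j) = 0) \<Longrightarrow> \<forall>i\<in>I. c i = 0"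
  shows "\<exists>w. \<forall>i\<in>I. \<forall>k\<in>I. (\<Sum>j<d. m i j * w k j) = (if i = k then 1 else 0)"
  using assms
proof (induction I rule: finite_induct)
  case empty
  then show ?case by simp
next
  case (insert a I)
  have "\<forall>i\<in>I. c i = 0" if c: "\<forall>j<d. (\<Sum>i\<in>I. c i * m i j) = 0" for c
  proof -
    have "(\<Sum>i\<in>insert a I. (c(a := 0)) i * m i j) = (\<Sum>i\<in>I. c i * m i j)" for j
      using insert.hyps by (auto intro!: sum.cong)
    then have "\<forall>i\<in>insert a I. (c(a := 0)) i = 0"
      using c by (intro insert.prems) simp
    then have "c i = 0" if "i \<in> I" for i
      using that insert.hyps(2) by (cases "i = a") auto
    then show ?thesis by blast
  qed
  from insert.IH[OF this] obtain w where
    w: "\<forall>i\<in>I. \<forall>k\<in>I. (\<Sum>j<d. m i j * w k j) = (if i = k then 1 else 0)" by blast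
  define ip where "ip u v = (\<Sum>j<d. u j * v j)" for u v :: "nat \<Rightarrow> rat"
  have ip_w: "ip (m i) (w k) = (if i = k then 1 else 0)" if "i \<in> I" "k \<in> I" for i k
    using w that by (simp add: ip_def)
  \<comment> \<open>The residue of \<open>m a\<close> after removing the combination of the other
    \<open>m k\<close> seen by the functionals \<open>w k\<close>. Independence forces some entry
    among the first \<open>d\<close> to be nonzero.\<close>
  define r where "r j = m a j - (\<Sum>k\<in>I. ip (m a) (w k) * m k j)" for j
  have "\<exists>j<d. r j \<noteq> 0"
  proof (rule ccontr)
    assume neg: "\<not> (\<exists>j<d. r j \<noteq> 0)"
    define c where "c i = (if i = a then 1 else - ip (m a) (w i))" for i
    have "(\<Sum>i\<in>insert a I. c i * m i j) = r j" for j
    proof -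
      have "(\<Sum>i\<in>I. c i * m i j) = - (\<Sum>k\<in>I. ip (m a) (w k) * m k j)"
        unfolding sum_negf[symmetric] using insert.hyps by (intro sum.cong) (auto simp: c_def)
      then show ?thesis using insert.hyps by (simp add: r_def c_def)
    qed
    then have "\<forall>i\<in>insert a I. c i = 0"
      using neg by (intro insert.prems) simp
    then show False by (simp add: c_def)
  qed
  then obtain j0 where j0: "j0 < d" "r j0 \<noteq> 0" by blast
  \<comment> \<open>The coordinate functional at \<open>j0\<close>, corrected to vanish on the old
    vectors. Its value on \<open>m a\<close> before division is \<open>r j0\<close>, which fixes the
    normalisation.\<close>
  define v where "v j = ((if j = j0 then 1 else 0) - (\<Sum>k\<in>I. m k j0 * w k j)) / r j0" for j
  have ip_v: "ip u v = (u j0 - (\<Sum>k\<in>I. m k j0 * ip u (w k))) / r j0" for u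
  proof -
    have "ip u v = ((\<Sum>j<d. u j * (if j = j0 then 1 else 0)) - (\<Sum>j<d. u j * (\<Sum>k\<in>I. m k j0 * w k j))) / r j0"
      by (simp add: ip_def v_def sum_divide_distrib[symmetric] sum_subtractf[symmetric] right_diff_distrib)
    also have "(\<Sum>j<d. u j * (if j = j0 then 1 else 0)) = u j0"
      using j0 by (simp add: if_distrib cong: if_cong)
    also have "(\<Sum>j<d. u j * (\<Sum>k\<in>I. m k j0 * w k j)) = (\<Sum>k\<in>I. m k j0 * ip u (w k))"
      unfolding ip_def sum_distrib_left by (subst sum.swap) (simp add: mult_ac)
    finally show ?thesis .
  qed
  have v_I: "ip (m i) v = 0" if "i \<in> I" for i
  proof -
    have "(\<Sum>k\<in>I. m k j0 * ip (m i) (w k)) = (\<Sum>k\<in>I. if k = i then m k j0 else 0)"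
      using ip_w that by (intro sum.cong) auto
    then show ?thesis using insert.hyps that by (simp add: ip_v)
  qed
  have v_a: "ip (m a) v = 1"
    using j0(2) by (simp add: ip_v r_def mult.commute)
  \<comment> \<open>Subtracting this multiple of \<open>v\<close> makes the old functionals vanish
    on \<open>m a\<close>; their values on the old vectors do not change because \<open>v\<close>
    vanishes there.\<close>
  define w' where "w' k = (if k = a then v else (\<lambda>j. w k j - ip (m a) (w k) * v j))" for k
  have "ip u (\<lambda>j. x j - y * v j) = ip u x - y * ip u v" for u x y
    by (simp add: ip_def right_diff_distrib sum_subtractf sum_distrib_left mult_ac)
  then have ip_w': "ip u (w' k) = ip u (w k) - ip (m a) (w k) * ip u v" if "k \<noteq> a" for u k
    using that by (simp add: w'_def)
  have "ip (m i) (w' k) = (if i = k then 1 else 0)" if "i \<in> insert a I" "k \<in> insert a I" for i k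
  proof (cases "k = a")
    case True
    then show ?thesis using that v_I v_a by (auto simp: w'_def)
  next
    case False
    then show ?thesis using that v_I v_a insert.hyps ip_w by (auto simp: ip_w')
  qed
  then show ?case unfolding ip_def by blast
qed

text \<open>Take the dual vector of \<open>m i0\<close> and clear its denominators by
  \<open>N\<close>. The resulting integral \<open>W\<close> pairs to \<open>0\<close> or
  \<open>N\<close> with the \<open>m i\<close>, but to \<open>N\<close> times \<open>r i0\<close>
  with \<open>c\<close>, which is not a multiple of \<open>N\<close> as \<open>r i0\<close> is not
  an integer.\<close>

lemma torsion_functional:
  fixes m :: "'i \<Rightarrow> nat \<Rightarrow> int" and c :: "nat \<Rightarrow> int" and r :: "'i \<Rightarrow> rat"
  assumes fin: "finite I"
    and indep: "\<And>a :: 'i \<Rightarrow> int. (\<forall>j<d. (\<Sum>i\<in>I. a i * m i j) = 0) \<Longrightarrow> \<forall>i\<in>I. a i = 0"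
    and c: "\<And>j. j < d \<Longrightarrow> of_int (c j) = (\<Sum>i\<in>I. r i * of_int (m i j))"
    and i0: "i0 \<in> I" "r i0 \<notin> \<int>"
  obtains N :: nat and W where "0 < N" "\<And>i. i \<in> I \<Longrightarrow> int N dvd (\<Sum>j<d. m i j * W j)"
    "\<not> int N dvd (\<Sum>j<d. c j * W j)"
proof -
  \<comment> \<open>Independence is given for integer coefficients; a common denominator carries it
    over to rational ones.\<close>
  have "\<forall>i\<in>I. a i = 0" if a: "\<forall>j<d. (\<Sum>i\<in>I. a i * (of_int (m i j) :: rat)) = 0" for a
  proof -
    obtain D :: nat and k where D: "0 < D" "\<And>i. i \<in> I \<Longrightarrow> of_nat D * a i = of_int (k i)"
      using common_denominator[OF fin, of a] by blast
    have "(\<Sum>i\<in>I. k i * m i j) = 0" if "j < d" for j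
    proof -
      have "of_int (\<Sum>i\<in>I. k i * m i j) = (\<Sum>i\<in>I. (of_nat D * a i) * (of_int (m i j) :: rat))"
        unfolding of_int_sum of_int_mult using D(2) by (intro sum.cong) auto
      also have "\<dots> = of_nat D * (\<Sum>i\<in>I. a i * of_int (m i j))"
        by (simp add: sum_distrib_left mult.assoc)
      finally have "of_int (\<Sum>i\<in>I. k i * m i j) = (of_int 0 :: rat)" using a that by simp
      then show ?thesis by (simp only: of_int_eq_iff)
    qed
    then have "\<forall>i\<in>I. k i = 0" using indep by blast
    then have "a i = 0" if "i \<in> I" for i
      using D(1) D(2)[OF that] that by simp
    then show ?thesis by blast
  qed
  then have "\<exists>w. \<forall>i\<in>I. \<forall>k\<in>I. (\<Sum>j<d. (of_int (m i j) :: rat) * w k j) = (if i = k then 1 else 0)"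
    by (intro dual_vectors fin)
  then obtain w where
    w: "\<forall>i\<in>I. \<forall>k\<in>I. (\<Sum>j<d. (of_int (m i j) :: rat) * w k j) = (if i = k then 1 else 0)" ..
  obtain N :: nat and W where N: "0 < N" "\<And>j. j \<in> {..<d} \<Longrightarrow> of_nat N * w i0 j = of_int (W j)"
    using common_denominator[of "{..<d}" "w i0"] by blast
  have pair: "of_int (\<Sum>j<d. a j * W j) = of_nat N * (\<Sum>j<d. (of_int (a j) :: rat) * w i0 j)" for a
    unfolding of_int_sum of_int_mult sum_distrib_left
    using N(2) by (intro sum.cong) (auto simp: mult.left_commute)
  have "of_int (\<Sum>j<d. m i j * W j) = (of_int (if i = i0 then int N else 0) :: rat)" if "i \<in> I" for i
    unfolding pair using w that i0(1) by simp
  then have "(\<Sum>j<d. m i j * W j) = (if i = i0 then int N else 0)" if "i \<in> I" for i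
    using that of_int_eq_iff by blast
  then have "int N dvd (\<Sum>j<d. m i j * W j)" if "i \<in> I" for i
    using that by simp
  moreover have "\<not> int N dvd (\<Sum>j<d. c j * W j)"
  proof
    assume "int N dvd (\<Sum>j<d. c j * W j)"
    then obtain k where k: "(\<Sum>j<d. c j * W j) = int N * k" by blast
    have "(\<Sum>j<d. (of_int (c j) :: rat) * w i0 j) = (\<Sum>j<d. \<Sum>i\<in>I. r i * (of_int (m i j) * w i0 j))"
      using c by (intro sum.cong) (auto simp: sum_distrib_right mult.assoc)
    also have "\<dots> = (\<Sum>i\<in>I. r i * (\<Sum>j<d. of_int (m i j) * w i0 j))"
      by (subst sum.swap) (simp add: sum_distrib_left)
    also have "\<dots> = (\<Sum>i\<in>I. if i = i0 then r i else 0)"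
      using w i0(1) by (intro sum.cong) auto
    also have "\<dots> = r i0"
      using fin i0(1) by simp
    finally have "of_nat N * r i0 = of_nat N * of_int k"
      using pair[of c] k by auto
    then have "r i0 = of_int k" using N(1) by simp
    then show False using i0(2) by simp
  qed
  ultimately show thesis using that N(1) by blast
qed

section \<open>Roots of unity with integer exponents\<close>

definition zeta :: "nat \<Rightarrow> int \<Rightarrow> complex" where
  "zeta N k = cis (2 * pi * of_int k / of_nat N)"

lemma zeta_add: "zeta N (k + l) = zeta N k * zeta N l"
  by (simp add: zeta_def cis_mult add_divide_distrib ring_distribs)

lemma zeta_0 [simp]: "zeta N 0 = 1"
  by (simp add: zeta_def)

lemma zeta_nonzero [simp]: "zeta N k \<noteq> 0"
  by (simp add: zeta_def)

lemma zeta_powi: "zeta N k powi l = zeta N (k * l)"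
  by (simp add: zeta_def cis_power_int mult_ac)

lemma zeta_power: "zeta N k ^ n = zeta N (int n * k)"
  using zeta_powi[of N k "int n"] by (simp add: mult.commute)

lemma zeta_sum: "finite A \<Longrightarrow> zeta N (\<Sum>i\<in>A. f i) = (\<Prod>i\<in>A. zeta N (f i))"
  by (induction A rule: finite_induct) (auto simp: zeta_add)

lemma zeta_eq_1_iff: "0 < N \<Longrightarrow> zeta N k = 1 \<longleftrightarrow> int N dvd k"
proof -
  assume N: "0 < N"
  have "zeta N k = 1 \<longleftrightarrow> (\<exists>n. 2 * pi * of_int k / of_nat N = of_int n * (2 * pi))"
    by (simp add: zeta_def cis_eq_1_iff)
  also have "\<dots> \<longleftrightarrow> (\<exists>n. real_of_int k = real_of_int (int N * n))"
    using N by (simp add: field_simps)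
  also have "\<dots> \<longleftrightarrow> int N dvd k"
    unfolding of_int_eq_iff dvd_def ..
  finally show ?thesis .
qed

lemma zeta_eq_iff: "0 < N \<Longrightarrow> zeta N k = zeta N l \<longleftrightarrow> int N dvd k - l"
  using zeta_eq_1_iff[of N "k - l"] zeta_add[of N "k - l" l] by auto

section \<open>The group \<open>DG(\<beta>)\<close>\<close>

lemma comm_group_hom_group:
  assumes "group A"
  shows "comm_group (hom_group A integer_group)"
proof -
  interpret group A by (rule assms)
  show ?thesis
  proof (rule comm_groupI)
    fix f assume f: "f \<in> carrier (hom_group A integer_group)"
    then have "(\<lambda>x\<in>carrier A. - f x) \<in> carrier (hom_group A integer_group)"
      by (auto simp: hom_def)
    moreover have "(\<lambda>x\<in>carrier A. - f x) \<otimes>\<^bsub>hom_group A integer_group\<^esub> f = \<one>\<^bsub>hom_group A integer_group\<^esub>"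
      by (auto intro: restrict_ext)
    ultimately show "\<exists>g\<in>carrier (hom_group A integer_group).
        g \<otimes>\<^bsub>hom_group A integer_group\<^esub> f = \<one>\<^bsub>hom_group A integer_group\<^esub>" by blast
    show "\<one>\<^bsub>hom_group A integer_group\<^esub> \<otimes>\<^bsub>hom_group A integer_group\<^esub> f = f"
      using f by (auto intro!: extensionalityI[of _ "carrier A"])
  qed (auto simp: hom_def intro!: restrict_ext)
qed

lemma group_Zpow: "group (Zpow k)"
  by (simp add: Zpow_def)

lemma Zpow_simps [simp]:
  "carrier (Zpow k) = ({..<k} \<rightarrow>\<^sub>E UNIV)"
  "x \<otimes>\<^bsub>Zpow k\<^esub> y = (\<lambda>j\<in>{..<k}. x j + y j)"
  by (simp_all add: Zpow_def)

text \<open>The subgroup divided out is the image of a homomorphism, the transpose \<open>T\<close>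
  of \<open>cone_map\<close>. In the commutative group of integer-valued homomorphisms it is normal,
  so the quotient is a group.\<close>

lemma group_DG:
  assumes "is_resolved St"
  shows "group (DG St)"
proof -
  let ?H = "hom_group (cone_src St) integer_group"
  let ?P = "hom_group (Zpow (ngens St)) integer_group"
  have src: "group (cone_src St)"
    unfolding cone_src_def by (intro DirProd_group group_Zpow)
  interpret H: comm_group ?H by (rule comm_group_hom_group[OF src])
  interpret P: comm_group ?P by (rule comm_group_hom_group[OF group_Zpow])
  have b: "blift St \<in> hom (Zpow (nrays St)) (Zpow (ngens St))"
    and r: "rmap St \<in> hom (Zpow (nrels St)) (Zpow (ngens St))"
    using assms by (simp_all add: is_resolved_def)
  have cm: "cone_map St \<in> hom (cone_src St) (Zpow (ngens St))"
  proof (rule homI)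
    fix x assume "x \<in> carrier (cone_src St)"
    then show "cone_map St x \<in> carrier (Zpow (ngens St))"
      by (auto simp: cone_map_def cone_src_def)
  next
    fix x y assume xy: "x \<in> carrier (cone_src St)" "y \<in> carrier (cone_src St)"
    obtain x1 x2 y1 y2 where eq: "x = (x1, x2)" "y = (y1, y2)" by (cases x; cases y)
    have "blift St (x1 \<otimes>\<^bsub>Zpow (nrays St)\<^esub> y1) = blift St x1 \<otimes>\<^bsub>Zpow (ngens St)\<^esub> blift St y1"
      using xy eq by (intro hom_mult[OF b]) (auto simp: cone_src_def)
    moreover have "rmap St (x2 \<otimes>\<^bsub>Zpow (nrels St)\<^esub> y2) = rmap St x2 \<otimes>\<^bsub>Zpow (ngens St)\<^esub> rmap St y2"
      using xy eq by (intro hom_mult[OF r]) (auto simp: cone_src_def)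
    ultimately have "cone_map St (x \<otimes>\<^bsub>cone_src St\<^esub> y) =
        (blift St x1 \<otimes>\<^bsub>Zpow (ngens St)\<^esub> blift St y1) \<otimes>\<^bsub>Zpow (ngens St)\<^esub>
        (rmap St x2 \<otimes>\<^bsub>Zpow (ngens St)\<^esub> rmap St y2)"
      by (simp only: eq cone_map_def cone_src_def mult_DirProd prod.case)
    then show "cone_map St (x \<otimes>\<^bsub>cone_src St\<^esub> y) = cone_map St x \<otimes>\<^bsub>Zpow (ngens St)\<^esub> cone_map St y"
      by (auto simp: eq cone_map_def intro!: restrict_ext)
  qed
  define T where "T \<phi> = restrict (\<phi> \<circ> cone_map St) (carrier (cone_src St))" for \<phi> :: "(nat \<Rightarrow> int) \<Rightarrow> int"
  have "T \<in> hom ?P ?H"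
  proof (rule homI)
    fix \<phi> assume "\<phi> \<in> carrier ?P"
    then have "\<phi> \<circ> cone_map St \<in> hom (cone_src St) integer_group"
      using hom_compose[OF cm] by auto
    then show "T \<phi> \<in> carrier ?H"
      using group.is_monoid[OF src] by (auto simp: T_def hom_def monoid.m_closed)
  next
    fix \<phi> \<psi> assume "\<phi> \<in> carrier ?P" "\<psi> \<in> carrier ?P"
    then show "T (\<phi> \<otimes>\<^bsub>?P\<^esub> \<psi>) = T \<phi> \<otimes>\<^bsub>?H\<^esub> T \<psi>"
      using cm unfolding T_def hom_group_simps by (intro restrict_ext) (auto simp: hom_def)
  qed
  then interpret T: group_hom ?P ?H T
    by unfold_locales
  have "cone_dual_image St = T ` carrier ?P"
    by (simp add: cone_dual_image_def T_def[abs_def])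
  then have "subgroup (cone_dual_image St) ?H"
    using T.img_is_subgroup by simp
  then have "cone_dual_image St \<lhd> ?H"
    by (simp add: H.normal_iff_subgroup)
  then show ?thesis
    unfolding DG_def by (rule normal.factorgroup_is_group)
qed

section \<open>Decomposing a toric sheaf\<close>

lemma slice_submodule_eq:
  "slice_submodule St F \<sigma> = ideal_sections F (chart St \<sigma>)
     (\<lambda>i. \<lambda>z\<in>chart St \<sigma>. z i - 1) ({..<nrays St} - cone_rays St \<sigma>)"
  unfolding slice_submodule_def ideal_sections_def by (rule refl)

lemma regular_slice_coordinate:
  assumes "\<sigma> \<in> fan St" "i < nrays St"
  shows "(\<lambda>z\<in>chart St \<sigma>. z i - 1) \<in> regular (Zvar St) (chart St \<sigma>)"
proof -
  interpret irreducible_funs "Zvar St" "coords (nrays St)" by (rule irreducible_Zvar)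
  have "(\<lambda>z. z i + (-1)) \<in> funs (Zvar St)"
    using assms(2) unfolding funs_Zvar
    by (intro function_algebra.add function_algebra.const function_algebra.gen) (auto simp: coords_def)
  moreover have "(\<lambda>z\<in>chart St \<sigma>. z i - 1) = restrict (\<lambda>z. z i + (-1)) (chart St \<sigma>)"
    by (intro restrict_ext) simp
  ultimately show ?thesis
    by (simp only: regular_fun[OF zopen_chart[OF assms(1)]])
qed

lemma charval_mult:
  assumes "t \<in> carrier (torus St)"
  shows "charval St (m \<otimes>\<^bsub>XT St\<^esub> m') t = charval St m t * charval St m' t"
proof -
  have "t j \<noteq> 0" if "j < dimn St" for j
    using assms that by (auto simp: PiE_def Pi_def)
  then have "charval St (m \<otimes>\<^bsub>XT St\<^esub> m') t = (\<Prod>j<dimn St. t j powi m j * t j powi m' j)"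
    unfolding charval_def by (intro prod.cong) (auto simp: power_int_add)
  then show ?thesis by (simp add: charval_def prod.distrib)
qed

text \<open>Composing \<open>clift St \<sigma>\<close> with evaluation of characters at
  \<open>t\<close> gives a homomorphism from \<open>DG\<close> to the nonzero complex numbers, that
  is, a point of \<open>G\<close>.\<close>

lemma slice_elt_closed:
  assumes St: "is_resolved St" and act: "torus_action St" and \<sigma>: "\<sigma> \<in> top_cones St"
    and t: "t \<in> carrier (torus St)"
  shows "slice_elt St \<sigma> t \<in> carrier (GT St)"
proof -
  interpret DG: group "DG St" by (rule group_DG[OF St])
  have lift: "clift St \<sigma> \<in> hom (DG St) (XT St)"
    using act \<sigma> by (simp add: torus_action_def)
  have "(\<lambda>x\<in>carrier (DG St). charval St (clift St \<sigma> x) t) \<in> hom (DG St) Cstar"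
  proof (rule homI)
    fix x assume "x \<in> carrier (DG St)"
    then show "(\<lambda>x\<in>carrier (DG St). charval St (clift St \<sigma> x) t) x \<in> carrier Cstar"
      using charval_nonzero[OF t] by simp
  next
    fix x y assume xy: "x \<in> carrier (DG St)" "y \<in> carrier (DG St)"
    then show "(\<lambda>x\<in>carrier (DG St). charval St (clift St \<sigma> x) t) (x \<otimes>\<^bsub>DG St\<^esub> y) =
        (\<lambda>x\<in>carrier (DG St). charval St (clift St \<sigma> x) t) x \<otimes>\<^bsub>Cstar\<^esub>
        (\<lambda>x\<in>carrier (DG St). charval St (clift St \<sigma> x) t) y"
      using hom_mult[OF lift xy] charval_mult[OF t] by (simp del: XT_simps)
  qed
  then show ?thesis
    using t by (simp add: slice_elt_def GT_def Ggrp_def)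
qed

lemma act_slice_elt:
  assumes "t \<in> carrier (torus St)"
  shows "act St (slice_elt St \<sigma> t) z = (\<lambda>i\<in>{..<nrays St}. charval St (chart_char St \<sigma> i) t * z i)"
  unfolding act_def slice_elt_def alpha_def chart_char_def charval_mult[OF assms]
  by (intro restrict_ext) (simp add: beta_dual_closed)

lemma preim_chart:
  assumes "\<sigma> \<in> fan St" "h \<in> carrier (GT St)"
  shows "preim (Zvar St) (act St) h (chart St \<sigma>) = chart St \<sigma>"
proof -
  have h: "fst h \<in> carrier (Ggrp St)" "snd h \<in> carrier (torus St)"
    using assms(2) by (auto simp: GT_def simp del: torus_simps)
  have "act St h z i \<noteq> 0 \<longleftrightarrow> z i \<noteq> 0" if "i < nrays St" for z i
    using that alpha_nonzero[OF h(1) that] charval_nonzero[OF h(2)] by (simp add: act_def)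
  then have "act St h z \<in> chart St \<sigma> \<longleftrightarrow> z \<in> chart St \<sigma>" if "z \<in> extensional {..<nrays St}" for z
    using that by (auto simp: chart_def PiE_def act_def)
  then show ?thesis
    using zopen_subset[OF zopen_chart[OF assms(1)]]
    by (auto simp: preim_def points_Zvar Zpoints_iff chart_def PiE_def)
qed

text \<open>A weight space other than the trivial one yields a section that has the weight modulo
  the slice ideal but does not lie in its multiples. These are the sections whose components in the
  splitting are tested.\<close>

lemma nonzero_box_summandE:
  assumes St: "is_resolved St" and act: "torus_action St" and F: "toric_sheaf St F"
    and top: "\<sigma> \<in> top_cones St" and nz: "nonzero_box_summand St F \<sigma> b"
  obtains l s where "s \<in> carrier (sect F (chart St \<sigma>))" "s \<notin> slice_submodule St F \<sigma>"
    "\<forall>t\<in>carrier (torus St). lin F (slice_elt St \<sigma> t) (chart St \<sigma>) s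
       \<ominus>\<^bsub>sect F (chart St \<sigma>)\<^esub> cscale F (chart St \<sigma>)
         (charval St (\<lambda>j\<in>{..<dimn St}. b j + (\<Sum>i\<in>cone_rays St \<sigma>. l i * chart_char St \<sigma> i j)) t) s
       \<in> slice_submodule St F \<sigma>"
proof -
  interpret equivariant_sheaf "Zvar St" "coords (nrays St)" F "GT St" "GTZ St" "act St"
    by (rule equivariant_sheaf_toric[OF F])
  let ?U = "chart St \<sigma>" and ?I = "slice_submodule St F \<sigma>"
  have \<sigma>: "\<sigma> \<in> fan St" using top by (simp add: top_cones_def)
  have U: "zopen (Zvar St) ?U" by (rule zopen_chart[OF \<sigma>])
  interpret U: abelian_group "sect F ?U" by (rule abelian_group_sect[OF U])
  have fin: "finite ({..<nrays St} - cone_rays St \<sigma>)" by simp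
  have g: "\<forall>i\<in>{..<nrays St} - cone_rays St \<sigma>. (\<lambda>z\<in>?U. z i - 1) \<in> regular (Zvar St) ?U"
    using regular_slice_coordinate[OF \<sigma>] by blast
  note coset = ideal_sections_coset[OF U fin g, folded slice_submodule_eq]
    and zero = ideal_sections_zero[OF U fin g, folded slice_submodule_eq]
  from nz obtain l where l: "box_summand St F \<sigma> b l \<noteq> {?I}"
    unfolding nonzero_box_summand_def by blast
  define m where "m = (\<lambda>j\<in>{..<dimn St}. b j + (\<Sum>i\<in>cone_rays St \<sigma>. l i * chart_char St \<sigma> i j))"
  let ?w = "\<lambda>t s. lin F (slice_elt St \<sigma> t) ?U s \<ominus>\<^bsub>sect F ?U\<^esub> cscale F ?U (charval St m t) s"
  have S: "S_family St F \<sigma> m = {?I +>\<^bsub>sect F ?U\<^esub> s | s. s \<in> carrier (sect F ?U) \<and>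
      (\<forall>t\<in>carrier (torus St). ?w t s \<in> ?I)}"
    unfolding S_family_def cscale_def by (rule refl)
  have "\<exists>s. s \<in> carrier (sect F ?U) \<and> (\<forall>t\<in>carrier (torus St). ?w t s \<in> ?I) \<and> s \<notin> ?I"
  proof (rule ccontr)
    assume neg: "\<not> (\<exists>s. s \<in> carrier (sect F ?U) \<and> (\<forall>t\<in>carrier (torus St). ?w t s \<in> ?I) \<and> s \<notin> ?I)"
    have "C = ?I" if "C \<in> S_family St F \<sigma> m" for C
    proof -
      from that obtain s where s: "C = ?I +>\<^bsub>sect F ?U\<^esub> s" "s \<in> carrier (sect F ?U)"
        "\<forall>t\<in>carrier (torus St). ?w t s \<in> ?I"
        unfolding S by blast
      then have "s \<in> ?I" using neg by blast
      then show ?thesis using s(1) coset by simp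
    qed
    \<comment> \<open>A set of cosets could also differ from \<open>{?I}\<close> by being empty. The
      zero section has every weight and rules this out.\<close>
    moreover have "?I \<in> S_family St F \<sigma> m"
    proof -
      have "?w t \<zero>\<^bsub>sect F ?U\<^esub> \<in> ?I" if t: "t \<in> carrier (torus St)" for t
      proof -
        note k = slice_elt_closed[OF St act top t]
        have "lin F (slice_elt St \<sigma> t) ?U \<zero>\<^bsub>sect F ?U\<^esub> = \<zero>\<^bsub>sect F ?U\<^esub>"
          using lin_cscale[OF k U zero_closed[OF U], of 0] lin_closed[OF k U zero_closed[OF U]]
          by (simp add: preim_chart[OF \<sigma> k] cscale_zero[OF U] cscale_0[OF U])
        moreover have "\<zero>\<^bsub>sect F ?U\<^esub> \<ominus>\<^bsub>sect F ?U\<^esub> \<zero>\<^bsub>sect F ?U\<^esub> = \<zero>\<^bsub>sect F ?U\<^esub>"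
          using U.r_neg[OF U.zero_closed] by (simp only: a_minus_def)
        ultimately show ?thesis
          using zero by (simp add: cscale_zero[OF U])
      qed
      then show ?thesis
        unfolding S using coset[OF zero] zero_closed[OF U] by blast
    qed
    ultimately have "S_family St F \<sigma> m = {?I}" by blast
    then show False using l by (simp add: box_summand_def m_def)
  qed
  then show thesis using that unfolding m_def by blast
qed

section \<open>From an equivariant splitting to a decomposition of toric sheaves\<close>

lemma toric_subsheaf_fixed:
  assumes F: "toric_sheaf St F"
    and eq: "equivariant_sheaf.equivariant_endo (Zvar St) F (GT St) (act St) \<phi>"
    and idem: "idempotent_endo (Zvar St) (coords (nrays St)) F \<phi>"
  shows "toric_subsheaf St (fixed_sheaf \<phi> F) F"
proof -
  interpret equivariant_sheaf "Zvar St" "coords (nrays St)" F "GT St" "GTZ St" "act St"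
    by (rule equivariant_sheaf_toric[OF F])
  interpret idempotent_endo "Zvar St" "coords (nrays St)" F \<phi> by (rule idem)
  have "toric_sheaf St E"
    using coherent_fixed linearised_fixed[OF eq idem] F
    unfolding toric_sheaf_def by blast
  then show ?thesis
    unfolding toric_subsheaf_def by (auto simp: fixed_sheaf_def)
qed

text \<open>The isomorphism sends a section to its pair of components, with addition as inverse.
  Each witness serves twice: the \<psi>-part of \<open>t\<close> shows that \<open>E2\<close> is
  nonzero and that \<open>E1\<close> has smaller rank, and the \<phi>-part of \<open>s\<close> does
  the same with the roles exchanged.\<close>

lemma equivariantly_decomposable_complementary:
  fixes F :: "'m tsheaf"
  assumes F: "toric_sheaf St F" and refl: "reflexive_sheaf (Zvar St) F"
    and compl: "complementary_endos (Zvar St) (coords (nrays St)) F \<phi> \<psi>"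
    and eq1: "equivariant_sheaf.equivariant_endo (Zvar St) F (GT St) (act St) \<phi>"
    and eq2: "equivariant_sheaf.equivariant_endo (Zvar St) F (GT St) (act St) \<psi>"
    and U: "zopen (Zvar St) U" "U \<noteq> {}"
    and s: "s \<in> carrier (sect F U)" "\<phi> U s \<noteq> \<zero>\<^bsub>sect F U\<^esub>"
    and t: "t \<in> carrier (sect F U)" "\<psi> U t \<noteq> \<zero>\<^bsub>sect F U\<^esub>"
  shows "equivariantly_decomposable St F"
proof -
  interpret equivariant_sheaf "Zvar St" "coords (nrays St)" F "GT St" "GTZ St" "act St"
    by (rule equivariant_sheaf_toric[OF F])
  interpret complementary_endos "Zvar St" "coords (nrays St)" F \<phi> \<psi> by (rule compl)
  interpret I1: idempotent_endo "Zvar St" "coords (nrays St)" F \<phi> by (rule idempotent1)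
  interpret I2: idempotent_endo "Zvar St" "coords (nrays St)" F \<psi> by (rule idempotent2)
  have ft: "finite_type (Zvar St) F" using F by (simp add: toric_sheaf_def coherent_def)
  have inj: "inj_on (bidual_map (Zvar St) F V) (carrier (sect F V))" if "zopen (Zvar St) V" for V
    using refl that by (auto simp: reflexive_sheaf_def bij_betw_def)
  have s1: "\<phi> U s \<in> carrier (sect E1 U)" and t1: "\<psi> U t \<in> carrier (sect E2 U)"
    using endo_closed[OF endo1 U(1) s(1)] endo_closed[OF endo2 U(1) t(1)]
      I1.idem[OF U(1) s(1)] I2.idem[OF U(1) t(1)] by auto
  have r1: "sheaf_rank (Zvar St) E1 < sheaf_rank (Zvar St) F"
    by (rule sheaf_rank_less[OF ft inj U t1 t(2)])
  have r2: "sheaf_rank (Zvar St) E2 < sheaf_rank (Zvar St) F"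
    by (rule complementary_endos.sheaf_rank_less[OF swap ft inj U s1 s(2)])
  have z1: "\<not> zero_sheaf (Zvar St) E1" and z2: "\<not> zero_sheaf (Zvar St) E2"
    unfolding zero_sheaf_def using U(1) s1 t1 s(2) t(2) by auto
  define D where "D j = (if j = (0::nat) then E1 else E2)" for j
  have D: "D 0 = E1" "D 1 = E2" by (simp_all add: D_def)
  have two: "{..<2} = {0, 1::nat}" by auto
  define \<theta> where "\<theta> V x = (\<lambda>j\<in>{..<2::nat}. if j = 0 then \<phi> V x else \<psi> V x)" for V x
  have eqI: "f = g" if "f \<in> extensional {..<2}" "g \<in> extensional {..<2}" "f 0 = g 0" "f 1 = g 1"
    for f g :: "nat \<Rightarrow> 'm"
    using that by (intro extensionalityI[of _ "{..<2}"]) (auto simp: two)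
  have \<theta>01: "\<theta> V x 0 = \<phi> V x" "\<theta> V x 1 = \<psi> V x" "\<theta> V x (Suc 0) = \<psi> V x" "\<theta> V x \<in> extensional {..<2}" for V x
    by (simp_all add: \<theta>_def)
  have c1: "\<phi> V x \<in> carrier (sect E1 V)" and c2: "\<psi> V x \<in> carrier (sect E2 V)"
    if "zopen (Zvar St) V" "x \<in> carrier (sect F V)" for V x
    using that endo_closed[OF endo1] endo_closed[OF endo2] I1.idem I2.idem by auto
  have bij: "bij_betw (\<theta> V) (carrier (sect F V)) (carrier (sect (direct_sum 2 D) V))"
    if V: "zopen (Zvar St) V" for V
  proof (rule bij_betw_byWitness[where f' = "\<lambda>x. x 0 \<oplus>\<^bsub>sect F V\<^esub> x 1"])
    interpret V: abelian_group "sect F V" by (rule abelian_group_sect[OF V])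
    show "\<forall>x\<in>carrier (sect F V). \<theta> V x 0 \<oplus>\<^bsub>sect F V\<^esub> \<theta> V x 1 = x"
      using sum[OF V] by (simp only: \<theta>01) blast
    have mem: "x 0 \<in> carrier (sect E1 V)" "x 1 \<in> carrier (sect E2 V)" "x \<in> extensional {..<2}"
      if "x \<in> carrier (sect (direct_sum 2 D) V)" for x
    proof -
      have "x \<in> (\<Pi>\<^sub>E j\<in>{..<2}. carrier (sect (D j) V))"
        using that by (simp add: direct_sum_def)
      from PiE_mem[OF this, of 0] PiE_mem[OF this, of 1] this
      show "x 0 \<in> carrier (sect E1 V)" "x 1 \<in> carrier (sect E2 V)" "x \<in> extensional {..<2}"
        by (simp_all only: D PiE_def) simp_all
    qed
    show "\<forall>x\<in>carrier (sect (direct_sum 2 D) V). \<theta> V (x 0 \<oplus>\<^bsub>sect F V\<^esub> x 1) = x"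
    proof
      fix x assume x: "x \<in> carrier (sect (direct_sum 2 D) V)"
      note m = mem[OF x]
      have mF: "x 0 \<in> carrier (sect F V)" "x 1 \<in> carrier (sect F V)" "\<phi> V (x 0) = x 0" "\<psi> V (x 1) = x 1"
        using m(1,2) by auto
      have "\<phi> V (x 0 \<oplus>\<^bsub>sect F V\<^esub> x 1) = x 0"
        using endo_add[OF endo1 V mF(1,2)] endo_other_vanishes(1)[OF V m(2)] mF by simp
      moreover have "\<psi> V (x 0 \<oplus>\<^bsub>sect F V\<^esub> x 1) = x 1"
        using endo_add[OF endo2 V mF(1,2)] endo_other_vanishes(2)[OF V m(1)] mF by simp
      ultimately show "\<theta> V (x 0 \<oplus>\<^bsub>sect F V\<^esub> x 1) = x"
        using m(3) by (intro eqI) (simp_all add: \<theta>01)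
    qed
    show "\<theta> V ` carrier (sect F V) \<subseteq> carrier (sect (direct_sum 2 D) V)"
    proof (intro image_subsetI)
      fix x assume x: "x \<in> carrier (sect F V)"
      have "\<theta> V x j \<in> carrier (sect (D j) V)" if "j < 2" for j
        using c1[OF V x] c2[OF V x] that unfolding \<theta>_def D_def by (cases "j = 0") simp_all
      then show "\<theta> V x \<in> carrier (sect (direct_sum 2 D) V)"
        using \<theta>01(4) by (simp add: direct_sum_def PiE_iff)
    qed
    show "(\<lambda>x. x 0 \<oplus>\<^bsub>sect F V\<^esub> x 1) ` carrier (sect (direct_sum 2 D) V) \<subseteq> carrier (sect F V)"
    proof (intro image_subsetI)
      fix x assume "x \<in> carrier (sect (direct_sum 2 D) V)"
      from mem(1,2)[OF this] show "x 0 \<oplus>\<^bsub>sect F V\<^esub> x 1 \<in> carrier (sect F V)"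
        by (intro add_closed[OF V]) simp_all
    qed
  qed
  have "toric_iso St F (direct_sum 2 D)"
    unfolding toric_iso_def
  proof (intro exI[of _ \<theta>] allI impI conjI ballI bij)
    fix V x assume V: "zopen (Zvar St) V" and x: "x \<in> carrier (sect F V)"
    show "\<theta> V (x \<oplus>\<^bsub>sect F V\<^esub> y) = \<theta> V x \<oplus>\<^bsub>sect (direct_sum 2 D) V\<^esub> \<theta> V y"
      if "y \<in> carrier (sect F V)" for y
      using endo_add[OF endo1 V x that] endo_add[OF endo2 V x that]
      by (intro eqI) (simp_all add: \<theta>01 direct_sum_def D_def)
    show "\<theta> V (f \<odot>\<^bsub>sect F V\<^esub> x) = f \<odot>\<^bsub>sect (direct_sum 2 D) V\<^esub> \<theta> V x"
      if "f \<in> regular (Zvar St) V" for f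
      using endo_smult[OF endo1 V x that] endo_smult[OF endo2 V x that]
      by (intro eqI) (simp_all add: \<theta>01 direct_sum_def D_def)
    show "\<theta> W (res F V W x) = res (direct_sum 2 D) V W (\<theta> V x)"
      if "zopen (Zvar St) W \<and> W \<subseteq> V" for W
      using endo_res[OF endo1 V x] endo_res[OF endo2 V x] that
      by (intro eqI) (simp_all add: \<theta>01 direct_sum_def D_def)
    show "\<theta> (preim (Zvar St) (act St) h V) (lin F h V x) = lin (direct_sum 2 D) h V (\<theta> V x)"
      if h: "h \<in> carrier (GT St)" for h
      using equivariant_endoD(2)[OF eq1 h V x] equivariant_endoD(2)[OF eq2 h V x]
      by (intro eqI) (simp_all add: \<theta>01 direct_sum_def D_def)
  qed
  moreover have "toric_subsheaf St (D j) F \<and> \<not> zero_sheaf (Zvar St) (D j) \<and>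
      sheaf_rank (Zvar St) (D j) < sheaf_rank (Zvar St) F" for j
    using toric_subsheaf_fixed[OF F eq1 idempotent1] toric_subsheaf_fixed[OF F eq2 idempotent2]
      r1 r2 z1 z2 by (simp add: D_def)
  ultimately show ?thesis
    unfolding equivariantly_decomposable_def by (intro exI[of _ 2] exI[of _ D]) simp
qed

theorem theorem3p11:
  fixes St :: "('g, 'v::ab_group_add) toric_stack"
    and F :: "'m tsheaf"
    and \<sigma> :: "'v set"
  assumes "smooth_toric_DM_stack St"
    and "torus_action St"
    and "toric_sheaf St F"
    and "reflexive_sheaf (Zvar St) F"
    and "\<sigma> \<in> top_cones St"
    and "\<exists>b \<in> box St \<sigma>. \<exists>b' \<in> box St \<sigma>. b \<noteq> b' \<and>
           nonzero_box_summand St F \<sigma> b \<and> nonzero_box_summand St F \<sigma> b'"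
  shows "equivariantly_decomposable St F"
proof -
  note act = assms(2) and F = assms(3) and top = assms(5)
  have res: "is_resolved St" using assms(1) by (simp add: smooth_toric_DM_stack_def)
  have \<sigma>: "\<sigma> \<in> fan St" using top by (simp add: top_cones_def)
  let ?d = "dimn St" and ?I = "cone_rays St \<sigma>" and ?m = "chart_char St \<sigma>" and ?U = "chart St \<sigma>"
  from assms(6) obtain b b' where b: "b \<in> box St \<sigma>" "nonzero_box_summand St F \<sigma> b"
    and b': "b' \<in> box St \<sigma>" "nonzero_box_summand St F \<sigma> b'" and ne: "b \<noteq> b'" by blast
  from b(1) obtain q :: "nat \<Rightarrow> rat" where bX: "b \<in> carrier (XT St)" and q: "\<forall>i\<in>?I. 0 \<le> q i \<and> q i < 1"
    "\<forall>j<?d. of_int (b j) = (\<Sum>i\<in>?I. q i * of_int (?m i j))" unfolding box_def by blast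
  from b'(1) obtain q' :: "nat \<Rightarrow> rat" where bX': "b' \<in> carrier (XT St)" and q': "\<forall>i\<in>?I. 0 \<le> q' i \<and> q' i < 1"
    "\<forall>j<?d. of_int (b' j) = (\<Sum>i\<in>?I. q' i * of_int (?m i j))" unfolding box_def by blast
  have finI: "finite ?I" by (simp add: cone_rays_def)
  have "\<exists>i\<in>?I. q i \<noteq> q' i"
  proof (rule ccontr)
    assume "\<not> (\<exists>i\<in>?I. q i \<noteq> q' i)"
    then have "of_int (b j) = (of_int (b' j) :: rat)" if "j < ?d" for j
      using q(2) q'(2) that by simp
    then have "b = b'"
      using bX bX' by (intro extensionalityI[of _ "{..<?d}"]) (auto simp: PiE_def)
    with ne show False by simp
  qed
  then obtain i0 where i0: "i0 \<in> ?I" "q i0 \<noteq> q' i0" by blast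
  \<comment> \<open>Box coordinates lie in the half-open unit interval, so two unequal ones differ
    by a nonzero number of absolute value below \<open>1\<close>.\<close>
  have "q i0 - q' i0 \<notin> \<int>"
  proof
    assume "q i0 - q' i0 \<in> \<int>"
    then obtain z where z: "q i0 - q' i0 = of_int z" by (auto elim: Ints_cases)
    have "-1 < q i0 - q' i0" "q i0 - q' i0 < 1" using q(1) q'(1) i0(1) by fastforce+
    then have "-1 < z" "z < 1" unfolding z by simp_all
    then show False using z i0(2) by simp
  qed
  moreover have "of_int (b j - b' j) = (\<Sum>i\<in>?I. (q i - q' i) * of_int (?m i j))" if "j < ?d" for j
    using q(2) q'(2) that by (simp add: left_diff_distrib sum_subtractf)
  moreover have "\<And>a :: nat \<Rightarrow> int. (\<forall>j<?d. (\<Sum>i\<in>?I. a i * ?m i j) = 0) \<Longrightarrow> \<forall>i\<in>?I. a i = 0"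
    using act top unfolding torus_action_def by blast
  ultimately obtain N :: nat and W where N: "0 < N"
    and dvd: "\<And>i. i \<in> ?I \<Longrightarrow> int N dvd (\<Sum>j<?d. ?m i j * W j)"
    and ndvd: "\<not> int N dvd (\<Sum>j<?d. (b j - b' j) * W j)"
    using torsion_functional[OF finI, of ?d ?m "\<lambda>j. b j - b' j" "\<lambda>i. q i - q' i" i0] i0(1) by blast
  \<comment> \<open>The pairing with \<open>W\<close> becomes an exponent modulo \<open>N\<close>:
    the torus element with coordinates \<open>zeta N (W j)\<close> has value
    \<open>zeta N (pr m)\<close> at the character \<open>m\<close>.\<close>
  define pr where "pr m = (\<Sum>j<?d. m j * W j)" for m
  \<comment> \<open>All powers are written down explicitly, \<open>t n\<close> being the
    \<open>n\<close>-th power of \<open>t 1\<close>, so that finite order can be read off from the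
    exponents.\<close>
  define t where "t n = (\<lambda>j\<in>{..<?d}. zeta N (int n * W j))" for n :: nat
  define k where "k n = slice_elt St \<sigma> (t n)" for n
  have t_torus: "t n \<in> carrier (torus St)" for n by (simp add: t_def)
  have cv: "charval St m (t n) = zeta N (int n * pr m)" for m n
    by (simp add: charval_def t_def pr_def zeta_powi zeta_sum sum_distrib_left mult_ac)
  have k_GT: "k n \<in> carrier (GT St)" for n
    unfolding k_def by (rule slice_elt_closed[OF res act top t_torus])
  have k_Suc: "k (Suc n) = k n \<otimes>\<^bsub>GT St\<^esub> k 1" for n
  proof -
    have "t (Suc n) = t n \<otimes>\<^bsub>torus St\<^esub> t 1"
      by (auto simp: t_def zeta_add[symmetric] ring_distribs add.commute intro!: restrict_ext)
    moreover have "charval St m (t (Suc n)) = charval St m (t n) * charval St m (t 1)" for m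
      by (simp add: cv zeta_add[symmetric] ring_distribs add.commute)
    ultimately show ?thesis
      by (intro prod_eqI) (auto simp: k_def slice_elt_def GT_def Ggrp_def mult_DirProd'
          simp del: torus_simps intro!: restrict_ext)
  qed
  have k_one: "k n = \<one>\<^bsub>GT St\<^esub>" if "int N dvd int n" for n
  proof -
    have z: "zeta N (int n * l) = 1" for l using that N by (simp add: zeta_eq_1_iff)
    have "fst (k n) = fst \<one>\<^bsub>GT St\<^esub>"
      by (simp add: k_def slice_elt_def GT_def Ggrp_def cv z)
    moreover have "snd (k n) = snd \<one>\<^bsub>GT St\<^esub>"
      by (simp add: k_def slice_elt_def GT_def t_def z)
    ultimately show ?thesis by (rule prod_eqI)
  qed
  \<comment> \<open>For rays of the cone the choice of \<open>W\<close> makes the character value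
    \<open>1\<close>; for the other rays the character itself is trivial, because the slice is
    preserved. Together these cover every coordinate of a point of \<open>Z\<close>.\<close>
  have k_triv: "act St (k n) z = z" if z: "z \<in> points (Zvar St)" for n z
  proof -
    have "charval St (?m i) (t n) = 1" if "i < nrays St" for i
    proof (cases "i \<in> ?I")
      case True
      then show ?thesis using dvd[OF True] N by (simp add: cv zeta_eq_1_iff pr_def)
    next
      case False
      then have "?m i = \<one>\<^bsub>XT St\<^esub>"
        using act top that unfolding torus_action_def by blast
      then show ?thesis by (simp add: cv pr_def)
    qed
    then show ?thesis
      using z unfolding k_def act_slice_elt[OF t_torus]
      by (intro extensionalityI[of _ "{..<nrays St}"]) (auto simp: points_Zvar Zpoints_iff)
  qed
  interpret equivariant_sheaf "Zvar St" "coords (nrays St)" F "GT St" "GTZ St" "act St"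
    by (rule equivariant_sheaf_toric[OF F])
  have pow: "(lin F (k 1) V ^^ n) s = lin F (k n) V s"
    if V: "zopen (Zvar St) V" and s: "s \<in> carrier (sect F V)" for V s n
  proof (induction n)
    case 0
    then show ?case using k_one[of 0] lin_one[OF V s] by simp
  next
    case (Suc n)
    have "preim (Zvar St) (act St) (k n) V = V"
      using zopen_subset[OF V] k_triv by (auto simp: preim_def)
    then show ?case
      using Suc lin_mult[OF V s k_GT k_GT, of n 1] k_Suc[of n] by simp
  qed
  \<comment> \<open>The root of unity selected is the eigenvalue of \<open>k 1\<close> on the box
    summand of \<open>b\<close>.\<close>
  interpret L: finite_order_endo "Zvar St" "coords (nrays St)" F "GT St" "GTZ St" "act St"
    "lin F (k 1)" N "zeta N (pr b)"
  proof unfold_locales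
    show "equivariant_endo (lin F (k 1))"
      by (rule equivariant_endo_lin[OF k_GT k_triv GT_comm[OF k_GT]])
    show "(lin F (k 1) V ^^ N) s = s" if "zopen (Zvar St) V" "s \<in> carrier (sect F V)" for V s
      using pow[OF that] k_one[of N] lin_one[OF that] by simp
    show "zeta N (pr b) ^ N = 1"
      using N by (simp add: zeta_power zeta_eq_1_iff)
  qed (rule N)
  have U: "zopen (Zvar St) ?U" by (rule zopen_chart[OF \<sigma>])
  have fin: "finite ({..<nrays St} - ?I)" by simp
  have g: "\<forall>i\<in>{..<nrays St} - ?I. (\<lambda>z\<in>?U. z i - 1) \<in> regular (Zvar St) ?U"
    using regular_slice_coordinate[OF \<sigma>] by blast
  \<comment> \<open>Moving within a box summand adds integer multiples of the characters
    \<open>?m i\<close>, whose pairings with \<open>W\<close> are divisible by \<open>N\<close>. A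
    whole summand therefore has a single eigenvalue, whichever \<open>l\<close> witnesses that it is
    nonzero.\<close>
  have weight: "charval St (\<lambda>j\<in>{..<?d}. c j + (\<Sum>i\<in>?I. l i * ?m i j)) (t 1) = zeta N (pr c)" for c l
  proof -
    have "pr (\<lambda>j\<in>{..<?d}. c j + (\<Sum>i\<in>?I. l i * ?m i j)) = pr c + (\<Sum>j<?d. \<Sum>i\<in>?I. l i * (?m i j * W j))"
      by (simp add: pr_def distrib_right sum.distrib sum_distrib_right mult.assoc)
    also have "(\<Sum>j<?d. \<Sum>i\<in>?I. l i * (?m i j * W j)) = (\<Sum>i\<in>?I. l i * pr (?m i))"
      by (subst sum.swap) (simp add: pr_def sum_distrib_left)
    finally have "int N dvd pr (\<lambda>j\<in>{..<?d}. c j + (\<Sum>i\<in>?I. l i * ?m i j)) - pr c"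
      using dvd by (auto simp: pr_def intro!: dvd_sum)
    then show ?thesis
      by (simp only: cv of_nat_1 mult_1 zeta_eq_iff[OF N])
  qed
  have sec: "\<exists>s. s \<in> carrier (sect F ?U) \<and> s \<notin> slice_submodule St F \<sigma> \<and>
      lin F (k 1) ?U s \<ominus>\<^bsub>sect F ?U\<^esub> cscale F ?U (zeta N (pr c)) s \<in> slice_submodule St F \<sigma>"
    if c: "nonzero_box_summand St F \<sigma> c" for c
  proof -
    obtain l s where s: "s \<in> carrier (sect F ?U)" "s \<notin> slice_submodule St F \<sigma>"
      and w: "\<forall>t\<in>carrier (torus St).
        lin F (slice_elt St \<sigma> t) ?U s \<ominus>\<^bsub>sect F ?U\<^esub> cscale F ?U
         (charval St (\<lambda>j\<in>{..<?d}. c j + (\<Sum>i\<in>?I. l i * ?m i j)) t) s \<in> slice_submodule St F \<sigma>"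
      using nonzero_box_summandE[OF res act F top c] by blast
    from bspec[OF w t_torus, of 1] show ?thesis
      using s unfolding weight k_def by blast
  qed
  obtain s where s: "s \<in> carrier (sect F ?U)" "s \<notin> slice_submodule St F \<sigma>"
    "lin F (k 1) ?U s \<ominus>\<^bsub>sect F ?U\<^esub> cscale F ?U (zeta N (pr b)) s \<in> slice_submodule St F \<sigma>"
    using sec[OF b(2)] by blast
  obtain s' where s': "s' \<in> carrier (sect F ?U)" "s' \<notin> slice_submodule St F \<sigma>"
    "lin F (k 1) ?U s' \<ominus>\<^bsub>sect F ?U\<^esub> cscale F ?U (zeta N (pr b')) s' \<in> slice_submodule St F \<sigma>"
    using sec[OF b'(2)] by blast
  \<comment> \<open>The nondivisibility built into \<open>W\<close> separates the eigenvalues of the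
    two boxes, so the section from \<open>b'\<close> cannot lie entirely in the eigensheaf of
    \<open>b\<close>.\<close>
  have "pr b - pr b' = (\<Sum>j<?d. (b j - b' j) * W j)"
    by (simp add: pr_def left_diff_distrib sum_subtractf)
  then have "zeta N (pr b) \<noteq> zeta N (pr b')" using ndvd N by (simp add: zeta_eq_iff)
  then have nz': "L.coproj ?U s' \<noteq> \<zero>\<^bsub>sect F ?U\<^esub>"
    using L.coproj_nonzero[OF U fin g s'(1) s'(2,3)[unfolded slice_submodule_eq]] by simp
  have nz: "L.proj ?U s \<noteq> \<zero>\<^bsub>sect F ?U\<^esub>"
    using L.proj_nonzero[OF U fin g s(1) s(2,3)[unfolded slice_submodule_eq]] by simp
  show ?thesis
    by (rule equivariantly_decomposable_complementary[OF F assms(4) L.complementary_proj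
        L.equivariant_proj L.equivariant_coproj U chart_nonempty s(1) nz s'(1) nz'])
qed

end
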